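(* Let $G=(V,E)$ be a connected, infinite, locally finite, vertex-transitive graph. Let $G_n=(V_n,E_n)$ be a sequence of finite connected subgraphs of $G$ such that $|V_n|\to\infty$ and, for every $r>0$, $|\{v\in V_n : S(v,r)\not\subset G_n\}|=o(|V_n|)$. Assign i.i.d. nonnegative weights to the edges of $G$ with a non-degenerate distribution $\mu$ having finite $(4+\delta)$-th moment for some $\delta>0$, and let $M_n$ be the total weight of a minimal spanning tree of $G_n$ (with the inherited weights). Then (i) $\mathrm{Var}(M_n)=\Theta(|V_n|)$, and (ii) $(M_n-\mathbb{E}(M_n))/\sqrt{\mathrm{Var}(M_n)}$ converges in distribution to the standard normal $N(0,1)$.
   Context: For a vertex $v\in V$ and $r>0$, $S(v,r)$ denotes the subgraph of $G$ spanned by all vertices $v'\in V$ with $d_G(v',v)\le r$, where $d_G$ is the graph distance in $G$. A minimal spanning tree of a finite connected edge-weighted graph is a spanning tree minimizing the sum of its edge weights. *)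

theory Defs
  imports "HOL-Probability.Probability" "HOL-Library.Landau_Symbols"
begin

text \<open>Simple graphs: vertex type 'v, symmetric irreflexive adjacency relation E.
  Undirected edges are represented as two-element vertex sets.\<close>

definition gedges :: "('v \<Rightarrow> 'v \<Rightarrow> bool) \<Rightarrow> 'v set set" where
  "gedges E = {{u, v} | u v. E u v}"

definition locally_finite :: "('v \<Rightarrow> 'v \<Rightarrow> bool) \<Rightarrow> bool" where
  "locally_finite E \<longleftrightarrow> (\<forall>v. finite {u. E v u})"

definition graph_connected :: "('v \<Rightarrow> 'v \<Rightarrow> bool) \<Rightarrow> bool" where
  "graph_connected E \<longleftrightarrow> (\<forall>u v. E\<^sup>*\<^sup>* u v)"

definition graph_automorphism :: "('v \<Rightarrow> 'v \<Rightarrow> bool) \<Rightarrow> ('v \<Rightarrow> 'v) \<Rightarrow> bool" where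
  "graph_automorphism E f \<longleftrightarrow> bij f \<and> (\<forall>x y. E x y \<longleftrightarrow> E (f x) (f y))"

definition vertex_transitive :: "('v \<Rightarrow> 'v \<Rightarrow> bool) \<Rightarrow> bool" where
  "vertex_transitive E \<longleftrightarrow> (\<forall>u v. \<exists>f. graph_automorphism E f \<and> f u = v)"

definition gdist :: "('v \<Rightarrow> 'v \<Rightarrow> bool) \<Rightarrow> 'v \<Rightarrow> 'v \<Rightarrow> nat" where
  "gdist E u v = (LEAST n. (E ^^ n) u v)"

definition ball_vertices :: "('v \<Rightarrow> 'v \<Rightarrow> bool) \<Rightarrow> 'v \<Rightarrow> real \<Rightarrow> 'v set" where
  "ball_vertices E v r = {u. real (gdist E u v) \<le> r}"

definition ball_edges :: "('v \<Rightarrow> 'v \<Rightarrow> bool) \<Rightarrow> 'v \<Rightarrow> real \<Rightarrow> 'v set set" where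
  "ball_edges E v r = {{x, y} | x y. E x y \<and> x \<in> ball_vertices E v r \<and> y \<in> ball_vertices E v r}"

definition ball_within :: "('v \<Rightarrow> 'v \<Rightarrow> bool) \<Rightarrow> 'v \<Rightarrow> real \<Rightarrow> 'v set \<Rightarrow> 'v set set \<Rightarrow> bool" where
  "ball_within E v r V F \<longleftrightarrow> ball_vertices E v r \<subseteq> V \<and> ball_edges E v r \<subseteq> F"

definition is_subgraph :: "('v \<Rightarrow> 'v \<Rightarrow> bool) \<Rightarrow> 'v set \<Rightarrow> 'v set set \<Rightarrow> bool" where
  "is_subgraph E V F \<longleftrightarrow> F \<subseteq> gedges E \<and> (\<forall>e\<in>F. e \<subseteq> V)"

definition adj :: "'v set \<Rightarrow> 'v set set \<Rightarrow> 'v \<Rightarrow> 'v \<Rightarrow> bool" where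
  "adj V F u v \<longleftrightarrow> u \<in> V \<and> v \<in> V \<and> u \<noteq> v \<and> {u, v} \<in> F"

definition connected_on :: "'v set \<Rightarrow> 'v set set \<Rightarrow> bool" where
  "connected_on V F \<longleftrightarrow> (\<forall>u\<in>V. \<forall>v\<in>V. (adj V F)\<^sup>*\<^sup>* u v)"

definition is_cycle :: "'v set set \<Rightarrow> 'v list \<Rightarrow> bool" where
  "is_cycle F xs \<longleftrightarrow> length xs \<ge> 3 \<and> distinct xs \<and>
     (\<forall>i < length xs. {xs ! i, xs ! ((i + 1) mod length xs)} \<in> F)"

definition acyclic_edges :: "'v set set \<Rightarrow> bool" where
  "acyclic_edges F \<longleftrightarrow> \<not> (\<exists>xs. is_cycle F xs)"

definition spanning_tree :: "'v set \<Rightarrow> 'v set set \<Rightarrow> 'v set set \<Rightarrow> bool" where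
  "spanning_tree V F T \<longleftrightarrow> T \<subseteq> F \<and> connected_on V T \<and> acyclic_edges T"

definition mst_weight :: "'v set \<Rightarrow> 'v set set \<Rightarrow> ('v set \<Rightarrow> real) \<Rightarrow> real" where
  "mst_weight V F w = Min ((\<lambda>T. \<Sum>e\<in>T. w e) ` {T. spanning_tree V F T})"

end

theory Submission
  imports Defs
begin

text \<open>As a function of the weight \<open>x\<close> of a single edge \<open>e\<close>, the tree weight is \<open>A + min x a\<close>, where
  \<open>a\<close> is the minimax weight of a path joining the ends of \<open>e\<close> outside \<open>e\<close>. Following Chatterjee's
  perturbative form of Stein's method, resampling the edges one at a time gives, for the
  standardised tree weight \<open>S\<close>, that \<open>E (S exp (i t S))\<close> is \<open>i t E (T exp (i t S)) / Var\<close> up to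
  third moments, where \<open>T\<close> is a sum of products of two increments and \<open>E T = Var\<close>. Once \<open>T\<close>
  concentrates, the characteristic function of \<open>S\<close> almost solves \<open>\<phi>' t = - t \<phi> t\<close>.

  For concentration it suffices that \<open>a\<close> can be read off in a large ball around \<open>e\<close>. This fails only
  if, at some level \<open>p\<close>, both ends of \<open>e\<close> are joined to the boundary of the ball by edges of weight
  at most \<open>p\<close> but not to each other. In a subgraph with thin boundary the density of such edges is
  small by the Aizenman--Kesten--Newman exploration argument, hence by transitivity the probability
  of the event is small in the whole graph. The lower bound on the variance comes from the
  covariance of the tree weight with the total edge weight.\<close>

section \<open>Minimal spanning trees and single edge weights\<close>

text \<open>The law of the weights may have atoms, so minimal trees need not be unique; the proof
  therefore works with the threshold \<open>a\<close>, read level by level through connectivity at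
  \<open>p\<close>, and not with membership of an edge in the tree. The concentration of
  \<open>T\<close> asks for bounded local summands, whereas \<open>a\<close> and the weights are
  unbounded: hence the increments are discretised on a finite grid of levels of height
  \<open>real J * \<eta>\<close>, and a radius has to be found for finitely many levels only. The
  two-arm event is controlled through a single finite subgraph. Once the radius exceeds its
  diameter, both arms of an edge away from the boundary leave the subgraph through the boundary, so
  that the edge is closed and joins two different clusters of the boundary. The number of such edges
  is small compared with the volume if the boundary is, and vertex transitivity turns this density
  into a probability at every vertex.\<close>

lemma adj_sym: "adj V F u v \<Longrightarrow> adj V F v u"
  by (auto simp: adj_def insert_commute)

lemma adj_rtranclp_sym: "(adj V F)\<^sup>*\<^sup>* u v \<Longrightarrow> (adj V F)\<^sup>*\<^sup>* v u"
  by (metis sympD symp_rtranclp sympI adj_sym)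

lemma adj_rtranclp_subst:
  assumes "(adj V T)\<^sup>*\<^sup>* u v" "\<And>x y. adj V T x y \<Longrightarrow> (adj V' T')\<^sup>*\<^sup>* x y"
  shows "(adj V' T')\<^sup>*\<^sup>* u v"
  using assms(1) by (induction) (auto intro: assms(2) rtranclp_trans)

lemma adj_rtranclp_mono:
  assumes "(adj V T)\<^sup>*\<^sup>* u v" "V \<subseteq> V'" "T \<subseteq> T'"
  shows "(adj V' T')\<^sup>*\<^sup>* u v"
  by (rule adj_rtranclp_subst[OF assms(1)]) (use assms in \<open>auto simp: adj_def intro!: r_into_rtranclp\<close>)

lemma adj_rtranclp_in: "(adj V T)\<^sup>*\<^sup>* u v \<Longrightarrow> u \<in> V \<Longrightarrow> v \<in> V"
  by (induction rule: rtranclp_induct) (auto simp: adj_def)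

text \<open>Every \<open>T\<close>-path is rerouted step by step: a step along \<open>{x, y}\<close>
  follows the given \<open>T'\<close>-path, any other step stays in \<open>T'\<close>. All later
  surgery on spanning sets, deleting a cycle edge or exchanging two edges, is an instance.\<close>

lemma connected_on_exchange:
  assumes "connected_on V T" "T - {{x, y}} \<subseteq> T'" "(adj V T')\<^sup>*\<^sup>* x y"
  shows "connected_on V T'"
  unfolding connected_on_def
proof (intro ballI)
  fix a b assume "a \<in> V" "b \<in> V"
  hence "(adj V T)\<^sup>*\<^sup>* a b" using assms(1) by (auto simp: connected_on_def)
  thus "(adj V T')\<^sup>*\<^sup>* a b"
  proof (rule adj_rtranclp_subst)
    fix c d assume *: "adj V T c d"
    show "(adj V T')\<^sup>*\<^sup>* c d"
    proof (cases "{c, d} = {x, y}")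
      case True
      thus ?thesis using assms(3) adj_rtranclp_sym[OF assms(3)] by (auto simp: doubleton_eq_iff)
    next
      case False
      hence "adj V T' c d" using * assms(2) by (auto simp: adj_def)
      thus ?thesis by blast
    qed
  qed
qed

lemma rtranclp_crossing:
  assumes "R\<^sup>*\<^sup>* u v" "Q u" "\<not> Q v"
  obtains x y where "R x y" "Q x" "\<not> Q y"
  using assms by (induction arbitrary: thesis) blast+

text \<open>An edge of a cycle can be deleted because the rest of the cycle still joins its ends; in
  a finite set this ends without cycles.\<close>

lemma spanning_tree_exists:
  assumes "finite T" "connected_on V T" "\<And>e. e \<in> T \<Longrightarrow> e \<subseteq> V"
  shows "\<exists>T'\<subseteq>T. connected_on V T' \<and> acyclic_edges T'"
  using assms
proof (induction T rule: finite_psubset_induct)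
  case (psubset T)
  show ?case
  proof (cases "acyclic_edges T")
    case True
    thus ?thesis using psubset by blast
  next
    case False
    then obtain xs where xs: "length xs \<ge> 3" "distinct xs"
      "\<And>i. i < length xs \<Longrightarrow> {xs ! i, xs ! ((i + 1) mod length xs)} \<in> T"
      by (auto simp: acyclic_edges_def is_cycle_def)
    define g where "g = {xs ! 0, xs ! 1}"
    have "0 < length xs" "Suc 0 mod length xs = 1" using xs(1) by auto
    hence gT: "g \<in> T" using xs(3)[of 0] by (simp add: g_def)
    \<comment> \<open>The rest of the cycle: starting at index 1 keeps all steps different from
      \<open>g\<close>, and the closing edge back to \<open>xs ! 0\<close> is added separately
      below.\<close>
    have path: "(adj V (T - {g}))\<^sup>*\<^sup>* (xs ! 1) (xs ! k)" if "1 \<le> k" "k < length xs" for k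
      using that
    proof (induction k rule: nat_induct_at_least)
      case (Suc k)
      have "{xs ! k, xs ! Suc k} \<in> T" using xs(3)[of k] Suc by simp
      moreover have "{xs ! k, xs ! Suc k} \<noteq> g"
        using Suc.hyps Suc.prems nth_eq_iff_index_eq[OF xs(2), of k 0]
          nth_eq_iff_index_eq[OF xs(2), of "Suc k" 0] xs(1) \<open>0 < length xs\<close>
        unfolding g_def by (auto simp: doubleton_eq_iff)
      moreover have "xs ! k \<noteq> xs ! Suc k" using Suc xs by (simp add: nth_eq_iff_index_eq)
      ultimately have "adj V (T - {g}) (xs ! k) (xs ! Suc k)"
        using psubset.prems(2) by (auto simp: adj_def)
      thus ?case using Suc by (auto intro: rtranclp.rtrancl_into_rtrancl)
    qed auto
    define l where "l = length xs - 1"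
    have l: "l < length xs" "l \<ge> 2" "Suc l = length xs" using xs(1) by (auto simp: l_def)
    have "{xs ! l, xs ! 0} \<in> T" using xs(3)[of l] l by simp
    moreover have "{xs ! l, xs ! 0} \<noteq> g"
      using l xs(1,2) unfolding g_def by (auto simp: doubleton_eq_iff nth_eq_iff_index_eq)
    moreover have "xs ! l \<noteq> xs ! 0"
      using l xs(2) nth_eq_iff_index_eq[of xs l 0] \<open>0 < length xs\<close> by (cases l) auto
    ultimately have "adj V (T - {g}) (xs ! l) (xs ! 0)"
      using psubset.prems(2) by (auto simp: adj_def)
    hence "(adj V (T - {g}))\<^sup>*\<^sup>* (xs ! 1) (xs ! 0)"
      using path[of l] l by (auto intro: rtranclp.rtrancl_into_rtrancl)
    hence c: "connected_on V (T - {g})"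
      using connected_on_exchange[OF psubset.prems(1), of "xs ! 1" "xs ! 0" "T - {g}"]
      by (auto simp: g_def insert_commute)
    have "T - {g} \<subset> T" using gT by blast
    from psubset.IH[OF this c] psubset.prems(2) show ?thesis by blast
  qed
qed

text \<open>The minimum runs over all connected spanning edge sets, not only trees, so that
  acyclicity never has to be maintained under exchanges. Nonnegative weights are what identifies it
  with \<open>mst_weight\<close>.\<close>

definition cmin :: "'v set \<Rightarrow> 'v set set \<Rightarrow> ('v set \<Rightarrow> real) \<Rightarrow> real" where
  "cmin V F w = Min ((\<lambda>T. \<Sum>e\<in>T. w e) ` {T. T \<subseteq> F \<and> connected_on V T})"

text \<open>Every connected set contains a spanning tree, and dropping edges of nonnegative weight
  does not raise the sum; so the larger family of competitors has the same minimum.\<close>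

lemma mst_weight_eq_cmin:
  assumes "finite F" "\<And>e. e \<in> F \<Longrightarrow> e \<subseteq> V" "\<And>e. e \<in> F \<Longrightarrow> 0 \<le> w e" "connected_on V F"
  shows "mst_weight V F w = cmin V F w"
proof -
  let ?s = "\<lambda>T. \<Sum>e\<in>T. w e"
  let ?A = "{T. spanning_tree V F T}" and ?B = "{T. T \<subseteq> F \<and> connected_on V T}"
  have sub: "?A \<subseteq> ?B" by (auto simp: spanning_tree_def)
  have finB: "finite ?B" using assms(1) by simp
  have finA: "finite ?A" using sub finB by (rule finite_subset)
  have dom: "\<exists>T'\<in>?A. ?s T' \<le> ?s T" if "T \<in> ?B" for T
  proof -
    have fT: "finite T" using that assms(1) finite_subset by auto
    have TB: "T \<subseteq> F" "connected_on V T" using that by auto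
    have "e \<subseteq> V" if "e \<in> T" for e using TB(1) assms(2) that by blast
    from spanning_tree_exists[OF fT TB(2) this]
    obtain T' where T': "T' \<subseteq> T" "connected_on V T'" "acyclic_edges T'" by metis
    have "?s T' \<le> ?s T" by (rule sum_mono2[OF fT T'(1)]) (use TB assms(3) in blast)
    thus ?thesis using T' TB by (intro bexI[of _ T']) (auto simp: spanning_tree_def)
  qed
  have neB: "?B \<noteq> {}" using assms(4) by auto
  hence neA: "?A \<noteq> {}" using dom by blast
  show ?thesis unfolding mst_weight_def cmin_def
  proof (rule antisym)
    show "Min (?s ` ?A) \<le> Min (?s ` ?B)"
    proof (rule Min.boundedI)
      fix b assume "b \<in> ?s ` ?B"
      then obtain T where "T \<in> ?B" "b = ?s T" by blast
      then obtain T' where T': "T' \<in> ?A" "?s T' \<le> b" using dom by blast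
      have "Min (?s ` ?A) \<le> ?s T'" using finA T'(1) by (intro Min_le) auto
      thus "Min (?s ` ?A) \<le> b" using T'(2) by linarith
    qed (use finB neB in auto)
    show "Min (?s ` ?B) \<le> Min (?s ` ?A)"
      by (rule Min_antimono) (use sub finB neA in auto)
  qed
qed

lemma cmin_cong:
  assumes "\<And>e. e \<in> F \<Longrightarrow> w e = w' e"
  shows "cmin V F w = cmin V F w'"
  unfolding cmin_def by (intro arg_cong[of _ _ Min] image_cong refl sum.cong) (use assms in auto)

lemma cmin_attained:
  assumes "finite F" "connected_on V F"
  obtains T where "T \<subseteq> F" "connected_on V T" "cmin V F w = (\<Sum>e\<in>T. w e)"
proof -
  have "cmin V F w \<in> (\<lambda>T. \<Sum>e\<in>T. w e) ` {T. T \<subseteq> F \<and> connected_on V T}"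
    unfolding cmin_def by (rule Min_in) (use assms in auto)
  thus ?thesis using that by auto
qed

lemma abs_cmin_le:
  assumes "finite F" "connected_on V F"
  shows "\<bar>cmin V F w\<bar> \<le> (\<Sum>e\<in>F. \<bar>w e\<bar>)"
proof -
  obtain T where T: "T \<subseteq> F" "cmin V F w = (\<Sum>e\<in>T. w e)" using cmin_attained[OF assms] by metis
  have "\<bar>\<Sum>e\<in>T. w e\<bar> \<le> (\<Sum>e\<in>T. \<bar>w e\<bar>)" by (rule sum_abs)
  also have "\<dots> \<le> (\<Sum>e\<in>F. \<bar>w e\<bar>)" by (rule sum_mono2) (use assms T in auto)
  finally show ?thesis using T by simp
qed

text \<open>Add the edges of \<open>H\<close> to \<open>S\<close> one at a time: the first that
  joins \<open>u\<close> to \<open>v\<close> is the required \<open>g\<close>. With \<open>S\<close>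
  the light and \<open>H\<close> the heavy edges of a spanning set, this finds a heavy edge that can
  be exchanged.\<close>

lemma critical_edge_exists:
  assumes "finite H" "(adj V (S \<union> H))\<^sup>*\<^sup>* u v" "\<not> (adj V S)\<^sup>*\<^sup>* u v"
  shows "\<exists>R g. R \<subseteq> S \<union> H \<and> g \<in> H \<and> g \<in> R \<and> (adj V R)\<^sup>*\<^sup>* u v \<and> \<not> (adj V (R - {g}))\<^sup>*\<^sup>* u v"
  using assms
proof (induction H rule: finite_induct)
  case (insert h H)
  show ?case
  proof (cases "(adj V (S \<union> H))\<^sup>*\<^sup>* u v")
    case True
    thus ?thesis using insert by blast
  next
    case False
    have "\<not> (adj V (insert h (S \<union> H) - {h}))\<^sup>*\<^sup>* u v"
      using False adj_rtranclp_mono[of V "insert h (S \<union> H) - {h}" u v V "S \<union> H"] by blast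
    thus ?thesis using insert.prems by (intro exI[of _ "insert h (S \<union> H)"] exI[of _ h]) auto
  qed
qed auto

lemma cut_crossing:
  assumes "(adj V R)\<^sup>*\<^sup>* u v" "\<not> (adj V (R - {g}))\<^sup>*\<^sup>* u v"
  obtains x y where "g = {x, y}" "(adj V (R - {g}))\<^sup>*\<^sup>* u x" "\<not> (adj V (R - {g}))\<^sup>*\<^sup>* u y"
proof -
  obtain x y where xy: "adj V R x y" "(adj V (R - {g}))\<^sup>*\<^sup>* u x" "\<not> (adj V (R - {g}))\<^sup>*\<^sup>* u y"
    using rtranclp_crossing[where Q="(adj V (R - {g}))\<^sup>*\<^sup>* u", OF assms(1) _ assms(2)] by blast
  have "g = {x, y}"
  proof (rule ccontr)
    assume "g \<noteq> {x, y}"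
    hence "adj V (R - {g}) x y" using xy(1) by (auto simp: adj_def)
    thus False using xy by (auto dest: rtranclp.rtrancl_into_rtrancl)
  qed
  thus ?thesis using xy that by blast
qed

lemma bridge_sides:
  assumes "(adj V T)\<^sup>*\<^sup>* u z" "e = {u, v}"
  shows "(adj V (T - {e}))\<^sup>*\<^sup>* u z \<or> (adj V (T - {e}))\<^sup>*\<^sup>* v z"
  using assms(1)
proof (induction rule: rtranclp_induct)
  case (step y z)
  show ?case
  proof (cases "{y, z} = e")
    case True
    thus ?thesis using assms(2) by (auto simp: doubleton_eq_iff)
  next
    case False
    hence "adj V (T - {e}) y z" using step(2) by (auto simp: adj_def)
    thus ?thesis using step.IH by (meson rtranclp.rtrancl_into_rtrancl)
  qed
qed auto

text \<open>The threshold \<open>a\<close> is the minimax weight of a path joining the ends of \<open>e\<close> outside \<open>e\<close>;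
  the cap \<open>X\<close> keeps it real when \<open>e\<close> is a bridge.\<close>

lemma cmin_perturb:
  fixes X :: real
  assumes fin: "finite F" and con: "connected_on V F" and e: "e = {u, v}" "e \<in> F"
    and uv: "u \<noteq> v" "u \<in> V" "v \<in> V"
  shows "\<exists>A a. (\<forall>x\<le>X. cmin V F (w(e := x)) = A + min x a) \<and>
     (\<forall>p. 0 \<le> p \<longrightarrow> p < X \<longrightarrow> ((adj V {g \<in> F - {e}. w g \<le> p})\<^sup>*\<^sup>* u v \<longleftrightarrow> a \<le> p))"
proof -
  let ?C1 = "{T. T \<subseteq> F \<and> connected_on V T \<and> e \<in> T}"
  let ?C0 = "{T. T \<subseteq> F - {e} \<and> connected_on V T}"
  let ?s = "\<lambda>T. \<Sum>g\<in>T. w g"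
  let ?conn = "\<lambda>p. (adj V {g \<in> F - {e}. w g \<le> p})\<^sup>*\<^sup>* u v"
  \<comment> \<open>Sets containing \<open>e\<close> cost at best \<open>A + x\<close>, sets
    avoiding \<open>e\<close> cost at best \<open>B\<close>, whatever \<open>x\<close> is; so the
    minimum is \<open>A + min x (B - A)\<close> and the threshold is \<open>B - A\<close>.\<close>
  define A where "A = Min ((\<lambda>T. ?s (T - {e})) ` ?C1)"
  define B where "B = Min (?s ` ?C0)"
  have f1: "finite ?C1" and f0: "finite ?C0" using fin by auto
  have n1: "?C1 \<noteq> {}" using con e by auto
  have sum1: "(\<Sum>g\<in>T. (w(e := x)) g) = x + ?s (T - {e})" if "T \<in> ?C1" for T x
  proof -
    have "finite T" using that fin finite_subset by auto
    thus ?thesis using that by (auto simp: sum.remove[of T e] intro!: sum.cong)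
  qed
  have sum0: "(\<Sum>g\<in>T. (w(e := x)) g) = ?s T" if "T \<in> ?C0" for T x
    using that by (intro sum.cong) auto
  have split: "{T. T \<subseteq> F \<and> connected_on V T} = ?C1 \<union> ?C0" by auto
  have im1: "(\<lambda>T. \<Sum>g\<in>T. (w(e := x)) g) ` ?C1 = (\<lambda>y. x + y) ` (\<lambda>T. ?s (T - {e})) ` ?C1" for x
    unfolding image_image by (rule image_cong[OF refl]) (use sum1 in auto)
  have im0: "(\<lambda>T. \<Sum>g\<in>T. (w(e := x)) g) ` ?C0 = ?s ` ?C0" for x
    by (rule image_cong[OF refl]) (use sum0 in auto)
  have min1: "Min ((\<lambda>T. \<Sum>g\<in>T. (w(e := x)) g) ` ?C1) = A + x" for x
    unfolding im1 A_def
    by (subst mono_Min_commute[symmetric]) (use f1 n1 in \<open>auto simp: mono_def\<close>)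
  show ?thesis
  proof (cases "?C0 = {}")
    \<comment> \<open>Here \<open>e\<close> is a bridge: the weight is linear in \<open>x\<close>,
      and the cap \<open>X\<close> can serve as threshold because no level joins the ends.\<close>
    case True
    have 1: "cmin V F (w(e := x)) = A + min x X" if "x \<le> X" for x
      unfolding cmin_def split True using min1[of x] that by simp
    have 2: "\<not> ?conn p" for p
    proof
      assume "?conn p"
      hence "(adj V (F - {e}))\<^sup>*\<^sup>* u v" by (rule adj_rtranclp_mono) auto
      hence "connected_on V (F - {e})" using connected_on_exchange[OF con, of u v] e by auto
      thus False using True by blast
    qed
    show ?thesis by (intro exI[of _ A] exI[of _ X]) (use 1 2 in auto)
  next
    case False
    have 1: "cmin V F (w(e := x)) = A + min x (B - A)" for x
    proof -
      have "cmin V F (w(e := x)) = min (A + x) B"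
        unfolding cmin_def split image_Un
        by (subst Min_Un) (use f0 f1 n1 False in \<open>simp_all only: min1 im0 B_def finite_imageI image_is_empty not_False_eq_True\<close>)
      thus ?thesis by simp
    qed
    \<comment> \<open>Remove \<open>e\<close> from an optimal set containing it. If the set stays
      connected, then \<open>B \<le> A\<close> and \<open>0 \<le> p\<close> finishes; otherwise the
      light path crosses the cut in an edge \<open>g\<close> of weight at most \<open>p\<close>,
      which takes the place of \<open>e\<close>.\<close>
    have 2: "B - A \<le> p" if p: "0 \<le> p" "?conn p" for p
    proof -
      have "A \<in> (\<lambda>T. ?s (T - {e})) ` ?C1" unfolding A_def by (rule Min_in) (use f1 n1 in auto)
      then obtain T where T: "T \<subseteq> F" "connected_on V T" "e \<in> T" "A = ?s (T - {e})" by blast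
      have fT: "finite T" using T fin finite_subset by auto
      show ?thesis
      proof (cases "(adj V (T - {e}))\<^sup>*\<^sup>* u v")
        case True
        hence "connected_on V (T - {e})" using connected_on_exchange[OF T(2), of u v] e by auto
        hence "B \<le> ?s (T - {e})" unfolding B_def by (intro Min_le) (use f0 T in auto)
        thus ?thesis using T p by linarith
      next
        case False
        obtain x y where xy: "adj V {g \<in> F - {e}. w g \<le> p} x y"
            "(adj V (T - {e}))\<^sup>*\<^sup>* u x" "\<not> (adj V (T - {e}))\<^sup>*\<^sup>* u y"
          using rtranclp_crossing[where Q="(adj V (T - {e}))\<^sup>*\<^sup>* u", OF p(2) _ False] by blast
        define g where "g = {x, y}"
        have g: "g \<in> F - {e}" "w g \<le> p" and xyV: "x \<in> V" "y \<in> V" "x \<noteq> y"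
          using xy(1) by (auto simp: g_def adj_def)
        have gT: "g \<notin> T - {e}"
        proof
          assume "g \<in> T - {e}"
          hence "adj V (T - {e}) x y" using xyV by (auto simp: adj_def g_def)
          thus False using xy by (auto dest: rtranclp.rtrancl_into_rtrancl)
        qed
        define T' where "T' = insert g (T - {e})"
        have sub: "T - {e} \<subseteq> T'" by (auto simp: T'_def)
        have "(adj V T)\<^sup>*\<^sup>* u y" using T(2) uv xyV by (auto simp: connected_on_def)
        hence "(adj V (T - {e}))\<^sup>*\<^sup>* v y" using bridge_sides[OF _ e(1)] xy(3) by blast
        hence yv: "(adj V T')\<^sup>*\<^sup>* y v"
          by (rule adj_rtranclp_mono[OF adj_rtranclp_sym order_refl sub])
        have ux: "(adj V T')\<^sup>*\<^sup>* u x" using xy(2) by (rule adj_rtranclp_mono[OF _ order_refl sub])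
        have "adj V T' x y" using xyV by (auto simp: adj_def T'_def g_def)
        hence "(adj V T')\<^sup>*\<^sup>* u v" using ux yv by (meson rtranclp_trans rtranclp.rtrancl_into_rtrancl)
        hence "connected_on V T'" using connected_on_exchange[OF T(2), of u v T'] sub e by auto
        hence "B \<le> ?s T'" unfolding B_def by (intro Min_le) (use f0 T g in \<open>auto simp: T'_def\<close>)
        also have "?s T' = w g + A" using gT fT T(4) by (simp add: T'_def)
        finally show ?thesis using g by linarith
      qed
    qed
    \<comment> \<open>Conversely, an optimal set without \<open>e\<close> cannot join the ends of
      \<open>e\<close> by light edges alone, so some \<open>g\<close> of weight above
      \<open>p\<close> is critical in a subset \<open>R\<close> joining them. Exchanging
      \<open>g\<close> for \<open>e\<close> gives \<open>A \<le> B - w g\<close>.\<close>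
    have 3: "p < B - A" if p: "\<not> ?conn p" for p
    proof -
      have "B \<in> ?s ` ?C0" unfolding B_def by (rule Min_in) (use f0 False in auto)
      then obtain T where T: "T \<subseteq> F - {e}" "connected_on V T" "B = ?s T" by blast
      have fT: "finite T" using T fin finite_subset by (metis finite_Diff)
      let ?S = "{g \<in> T. w g \<le> p}" and ?H = "{g \<in> T. p < w g}"
      have "?S \<union> ?H = T" by auto
      moreover have "(adj V T)\<^sup>*\<^sup>* u v" using T uv by (auto simp: connected_on_def)
      moreover have "\<not> (adj V ?S)\<^sup>*\<^sup>* u v"
        using p adj_rtranclp_mono[of V ?S u v V "{g \<in> F - {e}. w g \<le> p}"] T by blast
      ultimately obtain R g where R: "R \<subseteq> T" "g \<in> T" "p < w g" "(adj V R)\<^sup>*\<^sup>* u v"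
          "\<not> (adj V (R - {g}))\<^sup>*\<^sup>* u v"
        using critical_edge_exists[of ?H V ?S u v] fT by auto
      obtain x y where xy: "g = {x, y}" "(adj V (R - {g}))\<^sup>*\<^sup>* u x"
        using cut_crossing[OF R(4,5)] by metis
      have "\<not> (adj V (R - {g}))\<^sup>*\<^sup>* v u" using R(5) adj_rtranclp_sym by metis
      then obtain x' y' where xy': "g = {x', y'}" "(adj V (R - {g}))\<^sup>*\<^sup>* v x'"
        using cut_crossing[OF adj_rtranclp_sym[OF R(4)]] by metis
      \<comment> \<open>\<open>u\<close> and \<open>v\<close> lie on different sides of the cut that
        \<open>g\<close> makes in \<open>R\<close>, so they reach different ends of
        \<open>g\<close>.\<close>
      have "x' \<noteq> x" using xy(2) xy'(2) R(5) by (metis adj_rtranclp_sym rtranclp_trans)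
      hence vy: "(adj V (R - {g}))\<^sup>*\<^sup>* v y" using xy(1) xy' by (auto simp: doubleton_eq_iff)
      define T' where "T' = insert e (T - {g})"
      have sub: "T - {g} \<subseteq> T'" "R - {g} \<subseteq> T'" using R by (auto simp: T'_def)
      have "adj V T' u v" using uv e by (auto simp: T'_def adj_def)
      moreover have "(adj V T')\<^sup>*\<^sup>* x u"
        using xy(2) by (rule adj_rtranclp_mono[OF adj_rtranclp_sym order_refl sub(2)])
      moreover have "(adj V T')\<^sup>*\<^sup>* v y"
        using vy by (rule adj_rtranclp_mono[OF _ order_refl sub(2)])
      ultimately have "(adj V T')\<^sup>*\<^sup>* x y"
        by (meson rtranclp_trans rtranclp.rtrancl_into_rtrancl)
      hence "connected_on V T'" using connected_on_exchange[OF T(2), of x y T'] sub xy by auto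
      hence "A \<le> ?s (T' - {e})" unfolding A_def
        by (intro Min_le imageI finite_imageI f1) (use T(1) \<open>connected_on V T'\<close> e(2) in \<open>auto simp: T'_def\<close>)
      also have "T' - {e} = T - {g}" using T by (auto simp: T'_def)
      also have "?s (T - {g}) = B - w g" using T fT R by (simp add: sum_diff1)
      finally show ?thesis using R by linarith
    qed
    show ?thesis
      by (intro exI[of _ A] exI[of _ "B - A"]) (use 1 2 3 in \<open>auto simp: not_le\<close>, meson 3 not_le)
  qed
qed

lemma cmin_lipschitz:
  assumes "finite F" "connected_on V F" "\<And>e. e \<in> F \<Longrightarrow> \<exists>u v. e = {u, v} \<and> u \<noteq> v \<and> u \<in> V \<and> v \<in> V"
  shows "\<bar>cmin V F (w(e := x)) - cmin V F (w(e := y))\<bar> \<le> \<bar>x - y\<bar>"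
proof (cases "e \<in> F")
  case True
  then obtain u v where "e = {u, v}" "u \<noteq> v" "u \<in> V" "v \<in> V" using assms(3) by blast
  from cmin_perturb[OF assms(1,2) this(1) True this(2-4), of "max x y" w]
  obtain A a where "\<forall>z\<le>max x y. cmin V F (w(e := z)) = A + min z a" by blast
  hence "cmin V F (w(e := x)) = A + min x a" "cmin V F (w(e := y)) = A + min y a" by auto
  thus ?thesis by linarith
next
  case False
  have "cmin V F (w(e := x)) = cmin V F (w(e := y))" by (rule cmin_cong) (use False in auto)
  thus ?thesis by simp
qed

section \<open>Independent identically distributed families\<close>

definition dep_on :: "'i set \<Rightarrow> (('i \<Rightarrow> real) \<Rightarrow> 'b) \<Rightarrow> bool" where
  "dep_on A a \<longleftrightarrow> (\<forall>w w'. (\<forall>i\<in>A. w i = w' i) \<longrightarrow> a w = a w')"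

lemma dep_onD: "dep_on A a \<Longrightarrow> (\<And>i. i \<in> A \<Longrightarrow> w i = w' i) \<Longrightarrow> a w = a w'"
  by (auto simp: dep_on_def)

lemma dep_on_mono: "dep_on A a \<Longrightarrow> A \<subseteq> B \<Longrightarrow> dep_on B a"
  unfolding dep_on_def by blast

locale iid =
  fixes \<mu> :: "real measure"
  assumes prob_mu: "prob_space \<mu>" and sets_mu [measurable_cong, simp]: "sets \<mu> = sets borel"
begin

sublocale mu: prob_space \<mu> by (rule prob_mu)

text \<open>The product runs over a whole index type, so that relabelling the coordinates by any
  injection preserves the measure. This one invariance yields both the resampled configurations,
  indexed by an edge and a bit, and the action of graph automorphisms on edges.\<close>

definition Lam :: "('i \<Rightarrow> real) measure" where
  "Lam = Pi\<^sub>M UNIV (\<lambda>_. \<mu>)"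

lemma prob_space_Lam: "prob_space Lam"
  unfolding Lam_def by (intro prob_space_PiM prob_mu)

sublocale Lam: prob_space "Lam :: ('i \<Rightarrow> real) measure" by (rule prob_space_Lam)

abbreviation expect :: "(('i \<Rightarrow> real) \<Rightarrow> 'b::{banach, second_countable_topology}) \<Rightarrow> 'b" (binder "\<E>" 10)
  where "expect f \<equiv> integral\<^sup>L Lam f"

lemma space_mu [simp]: "space \<mu> = UNIV"
  using sets_eq_imp_space_eq[OF sets_mu] by simp

lemma space_Lam [simp]: "space Lam = UNIV"
  by (simp add: Lam_def space_PiM)

lemma prob_UNIV_Lam [simp]: "measure Lam UNIV = 1"
  using Lam.prob_space by simp

lemma measurable_coord [measurable]: "(\<lambda>w. w i) \<in> borel_measurable Lam"
proof -
  have "(\<lambda>w. w i) \<in> Lam \<rightarrow>\<^sub>M \<mu>" unfolding Lam_def by (rule measurable_component_singleton) simp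
  thus ?thesis by (simp cong: measurable_cong_sets)
qed

lemma measurable_into_Lam:
  assumes "\<And>i. (\<lambda>w. f w i) \<in> borel_measurable N"
  shows "f \<in> N \<rightarrow>\<^sub>M Lam"
proof -
  have "(\<lambda>w i. f w i) \<in> N \<rightarrow>\<^sub>M Pi\<^sub>M UNIV (\<lambda>_. \<mu>)"
    by (rule measurable_PiM_single') (use assms in \<open>simp_all cong: measurable_cong_sets\<close>)
  thus ?thesis by (simp add: Lam_def)
qed

section \<open>Invariance of the product law under injective relabelling\<close>

lemma distr_reindex:
  assumes "inj \<phi>"
  shows "distr Lam Lam (\<lambda>w k. w (\<phi> k)) = Lam"
  using distr_PiM_reindex[of UNIV "\<lambda>_. \<mu>" \<phi> UNIV] assms prob_mu by (simp add: Lam_def restrict_def)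

lemma measurable_reindex: "(\<lambda>w k. w (\<phi> k)) \<in> Lam \<rightarrow>\<^sub>M Lam"
  by (rule measurable_into_Lam) measurable

lemma integral_reindex:
  fixes h :: "_ \<Rightarrow> 'b::{banach, second_countable_topology}"
  assumes "inj \<phi>" and [measurable]: "h \<in> borel_measurable Lam"
  shows "(\<E> w. h (\<lambda>k. w (\<phi> k))) = (\<E> w. h w)"
proof -
  have "(\<E> w. h w) = (\<integral>w. h w \<partial>distr Lam Lam (\<lambda>w k. w (\<phi> k)))"
    by (subst distr_reindex[OF assms(1)]) (rule refl)
  also have "\<dots> = (\<E> w. h (\<lambda>k. w (\<phi> k)))"
    by (rule integral_distr[OF measurable_reindex assms(2)])
  finally show ?thesis by simp
qed

lemma integrable_reindex:
  fixes h :: "_ \<Rightarrow> 'b::{banach, second_countable_topology}"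
  assumes "inj \<phi>" and "integrable Lam h"
  shows "integrable Lam (\<lambda>w. h (\<lambda>k. w (\<phi> k)))"
proof -
  have "integrable (distr Lam Lam (\<lambda>w k. w (\<phi> k))) h"
    by (subst distr_reindex[OF assms(1)]) (rule assms(2))
  thus ?thesis by (rule integrable_distr[OF measurable_reindex])
qed

lemma distr_coord: "distr Lam \<mu> (\<lambda>w. w i) = \<mu>"
  unfolding Lam_def by (rule distr_PiM_component) (auto intro: prob_mu)

lemma integral_coord:
  fixes h :: "real \<Rightarrow> 'b::{banach, second_countable_topology}"
  assumes [measurable]: "h \<in> borel_measurable borel"
  shows "(\<E> w. h (w i)) = (\<integral>x. h x \<partial>\<mu>)"
proof -
  have "(\<integral>x. h x \<partial>\<mu>) = (\<integral>x. h x \<partial>distr Lam \<mu> (\<lambda>w. w i))" by (simp add: distr_coord)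
  also have "\<dots> = (\<E> w. h (w i))"
    by (rule integral_distr) (simp_all cong: measurable_cong_sets)
  finally show ?thesis by simp
qed

lemma integrable_coord:
  fixes h :: "real \<Rightarrow> 'b::{banach, second_countable_topology}"
  assumes "integrable \<mu> h"
  shows "integrable Lam (\<lambda>w. h (w i))"
proof -
  have "integrable (distr Lam \<mu> (\<lambda>w. w i)) h" using assms by (simp add: distr_coord)
  thus ?thesis by (rule integrable_distr[rotated]) (simp cong: measurable_cong_sets)
qed

lemma AE_coord: "AE x in \<mu>. Q x \<Longrightarrow> AE w in Lam. Q (w i)"
  unfolding Lam_def by (rule AE_PiM_component) (auto intro: prob_mu)

text \<open>\<open>a\<close> and \<open>b\<close> factor through the restrictions to
  \<open>A\<close> and \<open>B\<close>, which are independent as the index sets are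
  disjoint.\<close>

lemma indep_dep_on:
  fixes a b :: "('i \<Rightarrow> real) \<Rightarrow> 'b::topological_space"
  assumes [measurable]: "a \<in> borel_measurable Lam" "b \<in> borel_measurable Lam"
    and dep: "dep_on A a" "dep_on B b" and AB: "A \<inter> B = {}"
  shows "Lam.indep_var borel a borel b"
proof -
  have rv: "Lam.random_variable \<mu> (\<lambda>w. w i)" for i by (simp cong: measurable_cong_sets)
  have ind: "Lam.indep_vars (\<lambda>_. \<mu>) (\<lambda>i w. w i) (UNIV :: 'i set)"
    by (subst Lam.indep_vars_iff_distr_eq_PiM) (simp_all add: rv distr_coord, simp add: Lam_def restrict_UNIV distr_id2)
  \<comment> \<open>Coordinates outside \<open>C\<close> get the default 0, which
    \<open>dep_on\<close> hides from \<open>a\<close> and \<open>b\<close>.\<close>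
  define ext :: "'i set \<Rightarrow> ('i \<Rightarrow> real) \<Rightarrow> 'i \<Rightarrow> real" where "ext C x = (\<lambda>i. if i \<in> C then x i else 0)" for C x
  have ext: "ext C \<in> Pi\<^sub>M C (\<lambda>_. \<mu>) \<rightarrow>\<^sub>M Lam" for C
  proof (rule measurable_into_Lam)
    fix i show "(\<lambda>w. ext C w i) \<in> borel_measurable (Pi\<^sub>M C (\<lambda>_. \<mu>))"
    proof (cases "i \<in> C")
      case True
      have "(\<lambda>w. w i) \<in> Pi\<^sub>M C (\<lambda>_. \<mu>) \<rightarrow>\<^sub>M \<mu>" using True by (rule measurable_component_singleton)
      thus ?thesis using True by (simp add: ext_def cong: measurable_cong_sets)
    qed (simp add: ext_def)
  qed
  have "Lam.indep_var borel ((a \<circ> ext A) \<circ> (\<lambda>w. \<lambda>i\<in>A. w i)) borel ((b \<circ> ext B) \<circ> (\<lambda>w. \<lambda>i\<in>B. w i))"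
    by (rule Lam.indep_var_compose[OF Lam.indep_var_restrict[OF ind AB]])
      (use measurable_comp[OF ext assms(1)] measurable_comp[OF ext assms(2)] in auto)
  also have "(a \<circ> ext A) \<circ> (\<lambda>w. \<lambda>i\<in>A. w i) = a"
    by (auto simp: fun_eq_iff ext_def intro!: dep_onD[OF dep(1)])
  also have "(b \<circ> ext B) \<circ> (\<lambda>w. \<lambda>i\<in>B. w i) = b"
    by (auto simp: fun_eq_iff ext_def intro!: dep_onD[OF dep(2)])
  finally show ?thesis .
qed

lemma integral_mult_dep_on:
  fixes a b :: "('i \<Rightarrow> real) \<Rightarrow> 'b::{real_normed_field, banach, second_countable_topology}"
  assumes "integrable Lam a" "integrable Lam b" "dep_on A a" "dep_on B b" "A \<inter> B = {}"
  shows "(\<E> w. a w * b w) = (\<E> w. a w) * (\<E> w. b w)"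
    and "integrable Lam (\<lambda>w. a w * b w)"
proof -
  have "Lam.indep_var borel a borel b" by (rule indep_dep_on) (use assms in auto)
  from Lam.indep_var_lebesgue_integral[OF this assms(1,2)] Lam.indep_var_integrable[OF this assms(1,2)]
  show "(\<E> w. a w * b w) = (\<E> w. a w) * (\<E> w. b w)" "integrable Lam (\<lambda>w. a w * b w)"
    by auto
qed

text \<open>With \<open>F\<close> finite the set of open edges is a discrete random variable. Events
  about clusters and paths factor through it, which makes them measurable without an analysis of
  paths.\<close>

lemma measurable_open_edges:
  fixes F :: "'i set"
  assumes "finite F"
  shows "(\<lambda>w. {e \<in> F. w e \<le> p}) \<in> Lam \<rightarrow>\<^sub>M count_space UNIV"
  using assms
proof (induction F rule: finite_induct)
  case (insert x F)
  have eq: "{e \<in> insert x F. w e \<le> p} = (if w x \<le> p then insert x {e \<in> F. w e \<le> p} else {e \<in> F. w e \<le> p})" for w :: "'i \<Rightarrow> real"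
    by auto
  have "(\<lambda>w. insert x {e \<in> F. w e \<le> p}) \<in> Lam \<rightarrow>\<^sub>M count_space UNIV"
    by (rule measurable_compose[OF insert.IH]) simp
  moreover have "{w \<in> space Lam. w x \<le> p} \<in> sets Lam" by measurable
  ultimately show ?case unfolding eq by (intro measurable_If insert.IH) simp_all
qed simp

lemma measurable_open_edges' [measurable]:
  fixes F :: "'i set"
  assumes "finite F"
  shows "(\<lambda>w. h {e \<in> F. w e \<le> p}) \<in> Lam \<rightarrow>\<^sub>M count_space UNIV"
  by (rule measurable_compose[OF measurable_open_edges[OF assms]]) simp

end

section \<open>The covariance formula and the Stein bound\<close>

text \<open>List \<open>F\<close> in some order and let \<open>pre e\<close> be the elements before
  \<open>e\<close>; in the induction the new element comes last, with \<open>pre x = F\<close>. One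
  \<open>pre\<close> has to serve all \<open>G\<close>, because \<open>G\<close> will depend on the
  configuration.\<close>

lemma finite_telescope:
  assumes "finite F"
  shows "\<exists>pre. (\<forall>e\<in>F. e \<notin> pre e) \<and>
    (\<forall>G :: 'e set \<Rightarrow> 'b::ab_group_add. (\<Sum>e\<in>F. G (pre e) - G (insert e (pre e))) = G {} - G F)"
  using assms
proof (induction F rule: finite_induct)
  case (insert x F)
  then obtain pre where pre: "\<forall>e\<in>F. e \<notin> pre e"
    "\<And>G :: 'e set \<Rightarrow> 'b. (\<Sum>e\<in>F. G (pre e) - G (insert e (pre e))) = G {} - G F" by blast
  have "(\<Sum>e\<in>F. G ((pre(x := F)) e) - G (insert e ((pre(x := F)) e))) = G {} - G F" for G :: "'e set \<Rightarrow> 'b"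
    unfolding pre(2)[symmetric] by (rule sum.cong) (use insert in auto)
  thus ?case using insert pre(1) by (intro exI[of _ "pre(x := F)"]) (auto simp: algebra_simps)
qed simp

lemma integrable_mult_of_squares:
  fixes g h :: "'a \<Rightarrow> 'b::{real_normed_algebra, banach, second_countable_topology}"
  assumes [measurable]: "g \<in> borel_measurable M" "h \<in> borel_measurable M"
    and "integrable M (\<lambda>x. (norm (g x))\<^sup>2)" "integrable M (\<lambda>x. (norm (h x))\<^sup>2)"
  shows "integrable M (\<lambda>x. g x * h x)"
proof (rule Bochner_Integration.integrable_bound)
  show "integrable M (\<lambda>x. (norm (g x))\<^sup>2 + (norm (h x))\<^sup>2)" using assms by auto
  have "norm (g x * h x) \<le> (norm (g x))\<^sup>2 + (norm (h x))\<^sup>2" for x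
  proof -
    have "norm (g x * h x) \<le> norm (g x) * norm (h x)" by (rule norm_mult_ineq)
    also have "\<dots> \<le> (norm (g x))\<^sup>2 + (norm (h x))\<^sup>2"
      using sum_squares_bound[of "norm (g x)" "norm (h x)"]
        mult_nonneg_nonneg[OF norm_ge_zero norm_ge_zero, of "g x" "h x"] by linarith
    finally show ?thesis .
  qed
  thus "AE x in M. norm (g x * h x) \<le> norm ((norm (g x))\<^sup>2 + (norm (h x))\<^sup>2)" by auto
qed measurable

lemma (in finite_measure) integrable_of_square:
  fixes g :: "'a \<Rightarrow> 'b::{banach, second_countable_topology}"
  assumes [measurable]: "g \<in> borel_measurable M" and "integrable M (\<lambda>x. (norm (g x))\<^sup>2)"
  shows "integrable M g"
proof (rule Bochner_Integration.integrable_bound)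
  show "integrable M (\<lambda>x. 1 + (norm (g x))\<^sup>2)" using assms by auto
  have "norm (g x) \<le> 1 + (norm (g x))\<^sup>2" for x
    using sum_squares_bound[of 1 "norm (g x)"] norm_ge_zero[of "g x"]
    unfolding mult_1_right one_power2 by linarith
  thus "AE x in M. norm (g x) \<le> norm (1 + (norm (g x))\<^sup>2)" by auto
qed measurable

lemma integrable_square_diff:
  fixes g h :: "'a \<Rightarrow> real"
  assumes [measurable]: "g \<in> borel_measurable M" "h \<in> borel_measurable M"
    and "integrable M (\<lambda>x. (g x)\<^sup>2)" "integrable M (\<lambda>x. (h x)\<^sup>2)"
  shows "integrable M (\<lambda>x. (g x - h x)\<^sup>2)"
proof -
  have "integrable M (\<lambda>x. g x * h x)" by (rule integrable_mult_of_squares) (use assms in auto)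
  thus ?thesis unfolding power2_diff using assms by (simp add: mult.assoc)
qed

section \<open>Resampling weights from an independent copy\<close>

definition mix :: "'e set \<Rightarrow> ('e \<times> bool \<Rightarrow> real) \<Rightarrow> 'e \<Rightarrow> real" where
  "mix A w = (\<lambda>e. w (e, e \<in> A))"

definition swap :: "'e \<Rightarrow> ('e \<times> bool \<Rightarrow> real) \<Rightarrow> 'e \<times> bool \<Rightarrow> real" where
  "swap e w = (\<lambda>i. w (if fst i = e then (e, \<not> snd i) else i))"

text \<open>Exchanging the two copies of \<open>e\<close> exchanges the configurations just before
  and just after \<open>e\<close> is resampled, so that an increment at \<open>e\<close> changes
  sign.\<close>

lemma mix_swap:
  assumes "e \<notin> A"
  shows "mix A (swap e w) = mix (insert e A) w" "mix (insert e A) (swap e w) = mix A w"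
  using assms by (auto simp: mix_def swap_def fun_eq_iff)

lemma mix_insert: "mix (insert e A) w = (mix A w)(e := w (e, True))"
  by (auto simp: mix_def fun_eq_iff)

context iid begin

text \<open>\<open>mix A\<close> reads one of the two copies of every coordinate; being a
  relabelling along an injection, it has the law of the original weights.\<close>

lemma inj_mix: "inj (\<lambda>e. (e, e \<in> A))"
  by (auto simp: inj_on_def)

lemma measurable_mix [measurable]: "mix A \<in> Lam \<rightarrow>\<^sub>M Lam"
  unfolding mix_def by (rule measurable_reindex)

lemma integral_mix:
  fixes h :: "_ \<Rightarrow> 'b::{banach, second_countable_topology}"
  assumes "h \<in> borel_measurable Lam"
  shows "(\<E> w. h (mix A w)) = (\<E> w. h w)"
  unfolding mix_def by (rule integral_reindex[OF inj_mix assms])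

lemma integrable_mix:
  fixes h :: "_ \<Rightarrow> 'b::{banach, second_countable_topology}"
  assumes "integrable Lam h"
  shows "integrable Lam (\<lambda>w. h (mix A w))"
  unfolding mix_def by (rule integrable_reindex[OF inj_mix assms])

lemma integral_swap:
  fixes h :: "_ \<Rightarrow> 'b::{banach, second_countable_topology}"
  assumes "h \<in> borel_measurable Lam"
  shows "(\<E> w. h (swap e w)) = (\<E> w. h w)"
  unfolding swap_def
  by (rule integral_reindex[OF _ assms]) (auto simp: inj_on_def split: if_splits)

end

text \<open>On \<open>'e \<times> bool\<close> the coordinates \<open>(e, False)\<close> carry the weights and \<open>(e, True)\<close> an
  independent copy; \<open>mix A\<close> resamples the coordinates in \<open>A\<close>.\<close>

locale iid_function = iid +
  fixes F :: "'e set" and f :: "('e \<Rightarrow> real) \<Rightarrow> real"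
  assumes fin_F: "finite F"
    and f_meas [measurable]: "f \<in> borel_measurable Lam"
    and f_dep: "dep_on F f"
    and f_lip: "\<bar>f (w(e := x)) - f w\<bar> \<le> \<bar>x - w e\<bar>"
    and f_sq: "integrable Lam (\<lambda>w. (f w)\<^sup>2)"
    and mom3: "integrable \<mu> (\<lambda>x. \<bar>x\<bar> ^ 3)"
begin

definition Dlt :: "'e \<Rightarrow> 'e set \<Rightarrow> ('e \<times> bool \<Rightarrow> real) \<Rightarrow> real" where
  "Dlt e A w = f (mix A w) - f (mix (insert e A) w)"

definition pre :: "'e \<Rightarrow> 'e set" where
  "pre = (SOME pre. (\<forall>e\<in>F. e \<notin> pre e) \<and>
    (\<forall>G :: 'e set \<Rightarrow> real. (\<Sum>e\<in>F. G (pre e) - G (insert e (pre e))) = G {} - G F))"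

text \<open>The first increment is taken in the original configuration, the second after the edges
  in \<open>pre e\<close> have been resampled. The 1/2 is that of \<open>covariance_formula\<close>,
  where it comes from exchanging the two copies of an edge.\<close>

definition T :: "('e \<times> bool \<Rightarrow> real) \<Rightarrow> real" where
  "T w = (\<Sum>e\<in>F. Dlt e {} w * Dlt e (pre e) w) / 2"

lemma pre: "e \<in> F \<Longrightarrow> e \<notin> pre e"
    "(\<Sum>e\<in>F. G (pre e) - G (insert e (pre e))) = (G {} - G F :: real)"
  using someI_ex[OF finite_telescope[OF fin_F, where 'b=real]] unfolding pre_def[symmetric] by blast+

lemma measurable_Dlt [measurable]: "Dlt e A \<in> borel_measurable Lam"
  unfolding Dlt_def by measurable

lemma measurable_T [measurable]: "T \<in> borel_measurable Lam"
  unfolding T_def by measurable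

lemma abs_Dlt_le:
  assumes "e \<notin> A"
  shows "\<bar>Dlt e A w\<bar> \<le> \<bar>w (e, False) - w (e, True)\<bar>"
proof -
  have "\<bar>f ((mix A w)(e := w (e, True))) - f (mix A w)\<bar> \<le> \<bar>w (e, True) - mix A w e\<bar>" by (rule f_lip)
  thus ?thesis using assms unfolding Dlt_def mix_insert by (simp add: mix_def abs_minus_commute)
qed

lemma mom2: "integrable \<mu> (\<lambda>x. x\<^sup>2)"
proof (rule Bochner_Integration.integrable_bound)
  show "integrable \<mu> (\<lambda>x. 1 + \<bar>x\<bar> ^ 3)" using mom3 by auto
  have "x\<^sup>2 \<le> 1 + \<bar>x\<bar> ^ 3" for x :: real
  proof (cases "\<bar>x\<bar> \<le> 1")
    case True
    hence "\<bar>x\<bar>\<^sup>2 \<le> 1" by (intro power_le_one) auto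
    thus ?thesis by (simp add: add_increasing2)
  next
    case False
    hence "\<bar>x\<bar> ^ 2 \<le> \<bar>x\<bar> ^ 3" by (intro power_increasing) auto
    thus ?thesis by simp
  qed
  thus "AE x in \<mu>. norm (x\<^sup>2) \<le> norm (1 + \<bar>x\<bar> ^ 3)" by auto
qed (simp cong: measurable_cong_sets)

definition m2 where "m2 = (\<integral>x. x\<^sup>2 \<partial>\<mu>)"
definition m3 where "m3 = (\<integral>x. \<bar>x\<bar> ^ 3 \<partial>\<mu>)"

lemma m3_nonneg: "0 \<le> m3"
  unfolding m3_def by simp

lemma diff2:
  fixes i j :: 'i
  shows "integrable Lam (\<lambda>w. (w i - w j)\<^sup>2)" "(\<E> w. (w i - w j)\<^sup>2) \<le> 4 * m2"
proof -
  have i2: "integrable Lam (\<lambda>w. (w i)\<^sup>2)" for i :: 'i by (rule integrable_coord[OF mom2])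
  show *: "integrable Lam (\<lambda>w. (w i - w j)\<^sup>2)" by (rule integrable_square_diff) (auto intro: i2)
  have "(\<E> w. (w i - w j)\<^sup>2) \<le> (\<E> w. 2 * (w i)\<^sup>2 + 2 * (w j)\<^sup>2)"
  proof (rule integral_mono[OF *])
    fix w :: "'i \<Rightarrow> real"
    show "(w i - w j)\<^sup>2 \<le> 2 * (w i)\<^sup>2 + 2 * (w j)\<^sup>2"
      using zero_le_power2[of "w i + w j"] by (simp add: power2_eq_square algebra_simps)
  qed (use i2 in auto)
  also have "\<dots> = 4 * m2" using i2 integral_coord[of "\<lambda>x. x\<^sup>2" i] integral_coord[of "\<lambda>x. x\<^sup>2" j] by (simp add: m2_def)
  finally show "(\<E> w. (w i - w j)\<^sup>2) \<le> 4 * m2" .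
qed

lemma diff3:
  fixes i j :: 'i
  shows "integrable Lam (\<lambda>w. \<bar>w i - w j\<bar> ^ 3)" "(\<E> w. \<bar>w i - w j\<bar> ^ 3) \<le> 8 * m3"
proof -
  have i3: "integrable Lam (\<lambda>w. \<bar>w i\<bar> ^ 3)" for i :: 'i by (rule integrable_coord[OF mom3])
  have le: "\<bar>a - b\<bar> ^ 3 \<le> 4 * \<bar>a\<bar> ^ 3 + 4 * \<bar>b\<bar> ^ 3" for a b :: real
  proof -
    have "(x + y) ^ 3 \<le> 4 * x ^ 3 + 4 * y ^ 3" if "0 \<le> x" "0 \<le> y" for x y :: real
    proof -
      have "4 * x ^ 3 + 4 * y ^ 3 - (x + y) ^ 3 = 3 * ((x + y) * (x - y)\<^sup>2)"
        by (simp add: power2_eq_square power3_eq_cube algebra_simps)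
      moreover have "0 \<le> 3 * ((x + y) * (x - y)\<^sup>2)" using that by simp
      ultimately show ?thesis by linarith
    qed
    moreover have "\<bar>a - b\<bar> ^ 3 \<le> (\<bar>a\<bar> + \<bar>b\<bar>) ^ 3" by (intro power_mono) auto
    ultimately show ?thesis by (meson abs_ge_zero order_trans)
  qed
  have ii: "integrable Lam (\<lambda>w. 4 * \<bar>w i\<bar> ^ 3 + 4 * \<bar>w j\<bar> ^ 3)" using i3 by auto
  show *: "integrable Lam (\<lambda>w. \<bar>w i - w j\<bar> ^ 3)"
    by (rule Bochner_Integration.integrable_bound[OF ii]) (use le in auto)
  have "(\<E> w. \<bar>w i - w j\<bar> ^ 3) \<le> (\<E> w. 4 * \<bar>w i\<bar> ^ 3 + 4 * \<bar>w j\<bar> ^ 3)"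
    by (rule integral_mono[OF * ii le])
  also have "\<dots> = 8 * m3" using i3 integral_coord[of "\<lambda>x. \<bar>x\<bar> ^ 3" i] integral_coord[of "\<lambda>x. \<bar>x\<bar> ^ 3" j]
    by (simp add: m3_def)
  finally show "(\<E> w. \<bar>w i - w j\<bar> ^ 3) \<le> 8 * m3" .
qed

lemma Dlt_sq: "integrable Lam (\<lambda>w. (Dlt e A w)\<^sup>2)"
  unfolding Dlt_def by (rule integrable_square_diff) (auto intro: integrable_mix[OF f_sq])

lemma f_int: "integrable Lam f"
  by (rule Lam.integrable_of_square) (use f_sq in auto)

abbreviation mean where "mean \<equiv> \<E> w. f w"
abbreviation var where "var \<equiv> \<E> w. (f w - mean)\<^sup>2"

text \<open>Resampling all of \<open>F\<close> makes \<open>f\<close> independent of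
  \<open>g\<close>, so the covariance is the mean of \<open>g\<close> times the total change of
  \<open>f\<close>. This change telescopes along \<open>pre\<close>, and antisymmetry under
  \<open>swap e\<close> replaces \<open>g\<close> in each term by half of its increment at
  \<open>e\<close>. Complex values are allowed for the use with \<open>iexp\<close>.\<close>

lemma covariance_formula:
  fixes g :: "('e \<Rightarrow> real) \<Rightarrow> 'b::{real_normed_field, banach, second_countable_topology}"
  assumes [measurable]: "g \<in> borel_measurable Lam" and g2: "integrable Lam (\<lambda>w. (norm (g w))\<^sup>2)"
  shows "(\<E> w. g w * of_real (f w - mean)) =
    (\<Sum>e\<in>F. \<E> w. (g (mix {} w) - g (mix {e} w)) * of_real (Dlt e (pre e) w)) / 2"
proof -
  have g_int: "integrable Lam g" by (rule Lam.integrable_of_square) (use g2 in auto)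
  have gf: "integrable Lam (\<lambda>w. g w * of_real (f w))"
    by (rule integrable_mult_of_squares) (use f_sq g2 in auto)
  have gfm: "integrable Lam (\<lambda>w. g (mix {} w) * of_real (f (mix A w)))" for A
    by (rule integrable_mult_of_squares) (use integrable_mix[OF f_sq] integrable_mix[OF g2] in auto)
  have gD: "integrable Lam (\<lambda>w. g (mix B w) * of_real (Dlt e A w))" for A B e
    by (rule integrable_mult_of_squares) (use Dlt_sq integrable_mix[OF g2] in auto)
  have ind: "(\<E> w. g (mix {} w) * of_real (f (mix F w))) = (\<E> w. g w) * of_real mean"
  proof -
    have "(\<E> w. g (mix {} w) * of_real (f (mix F w)))
        = (\<E> w. g (mix {} w)) * (\<E> w. of_real (f (mix F w)))"
    proof (rule integral_mult_dep_on)
      show "dep_on (UNIV \<times> {False}) (\<lambda>w. g (mix {} w))"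
        by (auto simp: dep_on_def mix_def)
      show "dep_on (F \<times> {True}) (\<lambda>w. of_real (f (mix F w)) :: 'b)"
        by (auto simp: dep_on_def mix_def intro!: dep_onD[OF f_dep])
    qed (auto intro!: integrable_mix g_int f_int)
    also have "(\<E> w. (of_real (f (mix F w)) :: 'b)) = of_real (\<E> w. f (mix F w))"
      by (rule integral_bounded_linear[OF bounded_linear_of_real integrable_mix[OF f_int]])
    finally show ?thesis by (simp add: integral_mix)
  qed
  \<comment> \<open>\<open>swap e\<close> reverses the sign of \<open>Dlt e (pre e)\<close>, because
    \<open>e\<close> is not in \<open>pre e\<close>, and turns \<open>mix {}\<close> into
    \<open>mix {e}\<close>.\<close>
  have sw: "(\<E> w. g (mix {} w) * of_real (Dlt e (pre e) w))
      = - (\<E> w. g (mix {e} w) * of_real (Dlt e (pre e) w))" if "e \<in> F" for e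
  proof -
    have "(\<E> w. g (mix {} w) * of_real (Dlt e (pre e) w))
        = (\<E> w. g (mix {} (swap e w)) * of_real (Dlt e (pre e) (swap e w)))"
      by (rule integral_swap[symmetric]) simp
    also have "\<dots> = (\<E> w. - (g (mix {e} w) * of_real (Dlt e (pre e) w)))"
      using that by (simp add: mix_swap pre Dlt_def algebra_simps)
    finally show ?thesis by simp
  qed
  have half: "(\<E> w. g (mix {} w) * of_real (Dlt e (pre e) w))
      = (\<E> w. (g (mix {} w) - g (mix {e} w)) * of_real (Dlt e (pre e) w)) / 2" if "e \<in> F" for e
    using sw[OF that] gD by (simp add: left_diff_distrib)
  have "(\<E> w. g w * of_real (f w - mean)) = (\<E> w. g w * of_real (f w)) - (\<E> w. g w) * of_real mean"
    using gf g_int by (simp add: right_diff_distrib)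
  also have "\<dots> = (\<E> w. g (mix {} w) * of_real (f (mix {} w))) - (\<E> w. g (mix {} w) * of_real (f (mix F w)))"
    by (simp add: ind integral_mix[of "\<lambda>w. g w * of_real (f w)"])
  also have "\<dots> = (\<E> w. g (mix {} w) * of_real (f (mix {} w) - f (mix F w)))"
    using gfm by (simp add: right_diff_distrib)
  also have "\<dots> = (\<E> w. (\<Sum>e\<in>F. g (mix {} w) * of_real (Dlt e (pre e) w)))"
    by (simp add: pre(2)[of "\<lambda>A. f (mix A _)", symmetric] Dlt_def sum_distrib_left)
  also have "\<dots> = (\<Sum>e\<in>F. \<E> w. g (mix {} w) * of_real (Dlt e (pre e) w))"
    using gD by simp
  also have "\<dots> = (\<Sum>e\<in>F. (\<E> w. (g (mix {} w) - g (mix {e} w)) * of_real (Dlt e (pre e) w)) / 2)"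
    by (rule sum.cong) (simp_all add: half)
  finally show ?thesis by (simp add: sum_divide_distrib)
qed

lemma DD_int: "integrable Lam (\<lambda>w. Dlt e A w * Dlt e B w)"
  by (rule integrable_mult_of_squares) (use Dlt_sq in auto)

lemma T_int: "integrable Lam T"
  unfolding T_def using DD_int by auto

lemma sq_int: "integrable Lam (\<lambda>w. (f w - mean)\<^sup>2)"
  by (rule integrable_square_diff) (use f_sq in auto)

lemma var_eq_T: "var = (\<E> w. T w)"
proof -
  have "(\<E> w. f w * of_real (f w - mean)) =
    (\<Sum>e\<in>F. \<E> w. (f (mix {} w) - f (mix {e} w)) * of_real (Dlt e (pre e) w)) / 2"
    by (rule covariance_formula) (use f_sq in auto)
  also have "\<dots> = (\<E> w. T w)"
  proof -
    have "f (mix {} w) - f (mix {e} w) = Dlt e {} w" for e w by (simp add: Dlt_def)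
    thus ?thesis unfolding T_def using DD_int by simp
  qed
  also have "(\<E> w. f w * of_real (f w - mean)) = var"
    using f_sq f_int by (simp add: power2_diff right_diff_distrib Lam.prob_space)
      (simp add: power2_eq_square)
  finally show ?thesis .
qed

lemma var_le: "var \<le> 2 * m2 * card F"
proof -
  have "(\<E> w. T w) \<le> (\<E> w. (\<Sum>e\<in>F. (w (e, False) - w (e, True))\<^sup>2) / 2)"
  proof (rule integral_mono[OF T_int])
    fix w :: "'e \<times> bool \<Rightarrow> real"
    have "Dlt e {} w * Dlt e (pre e) w \<le> (w (e, False) - w (e, True))\<^sup>2" if "e \<in> F" for e
    proof -
      have "Dlt e {} w * Dlt e (pre e) w \<le> \<bar>Dlt e {} w\<bar> * \<bar>Dlt e (pre e) w\<bar>"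
        by (metis abs_ge_self abs_mult)
      also have "\<dots> \<le> \<bar>w (e, False) - w (e, True)\<bar> * \<bar>w (e, False) - w (e, True)\<bar>"
        by (intro mult_mono abs_Dlt_le) (use pre that in auto)
      finally show ?thesis by (simp add: power2_eq_square)
    qed
    thus "T w \<le> (\<Sum>e\<in>F. (w (e, False) - w (e, True))\<^sup>2) / 2"
      unfolding T_def by (intro divide_right_mono sum_mono) auto
  qed (intro Bochner_Integration.integrable_sum integrable_divide diff2)
  also have "\<dots> = (\<Sum>e\<in>F. \<E> w. (w (e, False) - w (e, True))\<^sup>2) / 2"
    by (simp add: diff2)
  also have "\<dots> \<le> (\<Sum>e\<in>F. 4 * m2) / 2" by (intro divide_right_mono sum_mono diff2) auto
  finally show ?thesis by (simp add: var_eq_T)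
qed

text \<open>\<open>covariance_formula\<close> with \<open>g\<close> the complex exponential of
  \<open>t * S\<close>, followed by a first-order expansion of the increment of \<open>g\<close> at
  each edge. The linear part produces \<open>T\<close>, and replacing \<open>T\<close> by its mean
  costs the last term; the remainder is quadratic in one increment and multiplied by another, whence
  the third moment.\<close>

lemma stein_bound:
  fixes s t :: real
  assumes s: "s > 0" "s\<^sup>2 = var"
  defines "S \<equiv> \<lambda>w. (f w - mean) / s"
  shows "cmod ((\<E> w. \<i> * of_real (S w) * iexp (t * S w)) + t * (\<E> w. iexp (t * S w)))
    \<le> 2 * t\<^sup>2 * card F * m3 / s ^ 3 + \<bar>t\<bar> * (\<E> w. \<bar>T w - var\<bar>) / var"
proof -
  define g where "g w = iexp (t * S w)" for w
  have [measurable]: "g \<in> borel_measurable Lam" unfolding g_def S_def by measurable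
  have ng: "cmod (g w) = 1" for w by (simp add: g_def)
  have gi: "integrable Lam (\<lambda>w. g (mix A w))" for A
    by (rule Lam.integrable_const_bound[of _ 1]) (auto simp: ng)
  \<comment> \<open>Up to the factor \<open>\<i> / s\<close>, the increment of \<open>g\<close>
    minus its linear part, hence of second order in \<open>Dlt e {}\<close>.\<close>
  define r where "r e w = (\<i> / s) * (g (mix {} w) - g (mix {e} w)) + of_real (t / s\<^sup>2 * Dlt e {} w) * g (mix {} w)" for e w
  have [measurable]: "r e \<in> borel_measurable Lam" for e unfolding r_def by measurable
  have r: "cmod (r e w) \<le> t\<^sup>2 * (Dlt e {} w)\<^sup>2 / (2 * s ^ 3)" for e w
  proof -
    define y where "y = - t * Dlt e {} w / s"
    have gm: "g (mix {e} w) = g (mix {} w) * iexp y"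
      by (simp add: g_def S_def y_def Dlt_def exp_add[symmetric] diff_divide_distrib add_divide_distrib algebra_simps)
    have "r e w = (\<i> / s) * g (mix {} w) * (1 + \<i> * y - iexp y)"
      using s(1) by (simp add: r_def gm y_def field_simps power2_eq_square)
    hence "cmod (r e w) = cmod (iexp y - (1 + \<i> * y)) / s"
      using s(1) by (simp add: norm_mult norm_divide ng norm_minus_commute)
    also have "cmod (iexp y - (1 + \<i> * y)) \<le> y\<^sup>2 / 2"
      using iexp_approx1[of y 1] by (simp add: numeral_2_eq_2)
    also have "y\<^sup>2 / 2 / s = t\<^sup>2 * (Dlt e {} w)\<^sup>2 / (2 * s ^ 3)"
      by (simp add: y_def power2_eq_square power3_eq_cube mult_ac)
    finally show ?thesis using s(1) by (simp add: divide_right_mono)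
  qed
  have rD: "cmod (r e w * Dlt e (pre e) w) \<le> t\<^sup>2 / (2 * s ^ 3) * \<bar>w (e, False) - w (e, True)\<bar> ^ 3" if "e \<in> F" for e w
  proof -
    have "cmod (r e w * Dlt e (pre e) w) \<le> (t\<^sup>2 * (Dlt e {} w)\<^sup>2 / (2 * s ^ 3)) * \<bar>Dlt e (pre e) w\<bar>"
      using mult_right_mono[OF r[of e w], of "\<bar>Dlt e (pre e) w\<bar>"] by (simp add: norm_mult)
    also have "\<dots> = t\<^sup>2 / (2 * s ^ 3) * (\<bar>Dlt e {} w\<bar> ^ 2 * \<bar>Dlt e (pre e) w\<bar>)" by simp
    also have "\<dots> \<le> t\<^sup>2 / (2 * s ^ 3) * (\<bar>w (e, False) - w (e, True)\<bar> ^ 2 * \<bar>w (e, False) - w (e, True)\<bar>)"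
      by (intro mult_left_mono mult_mono power_mono abs_Dlt_le) (use pre that s(1) in auto)
    finally show ?thesis by (simp add: power3_eq_cube power2_eq_square mult.assoc)
  qed
  have gg: "integrable Lam (\<lambda>w. (g (mix {} w) - g (mix {e} w)) * of_real (Dlt e A w))" for e A
  proof (rule integrable_mult_of_squares)
    have "(cmod (g (mix {} w) - g (mix {e} w)))\<^sup>2 \<le> 2\<^sup>2" for w
      by (intro power_mono order_trans[OF norm_triangle_ineq4]) (auto simp: ng)
    thus "integrable Lam (\<lambda>w. (cmod (g (mix {} w) - g (mix {e} w)))\<^sup>2)"
      by (intro Lam.integrable_const_bound[of _ "2\<^sup>2"]) auto
  qed (use Dlt_sq in auto)
  have DDg: "integrable Lam (\<lambda>w. of_real (Dlt e {} w * Dlt e A w) * g (mix {} w))" for e A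
    by (rule Bochner_Integration.integrable_bound[OF DD_int[of e "{}" A]]) (auto simp: norm_mult ng)
  have Tg: "integrable Lam (\<lambda>w. of_real (T w) * g (mix {} w))"
    by (rule Bochner_Integration.integrable_bound[OF T_int]) (auto simp: norm_mult ng)
  have cov: "(\<E> w. g w * of_real (f w - mean)) =
    (\<Sum>e\<in>F. \<E> w. (g (mix {} w) - g (mix {e} w)) * of_real (Dlt e (pre e) w)) / 2"
    by (rule covariance_formula) (auto simp: ng)
  have 1: "(\<E> w. \<i> * of_real (S w) * g w) = (\<i> / s) * (\<E> w. g w * of_real (f w - mean))"
    by (subst integral_mult_right_zero[symmetric]) (simp add: S_def mult_ac)
  have "(\<E> w. r e w * Dlt e (pre e) w) = (\<i> / s) * (\<E> w. (g (mix {} w) - g (mix {e} w)) * of_real (Dlt e (pre e) w))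
     + t / s\<^sup>2 * (\<E> w. of_real (Dlt e {} w * Dlt e (pre e) w) * g (mix {} w))" for e
  proof -
    have "(\<E> w. r e w * Dlt e (pre e) w) = (\<E> w. (\<i> / s) * ((g (mix {} w) - g (mix {e} w)) * of_real (Dlt e (pre e) w))
       + t / s\<^sup>2 * (of_real (Dlt e {} w * Dlt e (pre e) w) * g (mix {} w)))"
      by (rule Bochner_Integration.integral_cong) (auto simp: r_def algebra_simps)
    thus ?thesis using gg DDg by simp
  qed
  hence "(\<Sum>e\<in>F. \<E> w. r e w * Dlt e (pre e) w) / 2 =
     (\<i> / s) * ((\<Sum>e\<in>F. \<E> w. (g (mix {} w) - g (mix {e} w)) * of_real (Dlt e (pre e) w)) / 2)
      + t / s\<^sup>2 * ((\<Sum>e\<in>F. \<E> w. of_real (Dlt e {} w * Dlt e (pre e) w) * g (mix {} w)) / 2)"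
    by (simp add: sum.distrib sum_distrib_left add_divide_distrib)
  also have "(\<Sum>e\<in>F. \<E> w. of_real (Dlt e {} w * Dlt e (pre e) w) * g (mix {} w)) / 2
      = (\<E> w. of_real (T w) * g (mix {} w))"
    using DDg by (simp add: T_def sum_distrib_right)
  finally have sumr: "(\<Sum>e\<in>F. \<E> w. r e w * Dlt e (pre e) w) / 2 =
     (\<i> / s) * ((\<Sum>e\<in>F. \<E> w. (g (mix {} w) - g (mix {e} w)) * of_real (Dlt e (pre e) w)) / 2)
      + t / s\<^sup>2 * (\<E> w. of_real (T w) * g (mix {} w))" .
  have 2: "(\<i> / s) * (\<E> w. g w * of_real (f w - mean)) =
     (\<Sum>e\<in>F. \<E> w. r e w * Dlt e (pre e) w) / 2 - t / s\<^sup>2 * (\<E> w. of_real (T w) * g (mix {} w))"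
    unfolding cov eq_diff_eq by (rule sumr[symmetric])
  have 3: "(\<E> w. of_real (T w - var) * g (mix {} w)) =
     (\<E> w. of_real (T w) * g (mix {} w)) - var * (\<E> w. g w)"
    using Tg gi[of "{}"] integral_mix[of g "{}"] by (simp add: left_diff_distrib)
  have 4: "(\<E> w. \<i> * of_real (S w) * g w) + t * (\<E> w. g w) =
     (\<Sum>e\<in>F. \<E> w. r e w * Dlt e (pre e) w) / 2 - t / var * (\<E> w. of_real (T w - var) * g (mix {} w))"
  proof -
    have "var \<noteq> 0" using s by auto
    thus ?thesis unfolding 1 2 3 s(2) by (simp add: field_simps)
  qed
  \<comment> \<open>The 8 is that of \<open>diff3\<close>; halving the sum of
    \<open>t\<^sup>2 / (2 * s ^ 3) * (8 * m3)\<close> over \<open>F\<close> leaves the factor 2 of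
    the statement.\<close>
  have 5: "cmod (\<Sum>e\<in>F. \<E> w. r e w * Dlt e (pre e) w) \<le> (\<Sum>e\<in>F. t\<^sup>2 / (2 * s ^ 3) * (8 * m3))"
  proof (rule order_trans[OF norm_sum sum_mono])
    fix e assume e: "e \<in> F"
    have "cmod (\<E> w. r e w * Dlt e (pre e) w) \<le> (\<E> w. cmod (r e w * Dlt e (pre e) w))"
      by (rule integral_norm_bound)
    also have "\<dots> \<le> (\<E> w. t\<^sup>2 / (2 * s ^ 3) * \<bar>w (e, False) - w (e, True)\<bar> ^ 3)"
    proof (rule integral_mono')
      show "integrable Lam (\<lambda>w. t\<^sup>2 / (2 * s ^ 3) * \<bar>w (e, False) - w (e, True)\<bar> ^ 3)"
        by (intro integrable_mult_right diff3)
    qed (use rD[OF e] s in auto)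
    also have "\<dots> \<le> t\<^sup>2 / (2 * s ^ 3) * (8 * m3)"
      using s by (simp only: integral_mult_right_zero, intro mult_left_mono diff3) auto
    finally show "cmod (\<E> w. r e w * Dlt e (pre e) w) \<le> t\<^sup>2 / (2 * s ^ 3) * (8 * m3)" .
  qed
  have 6: "cmod (\<E> w. of_real (T w - var) * g (mix {} w)) \<le> (\<E> w. \<bar>T w - var\<bar>)"
    by (rule order_trans[OF integral_norm_bound]) (simp add: norm_mult ng flip: of_real_diff)
  have v: "var > 0" using s by (metis zero_less_power)
  have "cmod ((\<E> w. \<i> * of_real (S w) * g w) + t * (\<E> w. g w)) \<le>
     cmod (\<Sum>e\<in>F. \<E> w. r e w * Dlt e (pre e) w) / 2 + \<bar>t\<bar> / var * cmod (\<E> w. of_real (T w - var) * g (mix {} w))"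
    unfolding 4 by (rule order_trans[OF norm_triangle_ineq4]) (use v in \<open>simp add: norm_mult norm_divide\<close>)
  also have "\<dots> \<le> (\<Sum>e\<in>F. t\<^sup>2 / (2 * s ^ 3) * (8 * m3)) / 2 + \<bar>t\<bar> / var * (\<E> w. \<bar>T w - var\<bar>)"
    using 5 6 v by (intro add_mono divide_right_mono mult_left_mono) auto
  also have "\<dots> = 2 * t\<^sup>2 * card F * m3 / s ^ 3 + \<bar>t\<bar> * (\<E> w. \<bar>T w - var\<bar>) / var"
    using s(1) by (simp add: field_simps)
  finally show ?thesis by (simp add: g_def)
qed

end

section \<open>Characteristic functions and concentration\<close>

text \<open>The second-order Taylor bound for \<open>iexp\<close> is uniform and can be taken inside
  the integral: the difference quotient misses the derivative by at most half the second moment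
  times the increment of the argument.\<close>

lemma (in prob_space) expectation_iexp_has_vector_derivative:
  fixes S :: "'a \<Rightarrow> real"
  assumes [measurable]: "S \<in> borel_measurable M" and S2: "integrable M (\<lambda>x. (S x)\<^sup>2)"
  shows "((\<lambda>t. \<integral>x. iexp (t * S x) \<partial>M) has_vector_derivative (\<integral>x. \<i> * S x * iexp (t * S x) \<partial>M)) (at t)"
proof -
  define C where "C = (\<integral>x. (S x)\<^sup>2 \<partial>M) / 2"
  have S1: "integrable M S" by (rule integrable_of_square) (use S2 in auto)
  have ii: "integrable M (\<lambda>x. iexp (t * S x))" for t
    by (rule integrable_const_bound[of _ 1]) auto
  have di: "integrable M (\<lambda>x. \<i> * S x * iexp (t * S x))"
    by (rule Bochner_Integration.integrable_bound[OF S1]) (auto simp: norm_mult)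
  let ?f = "\<lambda>t. \<integral>x. iexp (t * S x) \<partial>M" and ?d = "\<integral>x. \<i> * S x * iexp (t * S x) \<partial>M"
  have bnd: "cmod (?f y - ?f t - (y - t) *\<^sub>R ?d) \<le> C * (y - t)\<^sup>2" for y
  proof -
    have "?f y - ?f t - (y - t) *\<^sub>R ?d
        = (\<integral>x. iexp (t * S x) * (iexp ((y - t) * S x) - (1 + \<i> * ((y - t) * S x))) \<partial>M)"
    proof -
      have "(\<integral>x. iexp (t * S x) * (iexp ((y - t) * S x) - (1 + \<i> * ((y - t) * S x))) \<partial>M)
          = (\<integral>x. iexp (y * S x) - iexp (t * S x) - (y - t) *\<^sub>R (\<i> * S x * iexp (t * S x)) \<partial>M)"
      proof (rule Bochner_Integration.integral_cong[OF refl])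
        fix x
        have e: "iexp (y * S x) = iexp (t * S x) * iexp ((y - t) * S x)"
          by (simp add: exp_add[symmetric] algebra_simps)
        show "iexp (t * S x) * (iexp ((y - t) * S x) - (1 + \<i> * ((y - t) * S x)))
          = iexp (y * S x) - iexp (t * S x) - (y - t) *\<^sub>R (\<i> * S x * iexp (t * S x))"
          unfolding e by (simp add: algebra_simps scaleR_conv_of_real)
      qed
      thus ?thesis using ii di by simp
    qed
    also have "cmod \<dots> \<le> (\<integral>x. (y - t)\<^sup>2 * (S x)\<^sup>2 / 2 \<partial>M)"
    proof (rule order_trans[OF integral_norm_bound integral_mono'])
      fix x
      have "cmod (iexp ((y - t) * S x) - (1 + \<i> * ((y - t) * S x))) \<le> ((y - t) * S x)\<^sup>2 / 2"
        using iexp_approx1[of "(y - t) * S x" 1] by (simp add: numeral_2_eq_2)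
      thus "cmod (iexp (t * S x) * (iexp ((y - t) * S x) - (1 + \<i> * ((y - t) * S x)))) \<le> (y - t)\<^sup>2 * (S x)\<^sup>2 / 2"
        by (simp add: norm_mult power_mult_distrib)
    qed (use S2 in auto)
    also have "\<dots> = C * (y - t)\<^sup>2" by (simp add: C_def)
    finally show ?thesis .
  qed
  show ?thesis unfolding has_vector_derivative_def
  proof (rule has_derivativeI_sandwich[where H="\<lambda>y. C * \<bar>y - t\<bar>" and e=1])
    show "((\<lambda>y. C * \<bar>y - t\<bar>) \<longlongrightarrow> 0) (at t)"
      by (rule tendsto_eq_intros | simp)+
    fix y assume "y \<noteq> t"
    thus "norm (?f y - ?f t - (y - t) *\<^sub>R ?d) / norm (y - t) \<le> C * \<bar>y - t\<bar>"
      using bnd[of y] by (simp add: divide_le_eq power2_eq_square mult.assoc flip: abs_mult)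
  qed (auto intro: bounded_linear_scaleR_left)
qed

text \<open>Integrating factor: \<open>exp (s\<^sup>2 / 2) * \<phi> s\<close> would be constant if
  the equation held exactly. Its derivative between 0 and \<open>t\<close> is at most the defect
  times \<open>exp (t\<^sup>2 / 2)\<close>, and multiplying back by
  \<open>exp (- (t\<^sup>2) / 2)\<close> cancels that weight.\<close>

lemma gaussian_comparison:
  fixes \<phi> \<phi>' :: "real \<Rightarrow> complex"
  assumes 0: "\<phi> 0 = 1" and d: "\<And>s. (\<phi> has_vector_derivative \<phi>' s) (at s)"
    and b: "\<And>s. cmod (\<phi>' s + s * \<phi> s) \<le> \<delta> * (s\<^sup>2 + \<bar>s\<bar>)" and \<delta>: "0 \<le> \<delta>"
  shows "cmod (\<phi> t - complex_of_real (exp (- (t\<^sup>2) / 2))) \<le> \<bar>t\<bar> * (\<delta> * (t\<^sup>2 + \<bar>t\<bar>))"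
proof -
  define \<psi> where "\<psi> s = exp (s\<^sup>2 / 2) *\<^sub>R \<phi> s" for s :: real
  define \<psi>' where "\<psi>' s = exp (s\<^sup>2 / 2) *\<^sub>R (\<phi>' s + s * \<phi> s)" for s :: real
  have e: "((\<lambda>s. exp (s\<^sup>2 / 2)) has_real_derivative exp (s\<^sup>2 / 2) * s) (at s)" for s :: real
    by (rule derivative_eq_intros refl | simp)+
  have d\<psi>: "(\<psi> has_vector_derivative \<psi>' s) (at s)" for s
    unfolding \<psi>_def \<psi>'_def
    by (rule has_vector_derivative_eq_rhs, rule has_vector_derivative_scaleR[OF e d])
      (simp add: algebra_simps scaleR_conv_of_real)
  have nb: "norm (\<psi>' s) \<le> exp (t\<^sup>2 / 2) * (\<delta> * (t\<^sup>2 + \<bar>t\<bar>))" if "\<bar>s\<bar> \<le> \<bar>t\<bar>" for s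
  proof -
    have s2: "s\<^sup>2 \<le> t\<^sup>2" using that by (simp add: abs_le_square_iff)
    have "norm (\<psi>' s) = exp (s\<^sup>2 / 2) * cmod (\<phi>' s + s * \<phi> s)" by (simp add: \<psi>'_def)
    also have "\<dots> \<le> exp (t\<^sup>2 / 2) * (\<delta> * (t\<^sup>2 + \<bar>t\<bar>))"
      using s2 that \<delta> by (intro mult_mono order_trans[OF b] mult_left_mono add_mono) auto
    finally show ?thesis .
  qed
  have "norm (\<psi> t - \<psi> 0) \<le> exp (t\<^sup>2 / 2) * (\<delta> * (t\<^sup>2 + \<bar>t\<bar>)) * norm (t - 0)"
  proof (rule differentiable_bound[where S="closed_segment 0 t" and f'="\<lambda>s h. h *\<^sub>R \<psi>' s"])
    fix s assume "s \<in> closed_segment 0 t"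
    hence "\<bar>s\<bar> \<le> \<bar>t\<bar>" by (auto simp: closed_segment_eq_real_ivl split: if_splits)
    thus "onorm (\<lambda>h. h *\<^sub>R \<psi>' s) \<le> exp (t\<^sup>2 / 2) * (\<delta> * (t\<^sup>2 + \<bar>t\<bar>))"
      using nb[of s] by (intro onorm_le) (simp add: mult.commute mult_left_mono)
    show "(\<psi> has_derivative (\<lambda>h. h *\<^sub>R \<psi>' s)) (at s within closed_segment 0 t)"
      using d\<psi>[of s] unfolding has_vector_derivative_def by (rule has_derivative_at_withinI)
  qed auto
  hence *: "norm (\<psi> t - 1) \<le> exp (t\<^sup>2 / 2) * (\<delta> * (t\<^sup>2 + \<bar>t\<bar>)) * \<bar>t\<bar>"
    by (simp add: \<psi>_def 0)
  have ex: "exp (- (t\<^sup>2) / 2) * exp (t\<^sup>2 / 2) = 1" by (simp add: exp_add[symmetric])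
  have "\<phi> t - exp (- (t\<^sup>2) / 2) = exp (- (t\<^sup>2) / 2) *\<^sub>R (\<psi> t - 1)"
    by (simp only: \<psi>_def scaleR_right_diff_distrib scaleR_scaleR ex scaleR_one of_real_def)
  hence "cmod (\<phi> t - exp (- (t\<^sup>2) / 2)) = exp (- (t\<^sup>2) / 2) * norm (\<psi> t - 1)" by simp
  also have "\<dots> \<le> exp (- (t\<^sup>2) / 2) * (exp (t\<^sup>2 / 2) * (\<delta> * (t\<^sup>2 + \<bar>t\<bar>)) * \<bar>t\<bar>)"
    by (rule mult_left_mono[OF *]) simp
  also have "\<dots> = \<bar>t\<bar> * (\<delta> * (t\<^sup>2 + \<bar>t\<bar>))"
    by (simp add: mult.assoc[symmetric] ex[simplified])
  finally show ?thesis .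
qed

lemma abs_le_half_sq: "\<bar>z\<bar> \<le> (c + z\<^sup>2 / c) / 2" if "c > 0" for z c :: real
proof -
  have "0 \<le> (\<bar>z\<bar> - c)\<^sup>2 / c" using that by simp
  also have "(\<bar>z\<bar> - c)\<^sup>2 / c = z\<^sup>2 / c + c - 2 * \<bar>z\<bar>"
    using that by (simp add: power2_eq_square field_simps)
  finally show ?thesis by simp
qed

context iid_function begin

text \<open>Replacing the increments of \<open>f\<close> by those of the bounded local
  \<open>D e\<close> turns \<open>T\<close> into \<open>T'\<close>, whose summands are correlated
  only if their neighbourhoods meet, so its variance is at most \<open>card F * L * K ^ 4\<close>.
  The parameter \<open>\<alpha>\<close> weighs the errors \<open>\<rho> e\<close> against the
  increments; \<open>\<kappa>\<close> is the scale at which the variance is turned into a mean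
  absolute deviation.\<close>

lemma T_concentration:
  fixes D \<rho> :: "'e \<Rightarrow> ('e \<Rightarrow> real) \<Rightarrow> real" and N :: "'e \<Rightarrow> 'e set" and K R \<alpha> \<kappa> :: real and L :: nat
  assumes D_meas [measurable]: "\<And>e. D e \<in> borel_measurable Lam"
    and D_dep: "\<And>e. e \<in> F \<Longrightarrow> dep_on (N e) (D e)"
    and D_bd: "\<And>e w. 0 \<le> D e w" "\<And>e w. D e w \<le> K"
    and \<rho>_meas [measurable]: "\<And>e. \<rho> e \<in> borel_measurable Lam"
    and \<rho>_sq: "\<And>e. e \<in> F \<Longrightarrow> integrable Lam (\<lambda>w. (\<rho> e w)\<^sup>2)"
    and approx: "\<And>e w x y. e \<in> F \<Longrightarrow> 0 \<le> x \<Longrightarrow> 0 \<le> y \<Longrightarrow>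
      \<bar>f (w(e := x)) - f (w(e := y)) - (D e (w(e := x)) - D e (w(e := y)))\<bar> \<le> \<rho> e (w(e := x)) + \<rho> e (w(e := y))"
    and nonneg: "AE x in \<mu>. 0 \<le> x"
    and overlap: "\<And>e. e \<in> F \<Longrightarrow> card {e' \<in> F. N e \<inter> N e' \<noteq> {}} \<le> L"
    and R: "(\<Sum>e\<in>F. \<E> w. (\<rho> e w)\<^sup>2) \<le> R"
    and pos: "\<alpha> > 0" "\<kappa> > 0"
  shows "(\<E> w. \<bar>T w - var\<bar>) \<le>
    4 * \<alpha> * m2 * card F + 4 * R * (1 + 1 / \<alpha>) + \<kappa> / 2 + card F * L * K ^ 4 / (2 * \<kappa>)"
proof -
  define D' where "D' e A w = D e (mix A w) - D e (mix (insert e A) w)" for e A w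
  define q where "q e A w = \<rho> e (mix A w) + \<rho> e (mix (insert e A) w)" for e A w
  define d where "d e w = \<bar>w (e, False) - w (e, True)\<bar>" for e :: 'e and w :: "'e \<times> bool \<Rightarrow> real"
  define Y where "Y e w = D' e {} w * D' e (pre e) w" for e w
  define T' where "T' w = (\<Sum>e\<in>F. Y e w) / 2" for w
  have [measurable]: "D' e A \<in> borel_measurable Lam" "q e A \<in> borel_measurable Lam"
      "d e \<in> borel_measurable Lam" for e A
    unfolding D'_def q_def d_def by measurable
  have [measurable]: "Y e \<in> borel_measurable Lam" for e unfolding Y_def by measurable
  have [measurable]: "T' \<in> borel_measurable Lam" unfolding T'_def by measurable
  have K: "0 \<le> K" using D_bd[of undefined undefined] by linarith
  have D'b: "\<bar>D' e A w\<bar> \<le> K" for e A w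
    using D_bd(1)[of e "mix A w"] D_bd(2)[of e "mix A w"] D_bd(1)[of e "mix (insert e A) w"]
      D_bd(2)[of e "mix (insert e A) w"] unfolding D'_def by linarith
  have Yb: "\<bar>Y e w\<bar> \<le> K\<^sup>2" for e w
    unfolding Y_def abs_mult power2_eq_square by (intro mult_mono D'b K) auto
  have Yi: "integrable Lam (Y e)" for e
    by (rule Lam.integrable_const_bound[of _ "K\<^sup>2"]) (auto simp: Yb)
  have T'i: "integrable Lam T'" unfolding T'_def using Yi by auto
  have qi: "integrable Lam (\<lambda>w. (q e A w)\<^sup>2)" "(\<E> w. (q e A w)\<^sup>2) \<le> 4 * (\<E> w. (\<rho> e w)\<^sup>2)" if "e \<in> F" for e A
  proof -
    have r: "integrable Lam (\<lambda>w. (\<rho> e (mix A w))\<^sup>2)" for A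
      using integrable_mix[OF \<rho>_sq[OF that]] .
    have le: "(q e A w)\<^sup>2 \<le> 2 * (\<rho> e (mix A w))\<^sup>2 + 2 * (\<rho> e (mix (insert e A) w))\<^sup>2" for w
      unfolding q_def using zero_le_power2[of "\<rho> e (mix A w) - \<rho> e (mix (insert e A) w)"]
      by (simp add: power2_eq_square algebra_simps)
    have ii: "integrable Lam (\<lambda>w. 2 * (\<rho> e (mix A w))\<^sup>2 + 2 * (\<rho> e (mix (insert e A) w))\<^sup>2)"
      using r by auto
    show *: "integrable Lam (\<lambda>w. (q e A w)\<^sup>2)"
      by (rule Bochner_Integration.integrable_bound[OF ii]) (use le in auto)
    have "(\<E> w. (q e A w)\<^sup>2) \<le> (\<E> w. 2 * (\<rho> e (mix A w))\<^sup>2 + 2 * (\<rho> e (mix (insert e A) w))\<^sup>2)"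
      by (rule integral_mono[OF * ii le])
    also have "\<dots> = 4 * (\<E> w. (\<rho> e w)\<^sup>2)"
      using r integral_mix[of "\<lambda>w. (\<rho> e w)\<^sup>2" A] integral_mix[of "\<lambda>w. (\<rho> e w)\<^sup>2" "insert e A"] by simp
    finally show "(\<E> w. (q e A w)\<^sup>2) \<le> 4 * (\<E> w. (\<rho> e w)\<^sup>2)" .
  qed
  \<comment> \<open>Almost surely only, since \<open>approx\<close> compares nonnegative
    weights.\<close>
  have near: "AE w in Lam. \<bar>Dlt e A w - D' e A w\<bar> \<le> q e A w" if "e \<in> F" "e \<notin> A" for e A
  proof -
    have "AE w in Lam. 0 \<le> w (e, False) \<and> 0 \<le> w (e, True)"
      using AE_coord[OF nonneg, of "(e, False)"] AE_coord[OF nonneg, of "(e, True)"] by auto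
    thus ?thesis
    proof eventually_elim
      case (elim w)
      have "mix A w = (mix A w)(e := w (e, False))" using that by (auto simp: mix_def fun_eq_iff)
      thus ?case using approx[OF that(1), of "w (e, False)" "w (e, True)" "mix A w"] elim
        unfolding Dlt_def D'_def q_def mix_insert by metis
    qed
  qed
  have pr: "AE w in Lam. \<bar>Dlt e {} w * Dlt e (pre e) w - Y e w\<bar> \<le>
      \<alpha> * (d e w)\<^sup>2 + (1 + 1 / \<alpha>) / 2 * ((q e {} w)\<^sup>2 + (q e (pre e) w)\<^sup>2)" if e: "e \<in> F" for e
    using near[OF e pre(1)[OF e]] near[OF e, of "{}", simplified]
  proof eventually_elim
    case (elim w)
    define a b p r q0 q1 dd where abp: "a = Dlt e {} w" "b = Dlt e (pre e) w" "p = D' e {} w"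
      "r = D' e (pre e) w" "q0 = q e {} w" "q1 = q e (pre e) w" "dd = d e w"
    have 1: "\<bar>a - p\<bar> \<le> q0" "\<bar>b - r\<bar> \<le> q1" using elim by (auto simp: abp)
    have 2: "\<bar>a\<bar> \<le> dd" "\<bar>b\<bar> \<le> dd" unfolding abp d_def by (auto intro!: abs_Dlt_le pre e)
    have nn: "0 \<le> q0" "0 \<le> q1" "0 \<le> dd" using 1 2 by linarith+
    \<comment> \<open>In this splitting only \<open>r\<close> is not bounded by \<open>dd\<close>
      directly; it lies within \<open>q1\<close> of \<open>b\<close>, whence
      \<open>dd + q1\<close>.\<close>
    have "\<bar>a * b - p * r\<bar> = \<bar>a * (b - r) + r * (a - p)\<bar>" by (simp add: algebra_simps)
    also have "\<dots> \<le> \<bar>a\<bar> * \<bar>b - r\<bar> + \<bar>r\<bar> * \<bar>a - p\<bar>"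
      by (rule order_trans[OF abs_triangle_ineq]) (simp add: abs_mult)
    also have "\<dots> \<le> dd * q1 + (dd + q1) * q0"
      using 1 2 nn by (intro add_mono mult_mono) linarith+
    also have "\<dots> = dd * q1 + dd * q0 + q0 * q1" by (simp add: algebra_simps)
    also have "\<dots> \<le> (\<alpha> * dd\<^sup>2 + q1\<^sup>2 / \<alpha>) / 2 + (\<alpha> * dd\<^sup>2 + q0\<^sup>2 / \<alpha>) / 2 + (q0\<^sup>2 + q1\<^sup>2) / 2"
    proof -
      have am: "x * y \<le> (\<alpha> * x\<^sup>2 + y\<^sup>2 / \<alpha>) / 2" for x y :: real
      proof -
        have "0 \<le> (\<alpha> * x - y)\<^sup>2 / \<alpha>" using pos by simp
        also have "\<dots> = \<alpha> * x\<^sup>2 + y\<^sup>2 / \<alpha> - 2 * (x * y)"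
          using pos by (simp add: power2_eq_square field_simps)
        finally show ?thesis by simp
      qed
      have "q0 * q1 \<le> (q0\<^sup>2 + q1\<^sup>2) / 2" using sum_squares_bound[of q0 q1] by simp
      thus ?thesis using am[of dd q1] am[of dd q0] by linarith
    qed
    also have "\<dots> = \<alpha> * dd\<^sup>2 + (1 + 1 / \<alpha>) / 2 * (q0\<^sup>2 + q1\<^sup>2)" by (simp add: field_simps)
    finally show ?case by (simp add: abp Y_def)
  qed
  have prE: "(\<E> w. \<bar>Dlt e {} w * Dlt e (pre e) w - Y e w\<bar>) \<le>
      4 * \<alpha> * m2 + 4 * (1 + 1 / \<alpha>) * (\<E> w. (\<rho> e w)\<^sup>2)" if e: "e \<in> F" for e
  proof -
    have d2: "integrable Lam (\<lambda>w. (d e w)\<^sup>2)" "(\<E> w. (d e w)\<^sup>2) \<le> 4 * m2"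
      unfolding d_def power2_abs by (rule diff2)+
    have "(\<E> w. \<bar>Dlt e {} w * Dlt e (pre e) w - Y e w\<bar>) \<le>
       (\<E> w. \<alpha> * (d e w)\<^sup>2 + (1 + 1 / \<alpha>) / 2 * ((q e {} w)\<^sup>2 + (q e (pre e) w)\<^sup>2))"
      by (rule integral_mono_AE) (use pr[OF e] d2 qi[OF e] DD_int Yi in auto)
    also have "\<dots> = \<alpha> * (\<E> w. (d e w)\<^sup>2) + (1 + 1 / \<alpha>) / 2 * ((\<E> w. (q e {} w)\<^sup>2) + (\<E> w. (q e (pre e) w)\<^sup>2))"
      using d2 qi[OF e] by simp
    also have "\<dots> \<le> \<alpha> * (4 * m2) + (1 + 1 / \<alpha>) / 2 * (4 * (\<E> w. (\<rho> e w)\<^sup>2) + 4 * (\<E> w. (\<rho> e w)\<^sup>2))"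
      using pos by (intro add_mono mult_left_mono d2 qi e) auto
    finally show ?thesis by (simp add: algebra_simps add_divide_distrib)
  qed
  have TT': "(\<E> w. \<bar>T w - T' w\<bar>) \<le> 2 * \<alpha> * m2 * card F + 2 * (1 + 1 / \<alpha>) * R"
  proof -
    have "(\<E> w. \<bar>T w - T' w\<bar>) \<le> (\<E> w. (\<Sum>e\<in>F. \<bar>Dlt e {} w * Dlt e (pre e) w - Y e w\<bar>) / 2)"
    proof (rule integral_mono')
      show "integrable Lam (\<lambda>w. (\<Sum>e\<in>F. \<bar>Dlt e {} w * Dlt e (pre e) w - Y e w\<bar>) / 2)"
        using DD_int Yi by auto
      fix w
      have "T w - T' w = (\<Sum>e\<in>F. Dlt e {} w * Dlt e (pre e) w - Y e w) / 2"
        by (simp add: T_def T'_def sum_subtractf diff_divide_distrib)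
      show "\<bar>T w - T' w\<bar> \<le> (\<Sum>e\<in>F. \<bar>Dlt e {} w * Dlt e (pre e) w - Y e w\<bar>) / 2"
        unfolding \<open>T w - T' w = _\<close> abs_divide by (simp add: divide_right_mono)
    qed (auto intro: sum_nonneg)
    also have "\<dots> = (\<Sum>e\<in>F. \<E> w. \<bar>Dlt e {} w * Dlt e (pre e) w - Y e w\<bar>) / 2"
      using DD_int Yi by simp
    also have "\<dots> \<le> (\<Sum>e\<in>F. 4 * \<alpha> * m2 + 4 * (1 + 1 / \<alpha>) * (\<E> w. (\<rho> e w)\<^sup>2)) / 2"
      by (intro divide_right_mono sum_mono prE) auto
    also have "\<dots> = 2 * \<alpha> * m2 * card F + 2 * (1 + 1 / \<alpha>) * (\<Sum>e\<in>F. \<E> w. (\<rho> e w)\<^sup>2)"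
      by (simp add: sum.distrib sum_distrib_left[symmetric] add_divide_distrib)
    also have "\<dots> \<le> 2 * \<alpha> * m2 * card F + 2 * (1 + 1 / \<alpha>) * R"
      using R pos by (intro add_left_mono mult_left_mono) auto
    finally show ?thesis .
  qed
  define Z where "Z e w = Y e w - (\<E> w. Y e w)" for e w
  have [measurable]: "Z e \<in> borel_measurable Lam" for e unfolding Z_def by measurable
  have Zb: "\<bar>Z e w\<bar> \<le> 2 * K\<^sup>2" for e w
  proof -
    have "\<bar>\<E> w. Y e w\<bar> \<le> (\<E> w. \<bar>Y e w\<bar>)" using integral_norm_bound[of Lam "Y e"] by simp
    also have "\<dots> \<le> (\<integral>w. K\<^sup>2 \<partial>(Lam :: ('e \<times> bool \<Rightarrow> real) measure))"
      by (rule integral_mono) (use Yi Yb in auto)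
    also have "\<dots> = K\<^sup>2" by simp
    finally show ?thesis using Yb[of e w] unfolding Z_def by linarith
  qed
  have Zi: "integrable Lam (Z e)" for e unfolding Z_def using Yi by auto
  have Z0: "(\<E> w. Z e w) = 0" for e unfolding Z_def using Yi by simp
  have ZZb: "\<bar>Z e w * Z e' w\<bar> \<le> 4 * K ^ 4" for e e' w
  proof -
    have "\<bar>Z e w * Z e' w\<bar> \<le> (2 * K\<^sup>2) * (2 * K\<^sup>2)" unfolding abs_mult by (intro mult_mono Zb) auto
    thus ?thesis by (simp add: power2_eq_square power4_eq_xxxx mult_ac)
  qed
  have ZZi: "integrable Lam (\<lambda>w. Z e w * Z e' w)" for e e'
    by (rule Lam.integrable_const_bound[of _ "4 * K ^ 4"]) (use ZZb in auto)
  have Ydep: "dep_on (N e \<times> UNIV) (Z e)" if eF: "e \<in> F" for e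
  proof -
    have "Z e w = Z e w'" if w: "\<forall>i\<in>N e \<times> UNIV. w i = w' i" for w w'
    proof -
      have eq: "D e (mix A w) = D e (mix A w')" for A
        by (rule dep_onD[OF D_dep[OF eF]]) (use w in \<open>auto simp: mix_def\<close>)
      show ?thesis unfolding Z_def Y_def D'_def eq by (rule refl)
    qed
    thus ?thesis unfolding dep_on_def by blast
  qed
  \<comment> \<open>Disjoint neighbourhoods give independent centred summands, hence covariance 0;
    otherwise each factor is at most \<open>2 * K\<^sup>2\<close>.\<close>
  have cov: "(\<E> w. Z e w * Z e' w) \<le> (if N e \<inter> N e' \<noteq> {} then 4 * K ^ 4 else 0)" if "e \<in> F" "e' \<in> F" for e e'
  proof (cases "N e \<inter> N e' = {}")
    case True
    have "(\<E> w. Z e w * Z e' w) = (\<E> w. Z e w) * (\<E> w. Z e' w)"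
      by (rule integral_mult_dep_on[OF Zi Zi Ydep Ydep]) (use True that in auto)
    thus ?thesis using True by (simp add: Z0)
  next
    case False
    have "(\<E> w. Z e w * Z e' w) \<le> (\<integral>w. 4 * K ^ 4 \<partial>(Lam :: ('e \<times> bool \<Rightarrow> real) measure))"
      by (rule integral_mono[OF ZZi]) (simp_all add: abs_le_D1[OF ZZb])
    thus ?thesis using False by simp
  qed
  have varT': "(\<E> w. (T' w - (\<E> w. T' w))\<^sup>2) \<le> card F * L * K ^ 4"
      and vi: "integrable Lam (\<lambda>w. (T' w - (\<E> w. T' w))\<^sup>2)"
  proof -
    have eq: "(T' w - (\<E> w. T' w))\<^sup>2 = (\<Sum>e\<in>F. \<Sum>e'\<in>F. Z e w * Z e' w) / 4" for w
    proof -
      have "T' w - (\<E> w. T' w) = (\<Sum>e\<in>F. Z e w) / 2"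
        using Yi by (simp add: T'_def Z_def sum_subtractf diff_divide_distrib)
      show ?thesis
        unfolding \<open>T' w - _ = _\<close> power_divide by (simp add: power2_eq_square sum_product)
    qed
    show "integrable Lam (\<lambda>w. (T' w - (\<E> w. T' w))\<^sup>2)" unfolding eq using ZZi by auto
    have "(\<E> w. (T' w - (\<E> w. T' w))\<^sup>2) = (\<Sum>e\<in>F. \<Sum>e'\<in>F. \<E> w. Z e w * Z e' w) / 4"
      unfolding eq using ZZi by simp
    also have "\<dots> \<le> (\<Sum>e\<in>F. \<Sum>e'\<in>F. if N e \<inter> N e' \<noteq> {} then 4 * K ^ 4 else 0) / 4"
      by (intro divide_right_mono sum_mono cov) auto
    also have "\<dots> = (\<Sum>e\<in>F. card {e' \<in> F. N e \<inter> N e' \<noteq> {}} * K ^ 4)"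
      using fin_F by (simp add: sum.If_cases Int_def sum_divide_distrib mult.assoc conj_commute)
    also have "\<dots> \<le> (\<Sum>e\<in>F. L * K ^ 4)"
      using overlap by (intro sum_mono mult_right_mono) auto
    finally show "(\<E> w. (T' w - (\<E> w. T' w))\<^sup>2) \<le> card F * L * K ^ 4" by simp
  qed
  have l1T': "(\<E> w. \<bar>T' w - (\<E> w. T' w)\<bar>) \<le> \<kappa> / 2 + card F * L * K ^ 4 / (2 * \<kappa>)"
  proof -
    have "(\<E> w. \<bar>T' w - (\<E> w. T' w)\<bar>) \<le> (\<E> w. (\<kappa> + (T' w - (\<E> w. T' w))\<^sup>2 / \<kappa>) / 2)"
      by (rule integral_mono) (use T'i vi abs_le_half_sq[OF pos(2)] in auto)
    also have "\<dots> = (\<kappa> + (\<E> w. (T' w - (\<E> w. T' w))\<^sup>2) / \<kappa>) / 2" using vi by simp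
    also have "\<dots> \<le> (\<kappa> + (card F * L * K ^ 4) / \<kappa>) / 2"
      using varT' pos by (intro divide_right_mono add_left_mono) auto
    finally show ?thesis by (simp add: add_divide_distrib)
  qed
  \<comment> \<open>\<open>var\<close> is the mean of \<open>T\<close>, so recentring costs the
    distance of \<open>T\<close> and \<open>T'\<close> once more; this doubles the bound
    \<open>TT'\<close> at the end.\<close>
  have mm: "\<bar>(\<E> w. T' w) - var\<bar> \<le> (\<E> w. \<bar>T w - T' w\<bar>)"
  proof -
    have "(\<E> w. T' w) - var = - (\<E> w. T w - T' w)" using T_int T'i by (simp add: var_eq_T)
    thus ?thesis using integral_norm_bound[of Lam "\<lambda>w. T w - T' w"] by simp
  qed
  have "(\<E> w. \<bar>T w - var\<bar>) \<le> (\<E> w. \<bar>T w - T' w\<bar> + \<bar>T' w - (\<E> w. T' w)\<bar> + \<bar>(\<E> w. T' w) - var\<bar>)"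
    by (rule integral_mono) (use T_int T'i in auto)
  also have "\<dots> = (\<E> w. \<bar>T w - T' w\<bar>) + (\<E> w. \<bar>T' w - (\<E> w. T' w)\<bar>) + \<bar>(\<E> w. T' w) - var\<bar>"
    using T_int T'i by simp
  also have "\<dots> \<le> 2 * (2 * \<alpha> * m2 * card F + 2 * (1 + 1 / \<alpha>) * R) + (\<kappa> / 2 + card F * L * K ^ 4 / (2 * \<kappa>))"
    by (rule order_trans[OF add_mono[OF add_mono[OF TT' l1T'] order_trans[OF mm TT']]]) simp
  finally show ?thesis by (simp add: algebra_simps)
qed

end

section \<open>Clusters separated by closed edges\<close>

definition reach :: "'v set \<Rightarrow> 'v set set \<Rightarrow> 'v set \<Rightarrow> 'v set" where
  "reach V T R = {x. \<exists>r\<in>R. (adj V T)\<^sup>*\<^sup>* r x}"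

text \<open>The edges whose state an exploration from \<open>R\<close> has to inspect: those inside
  the explored clusters and the closed ones that bound them.\<close>

definition touch :: "'v set \<Rightarrow> 'v set set \<Rightarrow> 'v set set \<Rightarrow> 'v set \<Rightarrow> 'v set set" where
  "touch V F T R = {e \<in> F. e \<inter> reach V T R \<noteq> {}}"

definition simple_edges :: "'v set \<Rightarrow> 'v set set \<Rightarrow> bool" where
  "simple_edges V F \<longleftrightarrow> (\<forall>e\<in>F. \<exists>u v. e = {u, v} \<and> u \<noteq> v \<and> u \<in> V \<and> v \<in> V)"

lemma simple_edgesE:
  assumes "simple_edges V F" "e \<in> F"
  obtains u v where "e = {u, v}" "u \<noteq> v" "u \<in> V" "v \<in> V"
  using assms unfolding simple_edges_def by blast

text \<open>Recursion step of the exploration: once \<open>e\<close> at the root \<open>x\<close> is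
  known to be open, its other end becomes a root and \<open>e\<close> can be discarded.\<close>

lemma reach_delete_edge:
  assumes e: "e = {x, y}" "e \<in> T" and xy: "x \<in> R" "x \<noteq> y" "x \<in> V" "y \<in> V"
  shows "reach V T R = reach V (T - {e}) (insert y R)"
proof
  show "reach V T R \<subseteq> reach V (T - {e}) (insert y R)"
  proof
    fix z assume "z \<in> reach V T R"
    then obtain r where r: "r \<in> R" "(adj V T)\<^sup>*\<^sup>* r z" by (auto simp: reach_def)
    from r(2) show "z \<in> reach V (T - {e}) (insert y R)"
    proof (induction rule: rtranclp_induct)
      case base
      thus ?case using r(1) by (auto simp: reach_def)
    next
      case (step s z)
      show ?case
      proof (cases "{s, z} = e")
        case True
        hence "z \<in> insert y R" using e xy by (auto simp: doubleton_eq_iff)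
        thus ?thesis by (auto simp: reach_def)
      next
        case False
        hence "adj V (T - {e}) s z" using step by (auto simp: adj_def)
        thus ?thesis using step.IH unfolding reach_def by (blast intro: rtranclp.rtrancl_into_rtrancl)
      qed
    qed
  qed
  show "reach V (T - {e}) (insert y R) \<subseteq> reach V T R"
  proof
    fix z assume "z \<in> reach V (T - {e}) (insert y R)"
    then obtain r where r: "r \<in> insert y R" "(adj V (T - {e}))\<^sup>*\<^sup>* r z" by (auto simp: reach_def)
    have rz: "(adj V T)\<^sup>*\<^sup>* r z" by (rule adj_rtranclp_mono[OF r(2)]) auto
    have "adj V T x y" using e xy by (auto simp: adj_def)
    thus "z \<in> reach V T R" using rz r(1) xy(1) unfolding reach_def
      by (auto intro: converse_rtranclp_into_rtranclp)
  qed
qed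

lemma reach_isolated:
  assumes "\<And>e. e \<in> T \<Longrightarrow> e \<inter> R = {}"
  shows "reach V T R = R"
proof -
  have "z \<in> R" if "(adj V T)\<^sup>*\<^sup>* r z" "r \<in> R" for r z
    using that by (induction rule: rtranclp_induct) (use assms in \<open>auto simp: adj_def\<close>)
  thus ?thesis by (auto simp: reach_def)
qed

lemma reach_singleton_eq:
  assumes "z \<in> reach V T {b}"
  shows "reach V T {z} = reach V T {b}"
  using assms unfolding reach_def by (auto intro: rtranclp_trans dest: adj_rtranclp_sym)

text \<open>Finite-volume form of the closed edges between two distinct infinite clusters:
  \<open>B\<close> plays the part of infinity and will be the boundary of a finite subgraph.\<close>

definition separating :: "'v set \<Rightarrow> 'v set set \<Rightarrow> 'v set set \<Rightarrow> 'v set \<Rightarrow> 'v set set" where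
  "separating V F T B = {e \<in> F - T. \<exists>x y. e = {x, y} \<and> \<not> (adj V T)\<^sup>*\<^sup>* x y
     \<and> x \<in> reach V T B \<and> y \<in> reach V T B}"

definition clusters :: "'v set \<Rightarrow> 'v set set \<Rightarrow> 'v set \<Rightarrow> 'v set set" where
  "clusters V T B = (\<lambda>b. reach V T {b}) ` B"

text \<open>A \<open>B\<close>-cluster meeting \<open>e\<close> is the cluster of one of its ends,
  so there are at most two. The ends of an open edge share their cluster; a separating edge meets
  two, one more than its single occurrence in \<open>touch\<close>.\<close>

lemma cluster_count:
  assumes T: "T \<subseteq> F" and s: "simple_edges V F" and e: "e \<in> F" and B: "finite B"
  defines "N \<equiv> card {C \<in> clusters V T B. e \<inter> C \<noteq> {}}"
  shows "N \<le> 2" "e \<in> T \<Longrightarrow> N = of_bool (e \<in> touch V F T B)"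
    "of_bool (e \<in> touch V F T B) + of_bool (e \<in> separating V F T B) \<le> N"
proof -
  obtain u v where uv: "e = {u, v}" "u \<noteq> v" "u \<in> V" "v \<in> V" using simple_edgesE[OF s e] by metis
  let ?S = "{C \<in> clusters V T B. e \<inter> C \<noteq> {}}"
  have fin: "finite ?S" using B by (simp add: clusters_def)
  have sub: "?S \<subseteq> {reach V T {u}, reach V T {v}}"
    using uv(1) reach_singleton_eq by (fastforce simp: clusters_def)
  have "card {reach V T {u}, reach V T {v}} \<le> 2" by (simp add: card_insert_if)
  thus "N \<le> 2" unfolding N_def using card_mono[OF _ sub] by simp
  have ne: "?S \<noteq> {}" if t: "e \<in> touch V F T B"
  proof -
    obtain z b where "z \<in> e" "b \<in> B" "z \<in> reach V T {b}" using t by (auto simp: touch_def reach_def)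
    thus ?thesis by (auto simp: clusters_def)
  qed
  have ge1: "1 \<le> N" if "e \<in> touch V F T B"
  proof -
    have "0 < card ?S" by (rule card_gt_0_iff[THEN iffD2]) (use ne[OF that] fin in blast)
    thus ?thesis unfolding N_def by linarith
  qed
  have z0: "N = 0" if "e \<notin> touch V F T B"
  proof -
    have "?S = {}" using that e by (auto simp: touch_def clusters_def reach_def)
    thus ?thesis unfolding N_def by (metis card.empty)
  qed
  show "N = of_bool (e \<in> touch V F T B)" if "e \<in> T"
  proof -
    have "adj V T u v" using that uv by (auto simp: adj_def)
    hence "v \<in> reach V T {u}" by (auto simp: reach_def)
    hence "?S \<subseteq> {reach V T {u}}" using sub reach_singleton_eq[of v V T u] by simp
    hence "N \<le> 1" unfolding N_def using card_mono[of "{reach V T {u}}" ?S] by simp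
    thus ?thesis using ge1 z0 by (cases "e \<in> touch V F T B") auto
  qed
  show "of_bool (e \<in> touch V F T B) + of_bool (e \<in> separating V F T B) \<le> N"
  proof (cases "e \<in> separating V F T B")
    case True
    then obtain x y where xy: "e = {x, y}" "\<not> (adj V T)\<^sup>*\<^sup>* x y" "x \<in> reach V T B" "y \<in> reach V T B"
      by (auto simp: separating_def)
    have mem: "reach V T {z} \<in> ?S" if z: "z \<in> reach V T B" "z \<in> e" for z
    proof -
      obtain b where b: "b \<in> B" "z \<in> reach V T {b}" using z by (auto simp: reach_def)
      hence "reach V T {z} \<in> clusters V T B" unfolding clusters_def reach_singleton_eq[OF b(2)] by blast
      moreover have "z \<in> reach V T {z}" by (auto simp: reach_def)
      ultimately show ?thesis using z by blast
    qed
    have "reach V T {x} \<noteq> reach V T {y}" using xy(2) by (auto simp: reach_def)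
    hence "2 = card {reach V T {x}, reach V T {y}}" by simp
    also have "\<dots> \<le> N" unfolding N_def by (rule card_mono[OF fin]) (use mem xy in auto)
    finally show ?thesis by (simp add: of_bool_def)
  next
    case False
    thus ?thesis using ge1 by (cases "e \<in> touch V F T B") auto
  qed
qed

section \<open>Exponential moments of a centred coin\<close>

lemma exp_le_quadratic:
  fixes s :: real
  assumes "\<bar>s\<bar> \<le> 1"
  shows "exp s \<le> 1 + s + s\<^sup>2"
proof (cases "0 \<le> s")
  case True
  thus ?thesis using exp_bound[of s] assms by simp
next
  case False
  define x where "x = - s"
  have x: "0 \<le> x" "x \<le> 1" using False assms by (auto simp: x_def)
  have "1 \<le> (1 + x) * (1 - x + x\<^sup>2)" using x by (simp add: power2_eq_square algebra_simps)
  also have "\<dots> \<le> exp x * (1 - x + x\<^sup>2)" using x by (intro mult_right_mono exp_ge_add_one_self) auto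
  finally have "exp (- x) * 1 \<le> exp (- x) * (exp x * (1 - x + x\<^sup>2))" by (intro mult_left_mono) auto
  hence "exp (- x) \<le> 1 - x + x\<^sup>2" by (simp add: mult.assoc[symmetric] exp_add[symmetric])
  thus ?thesis by (simp add: x_def)
qed

text \<open>For a centred Bernoulli variable \<open>X\<close> the mean of
  \<open>exp (\<theta> * X)\<close> is at most \<open>1 + \<theta>\<^sup>2\<close>, hence at most
  \<open>exp (\<theta>\<^sup>2)\<close>. Paying \<open>\<theta>\<^sup>2\<close> for every inspected
  edge therefore makes the exponential of the imbalance a supermartingale.\<close>

lemma bernoulli_mgf:
  fixes q \<theta> :: real
  assumes q: "0 \<le> q" "q \<le> 1" and \<theta>: "\<bar>\<theta>\<bar> \<le> 1"
  shows "q * exp (\<theta> * (1 - q) - \<theta>\<^sup>2) + (1 - q) * exp (\<theta> * (- q) - \<theta>\<^sup>2) \<le> 1"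
proof -
  have b: "\<bar>\<theta> * (1 - q)\<bar> \<le> 1" "\<bar>\<theta> * (- q)\<bar> \<le> 1"
    using mult_mono[OF \<theta>, of "\<bar>1 - q\<bar>" 1] mult_mono[OF \<theta>, of "\<bar>-q\<bar>" 1] q by (auto simp: abs_mult)
  have "q * exp (\<theta> * (1 - q)) + (1 - q) * exp (\<theta> * (- q)) \<le>
      q * (1 + \<theta> * (1 - q) + (\<theta> * (1 - q))\<^sup>2) + (1 - q) * (1 + \<theta> * (- q) + (\<theta> * (- q))\<^sup>2)"
    using q b by (intro add_mono mult_left_mono exp_le_quadratic) auto
  also have "\<dots> = 1 + \<theta>\<^sup>2 * (q * (1 - q))" by (simp add: power2_eq_square algebra_simps)
  also have "\<dots> \<le> 1 + \<theta>\<^sup>2 * 1"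
    using q by (intro add_left_mono mult_left_mono mult_le_one) auto
  also have "\<dots> \<le> exp (\<theta>\<^sup>2)" using exp_ge_add_one_self[of "\<theta>\<^sup>2"] by simp
  finally have "(q * exp (\<theta> * (1 - q)) + (1 - q) * exp (\<theta> * (- q))) * exp (- (\<theta>\<^sup>2)) \<le> exp (\<theta>\<^sup>2) * exp (- (\<theta>\<^sup>2))"
    by (intro mult_right_mono) auto
  moreover have "exp (\<theta>\<^sup>2) * exp (- (\<theta>\<^sup>2)) = 1" by (rule exp_minus_inverse)
  moreover have "exp (x - \<theta>\<^sup>2) = exp x * exp (- (\<theta>\<^sup>2))" for x by (simp add: exp_add[symmetric])
  ultimately show ?thesis by (simp only: distrib_right mult.assoc)
qed

text \<open>\<open>\<xi>\<close> is the centred state of an edge. An open edge contributes equally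
  to the sum over \<open>touch\<close> and to the sum over clusters, while a closed edge contributes
  \<open>- q\<close> to the latter once per cluster it meets; the difference thus gains
  \<open>q\<close> from every separating edge.\<close>

lemma open_closed_balance:
  fixes q :: real
  assumes T: "T \<subseteq> F" and s: "simple_edges V F" and fin: "finite F" "finite B" and q: "0 \<le> q"
  defines "\<xi> \<equiv> \<lambda>e. if e \<in> T then 1 - q else - q"
  shows "q * card (separating V F T B) \<le>
    (\<Sum>e\<in>touch V F T B. \<xi> e) - (\<Sum>C\<in>clusters V T B. \<Sum>e\<in>{e \<in> F. e \<inter> C \<noteq> {}}. \<xi> e)"
    and "(\<Sum>C\<in>clusters V T B. card {e \<in> F. e \<inter> C \<noteq> {}}) \<le> 2 * card F"
proof -
  let ?N = "\<lambda>e. card {C \<in> clusters V T B. e \<inter> C \<noteq> {}}"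
  have fC: "finite (clusters V T B)" using fin by (simp add: clusters_def)
  have sw: "(\<Sum>C\<in>clusters V T B. \<Sum>e\<in>{e \<in> F. e \<inter> C \<noteq> {}}. h e) = (\<Sum>e\<in>F. of_nat (?N e) * h e)"
    for h :: "'a set \<Rightarrow> 'b::semiring_1"
  proof -
    have "(\<Sum>C\<in>clusters V T B. \<Sum>e\<in>{e \<in> F. e \<inter> C \<noteq> {}}. h e)
        = (\<Sum>e\<in>F. \<Sum>C\<in>{C \<in> clusters V T B. e \<inter> C \<noteq> {}}. h e)"
      by (rule sum.swap_restrict[OF fC fin(1)])
    thus ?thesis by simp
  qed
  have "(\<Sum>C\<in>clusters V T B. card {e \<in> F. e \<inter> C \<noteq> {}}) = (\<Sum>e\<in>F. ?N e)"
    using sw[of "\<lambda>_. 1 :: nat"] by simp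
  also have "\<dots> \<le> (\<Sum>e\<in>F. 2)" by (intro sum_mono cluster_count[OF T s _ fin(2)])
  finally show "(\<Sum>C\<in>clusters V T B. card {e \<in> F. e \<inter> C \<noteq> {}}) \<le> 2 * card F" by simp
  have "q * card (separating V F T B) = (\<Sum>e\<in>F. q * of_bool (e \<in> separating V F T B))"
  proof -
    have "{e \<in> F. e \<in> separating V F T B} = separating V F T B" by (auto simp: separating_def)
    thus ?thesis using fin by (simp add: sum_distrib_left[symmetric] sum_of_bool_eq Int_def)
  qed
  also have "\<dots> \<le> (\<Sum>e\<in>F. of_bool (e \<in> touch V F T B) * \<xi> e - ?N e * \<xi> e)"
  proof (rule sum_mono)
    fix e assume e: "e \<in> F"
    note c = cluster_count[OF T s e fin(2)]
    show "q * of_bool (e \<in> separating V F T B) \<le> of_bool (e \<in> touch V F T B) * \<xi> e - ?N e * \<xi> e"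
    proof (cases "e \<in> T")
      case True
      thus ?thesis using c(2) by (simp add: separating_def)
    next
      case False
      have "real (of_bool (e \<in> touch V F T B) + of_bool (e \<in> separating V F T B)) \<le> real (?N e)"
        using c(3) by (rule of_nat_mono)
      hence "q * (of_bool (e \<in> touch V F T B) + of_bool (e \<in> separating V F T B)) \<le> q * real (?N e)"
        using q by (intro mult_left_mono) auto
      thus ?thesis using False by (simp add: \<xi>_def algebra_simps)
    qed
  qed
  also have "\<dots> = (\<Sum>e\<in>touch V F T B. \<xi> e) - (\<Sum>C\<in>clusters V T B. \<Sum>e\<in>{e \<in> F. e \<inter> C \<noteq> {}}. \<xi> e)"
  proof -
    have "(\<Sum>e\<in>F. of_bool (e \<in> touch V F T B) * \<xi> e) = (\<Sum>e\<in>touch V F T B. \<xi> e)"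
      using fin by (simp add: touch_def sum.inter_filter of_bool_def if_distrib[of "\<lambda>x. x * _"] cong: if_cong)
    thus ?thesis by (simp add: sum_subtractf sw[of \<xi>])
  qed
  finally show "q * card (separating V F T B) \<le>
    (\<Sum>e\<in>touch V F T B. \<xi> e) - (\<Sum>C\<in>clusters V T B. \<Sum>e\<in>{e \<in> F. e \<inter> C \<noteq> {}}. \<xi> e)" .
qed

context iid begin

lemma integrable_open_edges:
  fixes F :: "'i set" and h :: "'i set \<Rightarrow> real"
  assumes "finite F"
  shows "integrable Lam (\<lambda>w. h {e \<in> F. w e \<le> p})"
proof (rule Lam.integrable_const_bound)
  show "(\<lambda>w. h {e \<in> F. w e \<le> p}) \<in> borel_measurable Lam"
    by (rule measurable_compose[OF measurable_open_edges[OF assms]]) simp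
  have "\<bar>h {e \<in> F. w e \<le> p}\<bar> \<le> (\<Sum>T\<in>Pow F. \<bar>h T\<bar>)" for w
    by (rule member_le_sum) (use assms in auto)
  thus "AE w in Lam. norm (h {e \<in> F. w e \<le> p}) \<le> (\<Sum>T\<in>Pow F. \<bar>h T\<bar>)" by auto
qed

definition popen :: "real \<Rightarrow> real" where "popen p = measure \<mu> {..p}"

lemma popen_bounds: "0 \<le> popen p" "popen p \<le> 1"
  by (auto simp: popen_def)

lemma expectation_open: "(\<E> w. of_bool (w i \<le> p)) = popen p"
  and expectation_closed: "(\<E> w. of_bool (\<not> w i \<le> p)) = 1 - popen p"
proof -
  have 1: "(\<integral>x. of_bool (x \<le> p) \<partial>\<mu>) = popen p"
  proof -
    have "(\<integral>x. of_bool (x \<le> p) \<partial>\<mu>) = (\<integral>x. (indicator {..p} x :: real) \<partial>\<mu>)"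
      by (rule Bochner_Integration.integral_cong) (auto simp: indicator_def)
    thus ?thesis by (simp add: popen_def)
  qed
  thus op: "(\<E> w. of_bool (w i \<le> p)) = popen p"
    using integral_coord[of "\<lambda>x. of_bool (x \<le> p) :: real" i] by simp
  have "(\<E> w. of_bool (\<not> w i \<le> p)) = (\<E> w. 1 - of_bool (w i \<le> p))"
    by (rule Bochner_Integration.integral_cong) auto
  also have "\<dots> = 1 - popen p"
    using op by (subst Bochner_Integration.integral_diff)
      (auto intro!: Lam.integrable_const_bound[of _ 1])
  finally show "(\<E> w. of_bool (\<not> w i \<le> p)) = 1 - popen p" .
qed

text \<open>The factors for inspected open and closed edges are kept abstract: the induction only
  needs their mean to be at most 1, and the exponential tilt is inserted afterwards.\<close>

definition explore :: "'v set \<Rightarrow> real \<Rightarrow> real \<Rightarrow> 'v set set \<Rightarrow> 'v set set \<Rightarrow> 'v set \<Rightarrow> real" where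
  "explore V a b F T R = (\<Prod>e\<in>touch V F T R. if e \<in> T then a else b)"

text \<open>Revealing an edge at the explored set first reduces to the graph without that edge, so the
  exponential functional of the exploration is a supermartingale by induction on the edges.\<close>

lemma expectation_explore_le:
  fixes F :: "'v set set"
  assumes "finite F" "simple_edges V F" "R \<subseteq> V" "0 \<le> a" "0 \<le> b" "popen p * a + (1 - popen p) * b \<le> 1"
  shows "(\<E> w. explore V a b F {e \<in> F. w e \<le> p} R) \<le> 1"
  using assms(1-3)
proof (induction "card F" arbitrary: F R rule: less_induct)
  case less
  show ?case
  proof (cases "\<exists>e\<in>F. e \<inter> R \<noteq> {}")
    case False
    have "explore V a b F {e \<in> F. w e \<le> p} R = 1" for w
    proof -
      have "reach V {e \<in> F. w e \<le> p} R = R" by (rule reach_isolated) (use False in auto)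
      hence "touch V F {e \<in> F. w e \<le> p} R = {}" using False by (auto simp: touch_def)
      thus ?thesis by (simp add: explore_def)
    qed
    thus ?thesis by simp
  next
    case True
    then obtain e x where ex: "e \<in> F" "x \<in> e" "x \<in> R" by blast
    then obtain y where y: "e = {x, y}" "x \<noteq> y" "x \<in> V" "y \<in> V"
      using simple_edgesE[OF less.prems(2) ex(1)] by (metis empty_iff insert_commute insert_iff)
    define F' where "F' = F - {e}"
    have F': "finite F'" "simple_edges V F'" "card F' < card F"
      using less.prems ex(1) card_Diff1_less[of F e] by (auto simp: F'_def simple_edges_def)
    let ?H = "\<lambda>R w. explore V a b F' {e \<in> F'. w e \<le> p} R"
    \<comment> \<open>Conditioning on \<open>e\<close>: if it is open, \<open>y\<close> becomes a
      root; if closed, the roots stay. Either way the remaining functional lives on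
      \<open>F'\<close> and is independent of \<open>w e\<close>.\<close>
    have H: "explore V a b F {e \<in> F. w e \<le> p} R =
       a * (of_bool (w e \<le> p) * ?H (insert y R) w) + b * (of_bool (\<not> w e \<le> p) * ?H R w)" for w
    proof (cases "w e \<le> p")
      case True
      let ?T = "{e \<in> F. w e \<le> p}" and ?T' = "{e \<in> F'. w e \<le> p}"
      have T': "?T - {e} = ?T'" by (auto simp: F'_def)
      have r: "reach V ?T R = reach V ?T' (insert y R)"
        using reach_delete_edge[OF y(1) _ ex(3) y(2-4), of ?T] True ex T' by simp
      have "y \<in> reach V ?T' (insert y R)" by (auto simp: reach_def)
      hence "touch V F ?T R = insert e (touch V F' ?T' (insert y R))"
        using ex y unfolding touch_def r by (auto simp: F'_def)
      moreover have "e \<notin> touch V F' ?T' (insert y R)" "finite (touch V F' ?T' (insert y R))"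
        using F' by (auto simp: touch_def F'_def)
      moreover have "(\<Prod>g\<in>touch V F' ?T' (insert y R). if g \<in> ?T then a else b)
          = (\<Prod>g\<in>touch V F' ?T' (insert y R). if g \<in> ?T' then a else b)"
        by (rule prod.cong) (auto simp: touch_def F'_def)
      ultimately show ?thesis using True ex by (simp add: explore_def)
    next
      case False
      let ?T = "{e \<in> F. w e \<le> p}" and ?T' = "{e \<in> F'. w e \<le> p}"
      have T': "?T = ?T'" using False by (auto simp: F'_def)
      have "x \<in> reach V ?T R" using ex by (auto simp: reach_def)
      hence "touch V F ?T R = insert e (touch V F' ?T R)"
        using ex unfolding touch_def by (auto simp: F'_def)
      moreover have "e \<notin> touch V F' ?T R" "finite (touch V F' ?T R)"
        using F' by (auto simp: touch_def F'_def)
      ultimately show ?thesis using False ex T' by (simp add: explore_def)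
    qed
    have Hi: "integrable Lam (?H R')" for R' by (rule integrable_open_edges[OF F'(1)])
    have oi: "integrable Lam (\<lambda>w. of_bool (w e \<le> p) :: real)" "integrable Lam (\<lambda>w. of_bool (\<not> w e \<le> p) :: real)"
      by (auto intro!: Lam.integrable_const_bound[of _ 1])
    have dH: "dep_on F' (?H R')" for R'
    proof -
      have "?H R' w = ?H R' w'" if "\<forall>i\<in>F'. w i = w' i" for w w' :: "'v set \<Rightarrow> real"
      proof -
        have "{e \<in> F'. w e \<le> p} = {e \<in> F'. w' e \<le> p}" using that by auto
        thus ?thesis by (simp only:)
      qed
      thus ?thesis unfolding dep_on_def by blast
    qed
    have do: "dep_on {e} (\<lambda>w. of_bool (w e \<le> p) :: real)" "dep_on {e} (\<lambda>w. of_bool (\<not> w e \<le> p) :: real)"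
      by (auto simp: dep_on_def)
    have dis: "{e} \<inter> F' = {}" by (auto simp: F'_def)
    note m1 = integral_mult_dep_on[OF oi(1) Hi do(1) dH dis] and m2 = integral_mult_dep_on[OF oi(2) Hi do(2) dH dis]
    have IH: "(\<E> w. ?H R' w) \<le> 1" if "R' \<subseteq> V" for R'
      using less.hyps[OF F'(3,1,2) that] .
    have "(\<E> w. explore V a b F {e \<in> F. w e \<le> p} R)
        = a * (popen p * (\<E> w. ?H (insert y R) w)) + b * ((1 - popen p) * (\<E> w. ?H R w))"
      unfolding H using m1 m2 by (simp add: expectation_open expectation_closed)
    also have "\<dots> \<le> a * (popen p * 1) + b * ((1 - popen p) * 1)"
      using assms(4,5) popen_bounds[of p] less.prems(3) y(4)
      by (intro add_mono mult_left_mono IH) auto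
    also have "\<dots> \<le> 1" using assms(6) by (simp add: mult.commute)
    finally show ?thesis .
  qed
qed

text \<open>Aizenman--Kesten--Newman: exploring all clusters of \<open>B\<close> jointly counts a closed edge
  between two of them once, exploring them one by one counts it twice, and both explorations have
  small mean imbalance between open and closed edges.\<close>

lemma expectation_separating_le:
  fixes F :: "'v set set" and \<theta> p :: real
  assumes fin: "finite F" "finite B" and s: "simple_edges V F" and B: "B \<subseteq> V" and \<theta>: "0 < \<theta>" "\<theta> \<le> 1"
  shows "popen p * (\<E> w. card (separating V F {e \<in> F. w e \<le> p} B))
    \<le> 3 * \<theta> * card F + (card B + 1) / \<theta>"
proof -
  let ?q = "popen p"
  \<comment> \<open>\<open>\<sigma>\<close> will be \<open>\<theta>\<close> for the joint
    exploration and \<open>- \<theta>\<close> for the separate ones, whose imbalance enters with the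
    opposite sign.\<close>
  define a b where "a \<sigma> = exp (\<sigma> * (1 - ?q) - \<sigma>\<^sup>2)" and "b \<sigma> = exp (\<sigma> * (- ?q) - \<sigma>\<^sup>2)" for \<sigma> :: real
  let ?T = "\<lambda>w. {e \<in> F. w e \<le> p}"
  let ?X = "\<lambda>\<sigma> R w. explore V (a \<sigma>) (b \<sigma>) F (?T w) R"
  have Xi: "integrable Lam (?X \<sigma> R)" for \<sigma> R by (rule integrable_open_edges[OF fin(1)])
  have XE: "(\<E> w. ?X \<sigma> R w) \<le> 1" if "\<bar>\<sigma>\<bar> \<le> 1" "R \<subseteq> V" for \<sigma> R
    by (rule expectation_explore_le[OF fin(1) s that(2)])
      (use bernoulli_mgf[OF popen_bounds that(1)] in \<open>auto simp: a_def b_def\<close>)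
  have key: "?q * card (separating V F (?T w) B) \<le>
      3 * \<theta> * card F + (1 / \<theta>) * (?X \<theta> B w + (\<Sum>r\<in>B. ?X (- \<theta>) {r} w))" for w
  proof -
    define \<xi> where "\<xi> e = (if e \<in> ?T w then 1 - ?q else - ?q)" for e
    have expX: "exp (\<sigma> * (\<Sum>e\<in>touch V F (?T w) R. \<xi> e) - \<sigma>\<^sup>2 * card (touch V F (?T w) R)) = ?X \<sigma> R w" for \<sigma> R
    proof -
      have ft: "finite (touch V F (?T w) R)" using fin by (auto simp: touch_def)
      have "\<sigma> * (\<Sum>e\<in>touch V F (?T w) R. \<xi> e) - \<sigma>\<^sup>2 * card (touch V F (?T w) R)
          = (\<Sum>e\<in>touch V F (?T w) R. \<sigma> * \<xi> e - \<sigma>\<^sup>2)"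
        by (simp add: sum_subtractf sum_distrib_left)
      hence "exp (\<sigma> * (\<Sum>e\<in>touch V F (?T w) R. \<xi> e) - \<sigma>\<^sup>2 * card (touch V F (?T w) R))
          = (\<Prod>e\<in>touch V F (?T w) R. exp (\<sigma> * \<xi> e - \<sigma>\<^sup>2))" by (simp add: exp_sum[OF ft])
      also have "\<dots> = ?X \<sigma> R w" unfolding explore_def
        by (rule prod.cong) (auto simp: \<xi>_def a_def b_def)
      finally show ?thesis .
    qed
    \<comment> \<open>From \<open>1 + z \<le> exp z\<close> at
      \<open>z = \<theta> * x - \<theta>\<^sup>2 * n\<close>: bounding the imbalance
      \<open>x\<close> costs \<open>\<theta>\<close> per inspected edge and
      \<open>1 / \<theta>\<close> per exponential.\<close>
    have lin: "x \<le> \<theta> * n + (1 / \<theta>) * exp (\<theta> * x - \<theta>\<^sup>2 * n)" for x n :: real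
    proof -
      have "\<theta> * x \<le> \<theta>\<^sup>2 * n + exp (\<theta> * x - \<theta>\<^sup>2 * n)"
        using exp_ge_add_one_self[of "\<theta> * x - \<theta>\<^sup>2 * n"] by linarith
      hence "\<theta> * x / \<theta> \<le> (\<theta>\<^sup>2 * n + exp (\<theta> * x - \<theta>\<^sup>2 * n)) / \<theta>"
        using \<theta> by (intro divide_right_mono) auto
      thus ?thesis using \<theta> by (simp add: add_divide_distrib power2_eq_square)
    qed
    have 1: "(\<Sum>e\<in>touch V F (?T w) B. \<xi> e) \<le> \<theta> * card F + (1 / \<theta>) * ?X \<theta> B w"
    proof -
      have "card (touch V F (?T w) B) \<le> card F" by (rule card_mono[OF fin(1)]) (auto simp: touch_def)
      hence "\<theta> * real (card (touch V F (?T w) B)) \<le> \<theta> * card F" using \<theta> by (intro mult_left_mono) auto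
      thus ?thesis using lin[of "\<Sum>e\<in>touch V F (?T w) B. \<xi> e" "card (touch V F (?T w) B)"]
        unfolding expX by linarith
    qed
    \<comment> \<open>An edge is inspected for at most two clusters, hence
      \<open>2 * \<theta> * card F\<close>; the joint exploration adds one more and gives the 3 of
      the statement. Exponentials being nonnegative, the sum over clusters is at most the sum over
      roots.\<close>
    have 2: "- (\<Sum>C\<in>clusters V (?T w) B. \<Sum>e\<in>{e \<in> F. e \<inter> C \<noteq> {}}. \<xi> e)
       \<le> 2 * \<theta> * card F + (1 / \<theta>) * (\<Sum>r\<in>B. ?X (- \<theta>) {r} w)"
    proof -
      let ?E = "\<lambda>C. exp (\<theta> * (- (\<Sum>e\<in>{e \<in> F. e \<inter> C \<noteq> {}}. \<xi> e)) - \<theta>\<^sup>2 * card {e \<in> F. e \<inter> C \<noteq> {}})"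
      have tc: "{e \<in> F. e \<inter> reach V (?T w) R \<noteq> {}} = touch V F (?T w) R" for R
        by (simp add: touch_def)
      have "- (\<Sum>C\<in>clusters V (?T w) B. \<Sum>e\<in>{e \<in> F. e \<inter> C \<noteq> {}}. \<xi> e)
         \<le> (\<Sum>C\<in>clusters V (?T w) B. \<theta> * card {e \<in> F. e \<inter> C \<noteq> {}} + (1 / \<theta>) * ?E C)"
        unfolding sum_negf[symmetric] by (intro sum_mono lin)
      also have "\<dots> = \<theta> * (\<Sum>C\<in>clusters V (?T w) B. real (card {e \<in> F. e \<inter> C \<noteq> {}}))
          + (1 / \<theta>) * (\<Sum>C\<in>clusters V (?T w) B. ?E C)"
        by (simp add: sum.distrib sum_distrib_left sum_divide_distrib)
      also have "\<dots> \<le> \<theta> * (2 * real (card F)) + (1 / \<theta>) * (\<Sum>r\<in>B. ?E (reach V (?T w) {r}))"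
      proof (intro add_mono mult_left_mono)
        show "(\<Sum>C\<in>clusters V (?T w) B. real (card {e \<in> F. e \<inter> C \<noteq> {}})) \<le> 2 * real (card F)"
          using of_nat_mono[OF open_closed_balance(2)[OF _ s fin order_refl, of "?T w"], where 'a=real] by simp
        show "(\<Sum>C\<in>clusters V (?T w) B. ?E C) \<le> (\<Sum>r\<in>B. ?E (reach V (?T w) {r}))"
          unfolding clusters_def by (rule order_trans[OF sum_image_le]) (use fin in \<open>auto simp: o_def\<close>)
      qed (use \<theta> in auto)
      also have "(\<Sum>r\<in>B. ?E (reach V (?T w) {r})) = (\<Sum>r\<in>B. ?X (- \<theta>) {r} w)"
        unfolding tc expX[symmetric] by simp
      finally show ?thesis by (simp add: mult_ac)
    qed
    have "?q * card (separating V F (?T w) B) \<le>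
      (\<Sum>e\<in>touch V F (?T w) B. \<xi> e) - (\<Sum>C\<in>clusters V (?T w) B. \<Sum>e\<in>{e \<in> F. e \<inter> C \<noteq> {}}. \<xi> e)"
      unfolding \<xi>_def by (rule open_closed_balance(1)[OF _ s fin popen_bounds(1)]) auto
    thus ?thesis using 1 2 by (simp add: algebra_simps)
  qed
  have si: "integrable Lam (\<lambda>w. real (card (separating V F (?T w) B)))"
    by (rule integrable_open_edges[OF fin(1)])
  have "?q * (\<E> w. card (separating V F (?T w) B)) = (\<E> w. ?q * card (separating V F (?T w) B))"
    by simp
  also have "\<dots> \<le> (\<E> w. 3 * \<theta> * card F + (1 / \<theta>) * (?X \<theta> B w + (\<Sum>r\<in>B. ?X (- \<theta>) {r} w)))"
    by (rule integral_mono) (use si Xi key in auto)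
  also have "\<dots> = 3 * \<theta> * card F + (1 / \<theta>) * ((\<E> w. ?X \<theta> B w) + (\<Sum>r\<in>B. \<E> w. ?X (- \<theta>) {r} w))"
    using Xi by simp
  also have "\<dots> \<le> 3 * \<theta> * card F + (1 / \<theta>) * (1 + (\<Sum>r\<in>B. 1))"
    using \<theta> B by (intro add_left_mono mult_left_mono add_mono sum_mono XE) auto
  finally show ?thesis by (simp add: add.commute)
qed

end

section \<open>Two arms in a transitive graph\<close>

locale transitive_graph =
  fixes E :: "'v \<Rightarrow> 'v \<Rightarrow> bool"
  assumes sym: "E u v \<Longrightarrow> E v u"
    and irrefl: "\<not> E v v"
    and conn: "graph_connected E"
    and lf: "locally_finite E"
    and vt: "vertex_transitive E"
begin

section \<open>Graph distance, balls and automorphisms\<close>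

definition nbh :: "'v \<Rightarrow> 'v set" where "nbh u = {v. E u v}"

lemma finite_nbh: "finite (nbh u)"
  using lf by (simp add: nbh_def locally_finite_def)

lemma edge_mem_gedges: "{x, y} \<in> gedges E \<longleftrightarrow> E x y"
  using sym by (auto simp: gedges_def doubleton_eq_iff)

lemma gedgesE:
  assumes "e \<in> gedges E"
  obtains x y where "e = {x, y}" "E x y" "x \<noteq> y"
  using assms irrefl unfolding gedges_def by blast

lemma subgraph_edgeE:
  assumes "is_subgraph E V F" "e \<in> F"
  obtains x y where "e = {x, y}" "E x y" "x \<noteq> y" "x \<in> V" "y \<in> V"
proof -
  have "e \<in> gedges E" "e \<subseteq> V" using assms by (auto simp: is_subgraph_def)
  thus ?thesis using gedgesE[of e] that by (metis insert_subset)
qed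

lemma edge_mem_ball_edges:
  "{x, y} \<in> ball_edges E u r \<longleftrightarrow> E x y \<and> x \<in> ball_vertices E u r \<and> y \<in> ball_vertices E u r"
  using sym by (auto simp: ball_edges_def doubleton_eq_iff)

lemma relpowp_gdist: "(E ^^ gdist E u v) u v"
proof -
  have "E\<^sup>*\<^sup>* u v" using conn by (simp add: graph_connected_def)
  hence "\<exists>n. (E ^^ n) u v" by (rule rtranclp_imp_relpowp)
  thus ?thesis unfolding gdist_def by (rule LeastI_ex)
qed

lemma gdist_le: "(E ^^ n) u v \<Longrightarrow> gdist E u v \<le> n"
  unfolding gdist_def by (rule Least_le)

lemma gdist_self [simp]: "gdist E u u = 0"
  using gdist_le[of 0 u u] by simp

lemma gdist_triangle: "gdist E x z \<le> gdist E x y + gdist E y z"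
  by (intro gdist_le relpowp_trans[OF relpowp_gdist relpowp_gdist])

lemma gdist_commute: "gdist E x y = gdist E y x"
proof -
  have "(E ^^ n) b a" if "(E ^^ n) a b" for n a b
    using that
  proof (induction n arbitrary: b)
    case (Suc n)
    then obtain c where "(E ^^ n) a c" "E c b" by auto
    thus ?case using Suc.IH sym relpowp_Suc_I2[of E b c n a] by blast
  qed simp
  thus ?thesis by (intro antisym gdist_le) (auto intro: relpowp_gdist)
qed

lemma gdist_edge: "E x y \<Longrightarrow> gdist E x y \<le> 1"
  by (rule gdist_le) auto

lemma gdist_step: "E x y \<Longrightarrow> gdist E x u \<le> Suc (gdist E y u)"
  using gdist_triangle[of x u y] gdist_edge[of x y] by simp

lemma mem_ball: "x \<in> ball_vertices E u (real r) \<longleftrightarrow> gdist E x u \<le> r"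
  by (simp add: ball_vertices_def)

lemma finite_ball_nat: "finite (ball_vertices E u (real r))"
proof (induction r)
  case 0
  have "x = u" if "gdist E x u = 0" for x using relpowp_gdist[of x u] that by simp
  hence "ball_vertices E u (real 0) \<subseteq> {u}" by (auto simp: ball_vertices_def)
  thus ?case by (rule finite_subset) simp
next
  case (Suc r)
  have "x \<in> ball_vertices E u (real r) \<union> (\<Union>y\<in>ball_vertices E u (real r). nbh y)"
    if x: "gdist E x u \<le> Suc r" for x
  proof (cases "gdist E x u \<le> r")
    case False
    hence "(E ^^ Suc r) x u" using relpowp_gdist[of x u] x by (simp add: le_Suc_eq)
    then obtain y where y: "E x y" "(E ^^ r) y u" using relpowp_Suc_D2 by meson
    hence "gdist E y u \<le> r" "x \<in> nbh y" using gdist_le sym by (auto simp: nbh_def)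
    thus ?thesis by (auto simp: mem_ball)
  qed (simp add: mem_ball)
  hence "ball_vertices E u (real (Suc r)) \<subseteq> ball_vertices E u (real r) \<union> (\<Union>y\<in>ball_vertices E u (real r). nbh y)"
    unfolding mem_ball[symmetric] by blast
  thus ?case using Suc finite_nbh by (meson finite_UN finite_UnI finite_subset)
qed

lemma ball_edges_subset: "ball_edges E u r \<subseteq> Pow (ball_vertices E u r)"
  by (auto simp: ball_edges_def)

lemma finite_ball_edges: "finite (ball_edges E u (real r))"
  by (rule finite_subset[OF ball_edges_subset]) (simp add: finite_ball_nat)

lemma automorphism_relpowp:
  assumes "graph_automorphism E f"
  shows "(E ^^ n) (f x) (f y) \<longleftrightarrow> (E ^^ n) x y"
proof (induction n arbitrary: y)
  case 0
  thus ?case using assms by (auto simp: graph_automorphism_def bij_def inj_eq)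
next
  case (Suc n)
  have "surj f" using assms by (auto simp: graph_automorphism_def bij_def)
  hence "(E ^^ Suc n) (f x) (f y) \<longleftrightarrow> (\<exists>z. (E ^^ n) (f x) (f z) \<and> E (f z) (f y))"
    by (auto simp: relcompp_apply) (metis surjD)
  also have "\<dots> \<longleftrightarrow> (E ^^ Suc n) x y"
    using assms Suc.IH by (auto simp: graph_automorphism_def relcompp_apply)
  finally show ?case .
qed

lemma automorphism_gdist: "graph_automorphism E f \<Longrightarrow> gdist E (f x) (f y) = gdist E x y"
  by (simp add: gdist_def automorphism_relpowp)

lemma automorphism_exists:
  obtains f where "graph_automorphism E f" "f u = v"
  using vt unfolding vertex_transitive_def by blast

lemma automorphism_nbh:
  assumes "graph_automorphism E f"
  shows "nbh (f u) = f ` nbh u"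
proof -
  have "surj f" using assms by (auto simp: graph_automorphism_def bij_def)
  thus ?thesis using assms by (auto simp: nbh_def graph_automorphism_def image_iff) (metis surjD)
qed

lemma automorphism_ball:
  assumes "graph_automorphism E f"
  shows "ball_vertices E (f u) r = f ` ball_vertices E u r"
proof -
  have "surj f" using assms by (auto simp: graph_automorphism_def bij_def)
  thus ?thesis by (auto simp: ball_vertices_def image_iff automorphism_gdist[OF assms])
      (metis surjD automorphism_gdist[OF assms])
qed

lemma automorphism_ball_edges:
  assumes "graph_automorphism E f"
  shows "ball_edges E (f u) r = (`) f ` ball_edges E u r"
proof -
  have "ball_edges E (f u) r = {{f x, f y} | x y. E (f x) (f y) \<and> x \<in> ball_vertices E u r \<and> y \<in> ball_vertices E u r}"
    unfolding ball_edges_def automorphism_ball[OF assms] by blast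
  also have "\<dots> = {f ` {x, y} | x y. E x y \<and> x \<in> ball_vertices E u r \<and> y \<in> ball_vertices E u r}"
    using assms by (simp add: graph_automorphism_def)
  also have "\<dots> = (`) f ` ball_edges E u r" unfolding ball_edges_def by blast
  finally show ?thesis .
qed

text \<open>Read off at an arbitrary vertex; by transitivity it is, like \<open>vol\<close> below,
  the value at every vertex.\<close>

definition deg :: nat where "deg = card (nbh (SOME u. True))"

lemma card_nbh: "card (nbh u) = deg"
proof -
  obtain f where f: "graph_automorphism E f" "f u = (SOME u. True)" using automorphism_exists by metis
  have "nbh (SOME u. True) = f ` nbh u" using automorphism_nbh[OF f(1), of u] f(2) by simp
  moreover have "inj f" using f by (simp add: graph_automorphism_def bij_def)
  ultimately show ?thesis unfolding deg_def by (simp add: card_image inj_on_subset)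
qed

definition vol :: "nat \<Rightarrow> nat" where "vol r = card (ball_vertices E (SOME u. True) (real r))"

lemma card_ball: "card (ball_vertices E u (real r)) = vol r"
proof -
  obtain f where f: "graph_automorphism E f" "f u = (SOME u. True)" using automorphism_exists by metis
  have "ball_vertices E (SOME u. True) (real r) = f ` ball_vertices E u (real r)"
    using automorphism_ball[OF f(1), of u] f(2) by simp
  moreover have "inj f" using f by (simp add: graph_automorphism_def bij_def)
  ultimately show ?thesis unfolding vol_def by (simp add: card_image inj_on_subset)
qed

abbreviation ballv :: "'v \<Rightarrow> nat \<Rightarrow> 'v set" where "ballv u r \<equiv> ball_vertices E u (real r)"
abbreviation balle :: "'v \<Rightarrow> nat \<Rightarrow> 'v set set" where "balle u r \<equiv> ball_edges E u (real r)"

section \<open>Two-arm events and boundary vertices\<close>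

definition ball_conn :: "real \<Rightarrow> nat \<Rightarrow> 'v \<Rightarrow> ('v set \<Rightarrow> real) \<Rightarrow> 'v \<Rightarrow> 'v \<Rightarrow> bool" where
  "ball_conn p r u w = (adj (ballv u r) {e \<in> balle u r. w e \<le> p})\<^sup>*\<^sup>*"

text \<open>The two-arm event of percolation, confined to the ball around one end so that it
  involves finitely many weights and can be moved by automorphisms. The edge is asked to be closed
  because that is what makes it a separating edge in a finite subgraph.\<close>

definition arms :: "real \<Rightarrow> nat \<Rightarrow> 'v \<Rightarrow> 'v \<Rightarrow> ('v set \<Rightarrow> real) \<Rightarrow> bool" where
  "arms p r u v w \<longleftrightarrow> p < w {u, v} \<and> \<not> ball_conn p r u w u v \<and>
    (\<exists>z. r \<le> gdist E z u \<and> ball_conn p r u w u z) \<and> (\<exists>z. r \<le> gdist E z u \<and> ball_conn p r u w v z)"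

lemma automorphism_ball_conn:
  assumes f: "graph_automorphism E f"
  shows "ball_conn p r (f u) w (f x) (f y) \<longleftrightarrow> ball_conn p r u (\<lambda>e. w (f ` e)) x y"
proof -
  have inj: "inj f" and surj: "surj f" using f by (auto simp: graph_automorphism_def bij_def)
  have equiv: "adj (ballv (f u) r) {e \<in> balle (f u) r. w e \<le> p} (f a) (f b)
      \<longleftrightarrow> adj (ballv u r) {e \<in> balle u r. w (f ` e) \<le> p} a b" for a b
  proof -
    have "inj ((`) f)" using inj by (simp add: inj_on_def inj_image_eq_iff)
    hence "{f a, f b} \<in> (`) f ` balle u r \<longleftrightarrow> {a, b} \<in> balle u r"
      using inj_image_mem_iff[of "(`) f" "{a, b}" "balle u r"] by simp
    thus ?thesis
      by (auto simp: adj_def automorphism_ball[OF f] automorphism_ball_edges[OF f] inj_image_mem_iff[OF inj] inj_eq[OF inj])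
  qed
  show ?thesis unfolding ball_conn_def
  proof
    assume "(adj (ballv (f u) r) {e \<in> balle (f u) r. w e \<le> p})\<^sup>*\<^sup>* (f x) (f y)"
    hence "(adj (ballv u r) {e \<in> balle u r. w (f ` e) \<le> p})\<^sup>*\<^sup>* x (inv f (f y))"
    proof (induction rule: rtranclp_induct)
      case base
      show ?case by (simp add: inv_f_f[OF inj])
    next
      case (step a b)
      have "adj (ballv u r) {e \<in> balle u r. w (f ` e) \<le> p} (inv f a) (inv f b)"
        using step(2) equiv[of "inv f a" "inv f b"] by (simp add: surj_f_inv_f[OF surj])
      thus ?case using step.IH by (rule rtranclp.rtrancl_into_rtrancl[rotated])
    qed
    thus "(adj (ballv u r) {e \<in> balle u r. w (f ` e) \<le> p})\<^sup>*\<^sup>* x y" by (simp add: inv_f_f[OF inj])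
  next
    assume "(adj (ballv u r) {e \<in> balle u r. w (f ` e) \<le> p})\<^sup>*\<^sup>* x y"
    thus "(adj (ballv (f u) r) {e \<in> balle (f u) r. w e \<le> p})\<^sup>*\<^sup>* (f x) (f y)"
      by (induction rule: rtranclp_induct) (auto simp: equiv[symmetric] intro: rtranclp.rtrancl_into_rtrancl)
  qed
qed

lemma automorphism_arms:
  assumes f: "graph_automorphism E f"
  shows "arms p r (f u) (f v) w \<longleftrightarrow> arms p r u v (\<lambda>e. w (f ` e))"
proof -
  have surj: "surj f" using f by (auto simp: graph_automorphism_def bij_def)
  have ex: "(\<exists>z. Q z) \<longleftrightarrow> (\<exists>z. Q (f z))" for Q by (metis surj surjD)
  show ?thesis unfolding arms_def
    by (subst (1 2) ex) (simp add: automorphism_ball_conn[OF f] automorphism_gdist[OF f])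
qed

text \<open>Follow the path while it stays in the ball. If it leaves, the last vertex before has
  distance at least \<open>r\<close>, because one edge changes the distance by at most 1.\<close>

lemma exit_ball:
  assumes "(adj V H)\<^sup>*\<^sup>* a y" "a \<in> ballv u r" "H \<subseteq> gedges E" "\<And>e. e \<in> H \<Longrightarrow> w e \<le> p"
  shows "ball_conn p r u w a y \<or> (\<exists>z. r \<le> gdist E z u \<and> ball_conn p r u w a z)"
  using assms(1)
proof (induction rule: rtranclp_induct)
  case base
  show ?case by (simp add: ball_conn_def)
next
  case (step y y')
  have "{y, y'} \<in> gedges E" using step(2) assms(3) by (auto simp: adj_def)
  hence E: "E y y'" by (simp add: edge_mem_gedges)
  from step.IH show ?case
  proof
    assume c: "ball_conn p r u w a y"
    hence y: "y \<in> ballv u r" using adj_rtranclp_in assms(2) unfolding ball_conn_def by metis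
    show ?thesis
    proof (cases "y' \<in> ballv u r")
      case True
      have "{y, y'} \<in> balle u r" using y True E by (simp add: edge_mem_ball_edges)
      hence "adj (ballv u r) {e \<in> balle u r. w e \<le> p} y y'"
        using y True step(2) assms(4) by (auto simp: adj_def)
      thus ?thesis using c unfolding ball_conn_def by (meson rtranclp.rtrancl_into_rtrancl)
    next
      case False
      hence "r < gdist E y' u" by (simp add: mem_ball)
      hence "r \<le> gdist E y u" using gdist_step[of y' y u] sym[OF E] by simp
      thus ?thesis using c by blast
    qed
  qed blast
qed

text \<open>Off this set a vertex has all its neighbours in \<open>V\<close> and all its edges in
  \<open>F\<close>. Phrased through the ball of radius 1, it is the set that the thinness hypothesis
  bounds.\<close>

definition bdry :: "'v set \<Rightarrow> 'v set set \<Rightarrow> 'v set" where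
  "bdry V F = {x \<in> V. \<not> ball_within E x 1 V F}"

lemma not_bdry_edge:
  assumes "x \<in> V" "x \<notin> bdry V F" "E x y"
  shows "y \<in> V" "{x, y} \<in> F"
proof -
  have b: "ball_within E x 1 V F" using assms by (simp add: bdry_def)
  have xy: "x \<in> ball_vertices E x 1" "y \<in> ball_vertices E x 1"
    using gdist_edge[OF sym[OF assms(3)]] by (simp_all add: ball_vertices_def)
  thus "y \<in> V" using b by (auto simp: ball_within_def)
  have "{x, y} \<in> ball_edges E x 1" using xy assms(3) by (auto simp: ball_edges_def)
  thus "{x, y} \<in> F" using b by (auto simp: ball_within_def)
qed

text \<open>A path in the ball can be copied into the subgraph edge by edge until it stands at a
  boundary vertex, since at other vertices no edge is missing.\<close>

lemma reach_bdry:
  assumes "ball_conn p r u w a y" "a \<in> V"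
  shows "(adj V {e \<in> F. w e \<le> p})\<^sup>*\<^sup>* a y \<or> (\<exists>b\<in>bdry V F. (adj V {e \<in> F. w e \<le> p})\<^sup>*\<^sup>* a b)"
  using assms(1) unfolding ball_conn_def
proof (induction rule: rtranclp_induct)
  case (step y y')
  from step.IH show ?case
  proof
    assume c: "(adj V {e \<in> F. w e \<le> p})\<^sup>*\<^sup>* a y"
    hence y: "y \<in> V" using adj_rtranclp_in assms(2) by metis
    show ?thesis
    proof (cases "y \<in> bdry V F")
      case False
      have "E y y'" using step(2) by (auto simp: adj_def edge_mem_ball_edges)
      from not_bdry_edge[OF y False this] have "adj V {e \<in> F. w e \<le> p} y y'"
        using y step(2) by (auto simp: adj_def)
      thus ?thesis using c by (meson rtranclp.rtrancl_into_rtrancl)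
    qed (use c in blast)
  qed blast
qed simp

text \<open>All of \<open>V\<close> is closer to \<open>u\<close> than \<open>r\<close>, so an arm
  has to leave \<open>V\<close>, and its starting point is joined to the boundary within
  \<open>F\<close>. In turn \<open>F\<close> lies in the ball, so ends not joined in the ball are
  not joined in \<open>F\<close>.\<close>

lemma arms_separating:
  assumes sub: "is_subgraph E V F" and far: "\<And>x. x \<in> V \<Longrightarrow> gdist E x u < r"
    and uv: "u \<in> V" "v \<in> V" "{u, v} \<in> F" and a: "arms p r u v w"
  shows "{u, v} \<in> separating V F {e \<in> F. w e \<le> p} (bdry V F)"
proof -
  let ?T = "{e \<in> F. w e \<le> p}"
  have VB: "V \<subseteq> ballv u r" using far by (auto simp: mem_ball less_imp_le)
  have FB: "F \<subseteq> balle u r"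
  proof
    fix e assume e: "e \<in> F"
    then obtain x y where "e = {x, y}" "E x y" "x \<in> V" "y \<in> V" using subgraph_edgeE[OF sub] by metis
    thus "e \<in> balle u r" using VB by (auto simp: edge_mem_ball_edges)
  qed
  have "\<not> (adj V ?T)\<^sup>*\<^sup>* u v"
  proof
    assume "(adj V ?T)\<^sup>*\<^sup>* u v"
    hence "ball_conn p r u w u v" unfolding ball_conn_def
      by (rule adj_rtranclp_mono) (use VB FB in auto)
    thus False using a by (simp add: arms_def)
  qed
  moreover have "x \<in> reach V ?T (bdry V F)" if x: "x \<in> V" "\<exists>z. r \<le> gdist E z u \<and> ball_conn p r u w x z" for x
  proof -
    obtain z where z: "r \<le> gdist E z u" "ball_conn p r u w x z" using x by blast
    have "z \<notin> V" using far[of z] z by auto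
    hence "\<not> (adj V ?T)\<^sup>*\<^sup>* x z" using adj_rtranclp_in x(1) by metis
    then obtain b where "b \<in> bdry V F" "(adj V ?T)\<^sup>*\<^sup>* x b" using reach_bdry[OF z(2) x(1)] by blast
    thus ?thesis using adj_rtranclp_sym by (force simp: reach_def)
  qed
  ultimately show ?thesis using a uv by (auto simp: separating_def arms_def)
qed

lemma simple_subgraph:
  assumes "is_subgraph E V F"
  shows "simple_edges V F"
  unfolding simple_edges_def by (metis subgraph_edgeE[OF assms])

lemma finite_subgraph_edges: "is_subgraph E V F \<Longrightarrow> finite V \<Longrightarrow> finite F"
  by (rule finite_subset[of F "Pow V"]) (auto simp: is_subgraph_def)

lemma card_incident_edges:
  assumes "finite S" "A \<subseteq> (\<Union>u\<in>S. (\<lambda>v. {u, v}) ` nbh u)"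
  shows "card A \<le> deg * card S"
proof -
  have "card A \<le> card (\<Union>u\<in>S. (\<lambda>v. {u, v}) ` nbh u)"
    by (rule card_mono[OF _ assms(2)]) (use assms(1) finite_nbh in auto)
  also have "\<dots> \<le> (\<Sum>u\<in>S. card ((\<lambda>v. {u, v}) ` nbh u))" by (rule card_UN_le[OF assms(1)])
  also have "\<dots> \<le> (\<Sum>u\<in>S. deg)"
    by (intro sum_mono order_trans[OF card_image_le[OF finite_nbh]]) (simp add: card_nbh)
  finally show ?thesis by (simp add: mult.commute)
qed

lemma card_subgraph_edges:
  assumes "is_subgraph E V F" "finite V"
  shows "card F \<le> deg * card V"
proof (rule card_incident_edges[OF assms(2)], rule subsetI)
  fix e assume "e \<in> F"
  then obtain x y where "e = {x, y}" "E x y" "x \<in> V" using subgraph_edgeE[OF assms(1)] by metis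
  thus "e \<in> (\<Union>u\<in>V. (\<lambda>v. {u, v}) ` nbh u)" by (auto simp: nbh_def)
qed

end

locale iid_transitive_graph = transitive_graph E + iid \<mu>
  for E :: "'v \<Rightarrow> 'v \<Rightarrow> bool" and \<mu> :: "real measure"
begin

section \<open>Two-arm probabilities, averaged over a finite subgraph\<close>

lemma measurable_ball_conn [measurable]: "Measurable.pred Lam (\<lambda>w. ball_conn p r u w a b)"
  unfolding ball_conn_def
  by (rule measurable_open_edges'[OF finite_ball_edges, of "\<lambda>T. (adj (ballv u r) T)\<^sup>*\<^sup>* a b"])

lemma measurable_arms [measurable]: "Measurable.pred Lam (arms p r u v)"
proof -
  have [measurable]: "Measurable.pred Lam (\<lambda>w. \<exists>z. r \<le> gdist E z u \<and> ball_conn p r u w a z)" for a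
    unfolding ball_conn_def
    by (rule measurable_open_edges'[OF finite_ball_edges,
        of "\<lambda>T. \<exists>z. r \<le> gdist E z u \<and> (adj (ballv u r) T)\<^sup>*\<^sup>* a z"])
  show ?thesis unfolding arms_def by measurable
qed

lemma integrable_arms: "integrable Lam (\<lambda>w. of_bool (arms p r u v w) :: real)"
  by (rule Lam.integrable_const_bound[of _ 1]) auto

text \<open>Summed over the neighbours, because transitivity acts on vertices and may fail to
  identify the edges at a vertex.\<close>

definition arm_prob :: "real \<Rightarrow> nat \<Rightarrow> 'v \<Rightarrow> real" where
  "arm_prob p r u = (\<Sum>v\<in>nbh u. \<E> w. of_bool (arms p r u v w))"

text \<open>An automorphism acts injectively on edges and so preserves the law of the weights, while
  carrying the arms at \<open>u\<close> to those at \<open>f u\<close>.\<close>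

lemma arm_prob_transitive: "arm_prob p r u = arm_prob p r v"
proof -
  obtain f where f: "graph_automorphism E f" "f u = v" using automorphism_exists by metis
  have inj: "inj f" using f by (simp add: graph_automorphism_def bij_def)
  have "arm_prob p r v = (\<Sum>x\<in>nbh u. \<E> w. of_bool (arms p r (f u) (f x) w))"
    unfolding arm_prob_def f(2)[symmetric] automorphism_nbh[OF f(1)]
    by (subst sum.reindex) (auto intro: inj_on_subset[OF inj])
  also have "\<dots> = arm_prob p r u"
    unfolding arm_prob_def
  proof (rule sum.cong[OF refl])
    fix x
    have "inj ((`) f)" using inj by (simp add: inj_on_def inj_image_eq_iff)
    thus "(\<E> w. of_bool (arms p r (f u) (f x) w)) = (\<E> w. (of_bool (arms p r u x w) :: real))"
      unfolding automorphism_arms[OF f(1)]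
      using integral_reindex[of "(`) f" "\<lambda>w. of_bool (arms p r u x w) :: real"] by simp
  qed
  finally show ?thesis by simp
qed

lemma arm_prob_le_deg: "arm_prob p r u \<le> deg"
proof -
  have "arm_prob p r u \<le> (\<Sum>v\<in>nbh u. \<integral>w. 1 \<partial>(Lam :: ('v set \<Rightarrow> real) measure))"
    unfolding arm_prob_def by (intro sum_mono integral_mono integrable_arms) auto
  thus ?thesis by (simp add: card_nbh)
qed

lemma pair_count:
  assumes "finite V" "finite S"
  shows "(\<Sum>u\<in>V. card {v \<in> nbh u. {u, v} \<in> S}) \<le> (\<Sum>e\<in>S. card {u \<in> V. u \<in> e})"
proof -
  have "(\<Sum>u\<in>V. card {v \<in> nbh u. {u, v} \<in> S}) \<le> (\<Sum>u\<in>V. card {e \<in> S. u \<in> e})"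
  proof (rule sum_mono)
    fix u
    have "inj_on (\<lambda>v. {u, v}) {v \<in> nbh u. {u, v} \<in> S}" by (auto simp: inj_on_def doubleton_eq_iff)
    thus "card {v \<in> nbh u. {u, v} \<in> S} \<le> card {e \<in> S. u \<in> e}"
      by (rule card_inj_on_le) (use assms in auto)
  qed
  also have "\<dots> = (\<Sum>u\<in>V. \<Sum>e\<in>{e \<in> S. u \<in> e}. 1)" by simp
  also have "\<dots> = (\<Sum>e\<in>S. \<Sum>u\<in>{u \<in> V. u \<in> e}. 1)" by (rule sum.swap_restrict[OF assms])
  finally show ?thesis by simp
qed

text \<open>By transitivity the left side is a sum over \<open>V\<close>. Vertices off the boundary
  are charged to separating edges, each at most twice, which doubles the 3 of
  \<open>expectation_separating_le\<close>; a boundary vertex is charged its degree.\<close>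

lemma arm_prob_finite_bound:
  fixes \<theta> :: real
  assumes sub: "is_subgraph E V F" and fin: "finite V" and far: "\<And>x u. x \<in> V \<Longrightarrow> u \<in> V \<Longrightarrow> gdist E x u < r"
    and \<theta>: "0 < \<theta>" "\<theta> \<le> 1"
  shows "popen p * (card V * arm_prob p r v) \<le>
    6 * \<theta> * deg * card V + 2 * (card (bdry V F) + 1) / \<theta> + deg * card (bdry V F)"
proof -
  let ?B = "bdry V F" and ?sep = "\<lambda>w. separating V F {e \<in> F. w e \<le> p} (bdry V F)"
  have finF: "finite F" by (rule finite_subgraph_edges[OF sub fin])
  have BV: "?B \<subseteq> V" by (auto simp: bdry_def)
  have finB: "finite ?B" using BV fin finite_subset by metis
  have simp: "simple_edges V F" by (rule simple_subgraph[OF sub])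
  have sepF: "?sep w \<subseteq> F" for w by (auto simp: separating_def)
  have pw: "(\<Sum>u\<in>V - ?B. \<Sum>x\<in>nbh u. of_bool (arms p r u x w)) \<le> 2 * real (card (?sep w))" for w
  proof -
    have "(\<Sum>u\<in>V - ?B. \<Sum>x\<in>nbh u. of_bool (arms p r u x w)) \<le> (\<Sum>u\<in>V - ?B. real (card {x \<in> nbh u. {u, x} \<in> ?sep w}))"
    proof (rule sum_mono)
      fix u assume u: "u \<in> V - ?B"
      have "(\<Sum>x\<in>nbh u. of_bool (arms p r u x w)) \<le> (\<Sum>x\<in>nbh u. of_bool ({u, x} \<in> ?sep w) :: real)"
      proof (rule sum_mono)
        fix x assume x: "x \<in> nbh u"
        have "{u, x} \<in> ?sep w" if "arms p r u x w"
          by (rule arms_separating[OF sub _ _ _ _ that]) (use far u x not_bdry_edge[of u V F x] in \<open>auto simp: nbh_def\<close>)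
        thus "of_bool (arms p r u x w) \<le> (of_bool ({u, x} \<in> ?sep w) :: real)" by auto
      qed
      thus "(\<Sum>x\<in>nbh u. of_bool (arms p r u x w)) \<le> real (card {x \<in> nbh u. {u, x} \<in> ?sep w})"
        using finite_nbh by (simp add: sum_of_bool_eq Int_def)
    qed
    also have "\<dots> \<le> (\<Sum>u\<in>V. real (card {x \<in> nbh u. {u, x} \<in> ?sep w}))"
      by (rule sum_mono2) (use fin in auto)
    also have "\<dots> \<le> real (\<Sum>e\<in>?sep w. card {u \<in> V. u \<in> e})"
      using pair_count[OF fin finite_subset[OF sepF finF], of w] by (metis (mono_tags) of_nat_mono of_nat_sum)
    also have "(\<Sum>e\<in>?sep w. card {u \<in> V. u \<in> e}) \<le> (\<Sum>e\<in>?sep w. 2)"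
    proof (rule sum_mono)
      fix e assume "e \<in> ?sep w"
      hence "e \<in> F" using sepF by blast
      then obtain a b where "e = {a, b}" using simp by (meson simple_edgesE)
      hence "{u \<in> V. u \<in> e} \<subseteq> {a, b}" by auto
      from card_mono[OF _ this] show "card {u \<in> V. u \<in> e} \<le> 2" by (simp add: card_insert_if split: if_splits)
    qed
    finally show ?thesis by simp
  qed
  have si: "integrable Lam (\<lambda>w. real (card (?sep w)))" by (rule integrable_open_edges[OF finF])
  have sumV: "card V * arm_prob p r v = (\<Sum>u\<in>V - ?B. arm_prob p r u) + (\<Sum>u\<in>?B. arm_prob p r u)"
  proof -
    have "card V * arm_prob p r v = (\<Sum>u\<in>V. arm_prob p r v)" by simp
    also have "\<dots> = (\<Sum>u\<in>V. arm_prob p r u)" by (rule sum.cong[OF refl arm_prob_transitive])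
    also have "\<dots> = (\<Sum>u\<in>V - ?B. arm_prob p r u) + (\<Sum>u\<in>?B. arm_prob p r u)"
      by (rule sum.subset_diff[OF BV fin])
    finally show ?thesis .
  qed
  have "(\<Sum>u\<in>V - ?B. arm_prob p r u) = (\<E> w. (\<Sum>u\<in>V - ?B. \<Sum>x\<in>nbh u. of_bool (arms p r u x w)))"
    unfolding arm_prob_def using integrable_arms by (simp add: Bochner_Integration.integral_sum)
  also have "\<dots> \<le> (\<E> w. 2 * real (card (?sep w)))"
    by (rule integral_mono) (use si integrable_arms pw in auto)
  also have "\<dots> = 2 * (\<E> w. real (card (?sep w)))" by simp
  finally have 1: "popen p * (\<Sum>u\<in>V - ?B. arm_prob p r u) \<le> 2 * (popen p * (\<E> w. real (card (?sep w))))"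
    using popen_bounds(1)[of p] mult_left_mono by fastforce
  have 2: "popen p * (\<E> w. real (card (?sep w))) \<le> 3 * \<theta> * card F + (card ?B + 1) / \<theta>"
    by (rule expectation_separating_le[OF finF finB simp BV \<theta>])
  have "real (card F) \<le> deg * card V" using of_nat_mono[OF card_subgraph_edges[OF sub fin], where 'a=real] by simp
  hence 3: "3 * \<theta> * card F \<le> 3 * \<theta> * (deg * card V)" using \<theta> by (intro mult_left_mono) auto
  have "(\<Sum>u\<in>?B. arm_prob p r u) \<le> (\<Sum>u\<in>?B. real deg)" by (rule sum_mono[OF arm_prob_le_deg])
  hence "popen p * (\<Sum>u\<in>?B. arm_prob p r u) \<le> 1 * (real deg * real (card ?B))"
    using popen_bounds[of p] by (intro mult_mono) (auto simp: mult.commute arm_prob_def intro!: sum_nonneg integral_nonneg)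
  hence "popen p * (card V * arm_prob p r v) \<le> 2 * (3 * \<theta> * (deg * card V) + (card ?B + 1) / \<theta>) + deg * card ?B"
    using 1 2 3 unfolding sumV distrib_left of_nat_mult mult_1 by linarith
  thus ?thesis by (simp add: algebra_simps)
qed

end

section \<open>Local approximation of edge increments\<close>

text \<open>Layer-cake formula on a grid: \<open>t\<close> is \<open>\<eta>\<close> times the number
  of levels below it, up to one mesh and the part above the top.\<close>

lemma grid_approximation:
  fixes t \<eta> :: real
  assumes "0 \<le> t" "0 < \<eta>"
  shows "\<bar>t - \<eta> * (\<Sum>j<J. of_bool (real j * \<eta> < t))\<bar> \<le> \<eta> + max 0 (t - real J * \<eta>)"
proof -
  let ?S = "\<lambda>J. \<eta> * (\<Sum>j<J. of_bool (real j * \<eta> < t))"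
  have "(real J * \<eta> < t \<longrightarrow> ?S J = real J * \<eta>) \<and> (t \<le> real J * \<eta> \<longrightarrow> t \<le> ?S J \<and> ?S J \<le> t + \<eta>)"
  proof (induction J)
    case (Suc J)
    have *: "real (Suc J) * \<eta> = real J * \<eta> + \<eta>" by (simp add: algebra_simps)
    show ?case
    proof (cases "real J * \<eta> < t")
      case True
      hence "?S (Suc J) = real (Suc J) * \<eta>" using Suc by (simp add: algebra_simps)
      thus ?thesis using True * by linarith
    next
      case False
      hence "?S (Suc J) = ?S J" by simp
      thus ?thesis using False Suc * assms by linarith
    qed
  qed (use assms in auto)
  hence "(real J * \<eta> < t \<and> ?S J = real J * \<eta>) \<or> (t \<le> ?S J \<and> ?S J \<le> t + \<eta>)" by linarith
  thus ?thesis using assms by linarith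
qed

context iid_transitive_graph begin

text \<open>At such a level a bound on \<open>popen p\<close> times the probability says nothing;
  but almost surely no edge is open, and an arm of positive length needs one.\<close>

lemma arm_prob_zero:
  assumes "popen p = 0" "1 \<le> r"
  shows "arm_prob p r u = 0"
proof -
  have "mu.prob {..p} = 0" using assms(1) by (simp add: popen_def)
  hence "AE x in \<mu>. x \<notin> {..p}" by (subst (asm) mu.prob_eq_0) auto
  hence "AE w in Lam. w e \<notin> {..p}" for e :: "'v set" by (rule AE_coord)
  hence AE: "AE w in Lam. \<forall>e\<in>balle u r. w e \<notin> {..p}"
    by (intro AE_finite_allI finite_ball_edges)
  have "(\<E> w. of_bool (arms p r u v w)) = (0 :: real)" for v
  proof (rule integral_eq_zero_AE)
    show "AE w in Lam. of_bool (arms p r u v w) = (0 :: real)"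
      using AE
    proof eventually_elim
      case (elim w)
      have "\<not> arms p r u v w"
      proof
        assume "arms p r u v w"
        then obtain z where z: "r \<le> gdist E z u" "ball_conn p r u w u z" by (auto simp: arms_def)
        have "z \<noteq> u" using z(1) assms(2) by auto
        then obtain y where "adj (ballv u r) {e \<in> balle u r. w e \<le> p} u y"
          using z(2) unfolding ball_conn_def by (metis converse_rtranclpE)
        thus False using elim by (auto simp: adj_def)
      qed
      thus ?case by simp
    qed
  qed
  thus ?thesis by (simp add: arm_prob_def)
qed

text \<open>One subgraph is enough: \<open>n\<close> is fixed with a relatively small boundary, and
  \<open>r0\<close> is taken beyond the diameter of that subgraph. Thus \<open>r0\<close> depends on
  \<open>p\<close>, which is why only finitely many levels can be treated together.\<close>

lemma arm_prob_small:
  assumes sub: "\<And>n. is_subgraph E (Vn n) (En n)" and fin: "\<And>n. finite (Vn n)"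
    and grow: "filterlim (\<lambda>n. card (Vn n)) at_top sequentially"
    and bd: "(\<lambda>n. real (card (bdry (Vn n) (En n)))) \<in> o(\<lambda>n. real (card (Vn n)))"
    and \<epsilon>: "0 < \<epsilon>"
  shows "\<exists>r0. \<forall>r\<ge>r0. \<forall>u. arm_prob p r u \<le> \<epsilon>"
proof (cases "popen p = 0")
  case True
  thus ?thesis using \<epsilon> arm_prob_zero by (intro exI[of _ 1]) auto
next
  case False
  define q where "q = popen p"
  have q: "0 < q" using False popen_bounds(1)[of p] by (simp add: q_def)
  \<comment> \<open>Makes \<open>6 * \<theta> * deg\<close> at most a third of
    \<open>\<epsilon> * q\<close>; the boundary terms get the other two thirds through
    \<open>\<gamma>\<close>.\<close>
  define \<theta> where "\<theta> = min 1 (\<epsilon> * q / (18 * (real deg + 1)))"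
  have \<theta>: "0 < \<theta>" "\<theta> \<le> 1" using \<epsilon> q by (auto simp: \<theta>_def)
  have \<theta>D: "6 * \<theta> * deg \<le> \<epsilon> * q / 3"
  proof -
    have "\<theta> \<le> \<epsilon> * q / (18 * (real deg + 1))" by (simp add: \<theta>_def)
    hence "\<theta> * (18 * (real deg + 1)) \<le> \<epsilon> * q" by (simp add: pos_le_divide_eq)
    thus ?thesis using \<theta> by (simp add: algebra_simps)
  qed
  define \<gamma> where "\<gamma> = (2 * \<epsilon> * q / 3) / (4 / \<theta> + deg)"
  have d: "0 < 4 / \<theta> + deg" using \<theta> by (simp add: add_pos_nonneg)
  have \<gamma>: "0 < \<gamma>" unfolding \<gamma>_def using \<epsilon> q d by simp
  have "eventually (\<lambda>n. real (card (bdry (Vn n) (En n))) \<le> \<gamma> * real (card (Vn n))) sequentially"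
    using landau_o.smallD[OF bd \<gamma>] by simp
  moreover have "eventually (\<lambda>n. nat \<lceil>1 / \<gamma>\<rceil> + 1 \<le> card (Vn n)) sequentially"
    using grow by (simp add: filterlim_at_top)
  ultimately have "eventually (\<lambda>n. real (card (bdry (Vn n) (En n))) \<le> \<gamma> * real (card (Vn n)) \<and> nat \<lceil>1 / \<gamma>\<rceil> + 1 \<le> card (Vn n)) sequentially"
    by (rule eventually_conj)
  then obtain n where n: "real (card (bdry (Vn n) (En n))) \<le> \<gamma> * real (card (Vn n))"
      "nat \<lceil>1 / \<gamma>\<rceil> + 1 \<le> card (Vn n)"
    unfolding eventually_sequentially by blast
  define v where "v = real (card (Vn n))"
  define bb where "bb = real (card (bdry (Vn n) (En n)))"
  \<comment> \<open>\<open>1 \<le> \<gamma> * v\<close> lets the 1 in \<open>bb + 1\<close> be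
    absorbed into a second \<open>\<gamma> * v\<close>.\<close>
  have v: "0 < v" "1 \<le> \<gamma> * v"
  proof -
    show "0 < v" using n(2) by (simp add: v_def)
    have "1 / \<gamma> \<le> real (nat \<lceil>1 / \<gamma>\<rceil> + 1)" by linarith
    also have "\<dots> \<le> v" unfolding v_def using n(2) by (rule of_nat_mono)
    finally show "1 \<le> \<gamma> * v" using \<gamma> by (simp add: pos_divide_le_eq mult.commute)
  qed
  have "finite ((\<lambda>(x, u). gdist E x u) ` (Vn n \<times> Vn n))" using fin by simp
  then obtain r0 where r0: "\<And>m. m \<in> (\<lambda>(x, u). gdist E x u) ` (Vn n \<times> Vn n) \<Longrightarrow> m < r0"
    using finite_nat_set_iff_bounded by metis
  have "arm_prob p r u \<le> \<epsilon>" if r: "r0 \<le> r" for r u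
  proof -
    have far: "gdist E x y < r" if "x \<in> Vn n" "y \<in> Vn n" for x y
      using r0[of "gdist E x y"] that r by force
    have "q * (v * arm_prob p r u) \<le> 6 * \<theta> * deg * v + 2 * (bb + 1) / \<theta> + deg * bb"
      using arm_prob_finite_bound[OF sub[of n] fin[of n] far \<theta>, where p=p and v=u] by (simp add: q_def v_def bb_def add.commute)
    also have "\<dots> \<le> \<epsilon> * q / 3 * v + 2 * (\<gamma> * v + \<gamma> * v) / \<theta> + deg * (\<gamma> * v)"
      using \<theta> \<theta>D v n(1) by (intro add_mono mult_right_mono divide_right_mono mult_left_mono)
        (auto simp: v_def bb_def)
    also have "\<dots> = \<epsilon> * q / 3 * v + ((4 / \<theta> + deg) * \<gamma>) * v" by (simp add: field_simps)
    also have "(4 / \<theta> + deg) * \<gamma> = 2 * \<epsilon> * q / 3"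
    proof -
      have "4 / \<theta> + deg \<noteq> 0" using d by linarith
      hence "\<gamma> * (4 / \<theta> + deg) = 2 * \<epsilon> * q / 3"
        using nonzero_eq_divide_eq[of "4 / \<theta> + deg" \<gamma> "2 * \<epsilon> * q / 3"] \<gamma>_def by blast
      thus ?thesis by (simp only: mult.commute)
    qed
    also have "\<epsilon> * q / 3 * v + 2 * \<epsilon> * q / 3 * v = q * (v * \<epsilon>)" by (simp add: field_simps)
    finally show ?thesis using q v by simp
  qed
  thus ?thesis by blast
qed

text \<open>An arbitrary orientation, which gives each edge a vertex to centre its ball at.\<close>

definition src :: "'v set \<Rightarrow> 'v" where "src e = (SOME u. \<exists>v. e = {u, v} \<and> E u v)"
definition dst :: "'v set \<Rightarrow> 'v" where "dst e = (SOME v. e = {src e, v} \<and> E (src e) v)"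

lemma src_dst:
  assumes "e \<in> gedges E"
  shows "e = {src e, dst e}" "E (src e) (dst e)" "src e \<noteq> dst e"
proof -
  have "\<exists>v. e = {src e, v} \<and> E (src e) v" unfolding src_def
    by (rule someI_ex) (use assms in \<open>auto simp: gedges_def\<close>)
  hence *: "e = {src e, dst e} \<and> E (src e) (dst e)" unfolding dst_def by (rule someI_ex)
  thus "e = {src e, dst e}" "E (src e) (dst e)" by auto
  show "src e \<noteq> dst e" using * irrefl by metis
qed

text \<open>Ball version of the connectivity that decides \<open>a \<le> p\<close> in
  \<open>cmin_perturb\<close>; \<open>e\<close> is left out, so it does not depend on
  \<open>w e\<close>.\<close>

definition bypass :: "real \<Rightarrow> nat \<Rightarrow> 'v set \<Rightarrow> ('v set \<Rightarrow> real) \<Rightarrow> bool" where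
  "bypass p r e w \<longleftrightarrow> (adj (ballv (src e) r) {g \<in> balle (src e) r - {e}. w g \<le> p})\<^sup>*\<^sup>* (src e) (dst e)"

text \<open>Discretised local version, at mesh \<open>\<eta>\<close> and height \<open>J \<eta>\<close>, of \<open>min (w e) a\<close> in \<open>cmin_perturb\<close>.\<close>

definition local_min :: "real \<Rightarrow> nat \<Rightarrow> nat \<Rightarrow> 'v set \<Rightarrow> ('v set \<Rightarrow> real) \<Rightarrow> real" where
  "local_min \<eta> J r e w = \<eta> * (\<Sum>j<J. of_bool (real j * \<eta> < w e \<and> \<not> bypass (real j * \<eta>) r e w))"

text \<open>One term per source of error: the mesh, the part of the weight above the grid, and the
  levels at which the ball may misjudge the bypass.\<close>

definition local_err :: "real \<Rightarrow> nat \<Rightarrow> nat \<Rightarrow> 'v set \<Rightarrow> ('v set \<Rightarrow> real) \<Rightarrow> real" where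
  "local_err \<eta> J r e w = \<eta> + max 0 (w e - real J * \<eta>)
     + \<eta> * (\<Sum>j<J. of_bool (arms (real j * \<eta>) r (src e) (dst e) w))"

lemma measurable_local_min [measurable]: "local_min \<eta> J r e \<in> borel_measurable Lam"
proof -
  have [measurable]: "Measurable.pred Lam (bypass p r e)" for p
    unfolding bypass_def
    by (rule measurable_open_edges'[of "balle (src e) r - {e}" "\<lambda>T. (adj (ballv (src e) r) T)\<^sup>*\<^sup>* (src e) (dst e)"])
      (simp add: finite_ball_edges)
  show ?thesis unfolding local_min_def by measurable
qed

lemma measurable_local_err [measurable]: "local_err \<eta> J r e \<in> borel_measurable Lam"
  unfolding local_err_def by measurable

lemma local_min_bounds:
  assumes "0 \<le> \<eta>"
  shows "0 \<le> local_min \<eta> J r e w" "local_min \<eta> J r e w \<le> real J * \<eta>"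
proof -
  show "0 \<le> local_min \<eta> J r e w" unfolding local_min_def using assms by (intro mult_nonneg_nonneg sum_nonneg) auto
  have "(\<Sum>j<J. of_bool (real j * \<eta> < w e \<and> \<not> bypass (real j * \<eta>) r e w)) \<le> (\<Sum>j<J. 1 :: real)"
    by (rule sum_mono) auto
  hence "\<eta> * (\<Sum>j<J. of_bool (real j * \<eta> < w e \<and> \<not> bypass (real j * \<eta>) r e w)) \<le> \<eta> * real J"
    using assms by (intro mult_left_mono) auto
  thus "local_min \<eta> J r e w \<le> real J * \<eta>" by (simp add: local_min_def mult.commute)
qed

lemma dep_on_local_min: "dep_on (insert e (balle (src e) r)) (local_min \<eta> J r e)"
proof -
  have "local_min \<eta> J r e w = local_min \<eta> J r e w'"
    if "\<forall>i\<in>insert e (balle (src e) r). w i = w' i" for w w'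
  proof -
    have "{g \<in> balle (src e) r - {e}. w g \<le> p} = {g \<in> balle (src e) r - {e}. w' g \<le> p}" for p
      using that by auto
    thus ?thesis using that by (simp add: local_min_def bypass_def)
  qed
  thus ?thesis unfolding dep_on_def by blast
qed

text \<open>A path in the ball is a path in \<open>F\<close>. If \<open>F\<close> contains a path
  and the ball none, that path leaves the ball from either end, and with \<open>e\<close> closed
  this gives two arms.\<close>

lemma bypass_difference:
  fixes w :: "'v set \<Rightarrow> real" and p z :: real
  assumes sub: "is_subgraph E V F" and e: "e \<in> F" and good: "ball_within E (src e) (real r) V F"
    and r: "1 \<le> r" and z: "p < z"
  defines "H \<equiv> {g \<in> F - {e}. w g \<le> p}"
  shows "bypass p r e (w(e := z)) \<Longrightarrow> (adj V H)\<^sup>*\<^sup>* (src e) (dst e)"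
    and "(adj V H)\<^sup>*\<^sup>* (src e) (dst e) \<Longrightarrow> \<not> bypass p r e (w(e := z)) \<Longrightarrow> arms p r (src e) (dst e) (w(e := z))"
proof -
  let ?u = "src e" and ?v = "dst e" and ?w = "w(e := z)"
  have eg: "e \<in> gedges E" using sub e by (auto simp: is_subgraph_def)
  have b: "ballv ?u r \<subseteq> V" "balle ?u r \<subseteq> F" using good by (auto simp: ball_within_def)
  have ball: "?u \<in> ballv ?u r" "?v \<in> ballv ?u r"
    using r gdist_edge[OF sym[OF src_dst(2)[OF eg]]] by (auto simp: mem_ball)
  show "(adj V H)\<^sup>*\<^sup>* ?u ?v" if "bypass p r e ?w"
    using that unfolding bypass_def by (rule adj_rtranclp_mono) (use b in \<open>auto simp: H_def\<close>)
  assume c: "(adj V H)\<^sup>*\<^sup>* ?u ?v" and nb: "\<not> bypass p r e ?w"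
  have "{g \<in> balle ?u r. ?w g \<le> p} = {g \<in> balle ?u r - {e}. ?w g \<le> p}" using z by auto
  hence nc: "\<not> ball_conn p r ?u ?w ?u ?v" using nb by (simp add: bypass_def ball_conn_def)
  hence nc': "\<not> ball_conn p r ?u ?w ?v ?u" unfolding ball_conn_def using adj_rtranclp_sym by metis
  have H: "H \<subseteq> gedges E" "\<And>g. g \<in> H \<Longrightarrow> ?w g \<le> p" using sub by (auto simp: H_def is_subgraph_def)
  have "\<exists>z. r \<le> gdist E z ?u \<and> ball_conn p r ?u ?w ?u z"
    using exit_ball[where w="w(e := z)", OF c ball(1) H] nc by blast
  moreover have "\<exists>z. r \<le> gdist E z ?u \<and> ball_conn p r ?u ?w ?v z"
    using exit_ball[where w="w(e := z)", OF adj_rtranclp_sym[OF c] ball(2) H] nc' by blast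
  moreover have "p < ?w {?u, ?v}" using src_dst(1)[OF eg] z by simp
  ultimately show "arms p r ?u ?v ?w" using nc by (simp add: arms_def)
qed

text \<open>By \<open>cmin_perturb\<close> the increments are those of \<open>min z a\<close>, which
  the grid resolves; at each level \<open>p\<close> below \<open>z\<close>, the ball decides
  \<open>a \<le> p\<close> correctly unless two arms occur.\<close>

lemma local_approximation:
  assumes sub: "is_subgraph E V F" and fin: "finite V" and con: "connected_on V F" and e: "e \<in> F"
    and good: "ball_within E (src e) (real r) V F" and r: "1 \<le> r" and \<eta>: "0 < \<eta>" and xy: "0 \<le> x" "0 \<le> y"
  shows "\<bar>cmin V F (w(e := x)) - cmin V F (w(e := y)) - (local_min \<eta> J r e (w(e := x)) - local_min \<eta> J r e (w(e := y)))\<bar>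
    \<le> local_err \<eta> J r e (w(e := x)) + local_err \<eta> J r e (w(e := y))"
proof -
  have eg: "e \<in> gedges E" "e \<subseteq> V" using sub e by (auto simp: is_subgraph_def)
  note sd = src_dst[OF eg(1)]
  have V: "src e \<in> V" "dst e \<in> V" using eg(2) sd(1) by blast+
  \<comment> \<open>The cap is at least both weights and strictly above all levels
    \<open>real j * \<eta>\<close> with \<open>j < J\<close>, as \<open>p < X\<close>
    requires.\<close>
  define X where "X = max (max x y) (real J * \<eta>)"
  obtain A a where Aa: "\<And>z. z \<le> X \<Longrightarrow> cmin V F (w(e := z)) = A + min z a"
    "\<And>p. 0 \<le> p \<Longrightarrow> p < X \<Longrightarrow> (adj V {g \<in> F - {e}. w g \<le> p})\<^sup>*\<^sup>* (src e) (dst e) \<longleftrightarrow> a \<le> p"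
    using cmin_perturb[OF finite_subgraph_edges[OF sub fin] con sd(1) e sd(3) V, of X w] by blast
  have close: "\<bar>min z (max 0 a) - local_min \<eta> J r e (w(e := z))\<bar> \<le> local_err \<eta> J r e (w(e := z))"
    if z: "0 \<le> z" "z \<le> X" for z
  proof -
    let ?t = "min z (max 0 a)"
    have jX: "real j * \<eta> < X" if "j < J" for j
    proof -
      have "real j * \<eta> < real J * \<eta>" using that \<eta> by simp
      thus ?thesis unfolding X_def by linarith
    qed
    have trm: "\<bar>of_bool (real j * \<eta> < ?t) - of_bool (real j * \<eta> < z \<and> \<not> bypass (real j * \<eta>) r e (w(e := z)))\<bar>
        \<le> (of_bool (arms (real j * \<eta>) r (src e) (dst e) (w(e := z))) :: real)" if j: "j < J" for j
    proof -
      have 0: "0 \<le> real j * \<eta>" using \<eta> by simp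
      show ?thesis
      proof (cases "real j * \<eta> < z")
        case True
        note bd = bypass_difference[OF sub e good r True, of w]
        have "real j * \<eta> < max 0 a \<longleftrightarrow> \<not> (adj V {g \<in> F - {e}. w g \<le> real j * \<eta>})\<^sup>*\<^sup>* (src e) (dst e)"
          using Aa(2)[OF 0 jX[OF j]] 0 by auto
        thus ?thesis using True bd by auto
      qed auto
    qed
    let ?G = "\<eta> * (\<Sum>j<J. of_bool (real j * \<eta> < ?t))"
    have 1: "\<bar>?t - ?G\<bar> \<le> \<eta> + max 0 (?t - real J * \<eta>)"
      by (rule grid_approximation) (use z \<eta> in auto)
    have 2: "max 0 (?t - real J * \<eta>) \<le> max 0 ((w(e := z)) e - real J * \<eta>)" by simp
    have "\<bar>?G - local_min \<eta> J r e (w(e := z))\<bar>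
        = \<eta> * \<bar>\<Sum>j<J. of_bool (real j * \<eta> < ?t) - of_bool (real j * \<eta> < z \<and> \<not> bypass (real j * \<eta>) r e (w(e := z)))\<bar>"
      using \<eta> by (simp add: local_min_def right_diff_distrib[symmetric] sum_subtractf[symmetric] abs_mult
          del: sum_of_bool_eq)
    also have "\<dots> \<le> \<eta> * (\<Sum>j<J. of_bool (arms (real j * \<eta>) r (src e) (dst e) (w(e := z))))"
      using \<eta> by (intro mult_left_mono order_trans[OF sum_abs] sum_mono trm) auto
    finally have 3: "\<bar>?G - local_min \<eta> J r e (w(e := z))\<bar>
      \<le> \<eta> * (\<Sum>j<J. of_bool (arms (real j * \<eta>) r (src e) (dst e) (w(e := z))))" .
    have "\<bar>?t - local_min \<eta> J r e (w(e := z))\<bar> \<le> \<bar>?t - ?G\<bar> + \<bar>?G - local_min \<eta> J r e (w(e := z))\<bar>"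
      using abs_triangle_ineq[of "?t - ?G" "?G - local_min \<eta> J r e (w(e := z))"] by simp
    also have "\<dots> \<le> local_err \<eta> J r e (w(e := z))"
      unfolding local_err_def by (rule add_mono[OF order_trans[OF 1 add_left_mono[OF 2]] 3])
    finally show ?thesis .
  qed
  \<comment> \<open>For nonnegative weights a negative threshold acts like 0: both give increment
    0.\<close>
  have "cmin V F (w(e := x)) - cmin V F (w(e := y)) = min x (max 0 a) - min y (max 0 a)"
    using Aa(1)[of x] Aa(1)[of y] xy by (auto simp: X_def)
  moreover have "\<bar>s - t - (s' - t')\<bar> \<le> b + c" if "\<bar>s - s'\<bar> \<le> b" "\<bar>t - t'\<bar> \<le> c" for s t s' t' b c :: real
    using that by linarith
  moreover have "x \<le> X" "y \<le> X" by (simp_all add: X_def)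
  ultimately show ?thesis using close xy by presburger
qed

text \<open>The 3 comes from squaring a sum of three terms. The arm sum is at most \<open>J\<close>,
  so its square is at most \<open>J\<close> times itself, and its mean is a sum of two-arm
  probabilities.\<close>

lemma local_err_sq:
  assumes m2: "integrable \<mu> (\<lambda>x. x\<^sup>2)" and \<eta>: "0 < \<eta>" and e: "e \<in> gedges E"
    and \<epsilon>: "\<And>j. j < J \<Longrightarrow> arm_prob (real j * \<eta>) r (src e) \<le> \<epsilon>"
  shows "integrable Lam (\<lambda>w. (local_err \<eta> J r e w)\<^sup>2)"
    and "(\<E> w. (local_err \<eta> J r e w)\<^sup>2) \<le>
      3 * (\<eta>\<^sup>2 + (\<integral>x. (max 0 (x - real J * \<eta>))\<^sup>2 \<partial>\<mu>) + (real J * \<eta>)\<^sup>2 * \<epsilon>)"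
proof -
  let ?K = "real J * \<eta>"
  let ?s = "\<lambda>w. \<Sum>j<J. (of_bool (arms (real j * \<eta>) r (src e) (dst e) w) :: real)"
  have K: "0 \<le> ?K" using \<eta> by simp
  have ti: "integrable \<mu> (\<lambda>x. (max 0 (x - ?K))\<^sup>2)"
  proof (rule Bochner_Integration.integrable_bound[OF m2])
    have "(max 0 (x - ?K))\<^sup>2 \<le> x\<^sup>2" for x
    proof (cases "x \<le> ?K")
      case False
      thus ?thesis using K by (auto intro!: power_mono)
    qed (simp add: max_def)
    thus "AE x in \<mu>. norm ((max 0 (x - ?K))\<^sup>2) \<le> norm (x\<^sup>2)" by auto
  qed (simp cong: measurable_cong_sets)
  have s: "0 \<le> ?s w" "?s w \<le> J" for w
    using sum_mono[of "{..<J}" "\<lambda>j. of_bool (arms (real j * \<eta>) r (src e) (dst e) w)" "\<lambda>_. 1 :: real"]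
    by (auto intro: sum_nonneg)
  have le: "(local_err \<eta> J r e w)\<^sup>2 \<le> 3 * (\<eta>\<^sup>2 + (max 0 (w e - ?K))\<^sup>2 + ?K * \<eta> * ?s w)" for w
  proof -
    have sq3: "(a + b + c)\<^sup>2 \<le> 3 * (a\<^sup>2 + b\<^sup>2 + c\<^sup>2)" for a b c :: real
      using zero_le_power2[of "a - b"] zero_le_power2[of "b - c"] zero_le_power2[of "a - c"]
      by (simp add: power2_eq_square algebra_simps)
    have "(\<eta> * ?s w)\<^sup>2 \<le> ?K * \<eta> * ?s w"
    proof -
      have "\<eta> * ?s w \<le> ?K" using mult_left_mono[OF s(2)[of w], of \<eta>] \<eta> by (simp add: mult.commute)
      hence "(\<eta> * ?s w) * (\<eta> * ?s w) \<le> ?K * (\<eta> * ?s w)" using \<eta> s(1)[of w] by (intro mult_right_mono) auto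
      thus ?thesis by (simp add: power2_eq_square mult.assoc)
    qed
    thus ?thesis unfolding local_err_def
      by (intro order_trans[OF sq3] mult_left_mono add_left_mono) auto
  qed
  have ti': "integrable Lam (\<lambda>w. (max 0 (w e - ?K))\<^sup>2)" by (rule integrable_coord[OF ti])
  have si: "integrable Lam ?s" by (intro Bochner_Integration.integrable_sum integrable_arms)
  have ii: "integrable Lam (\<lambda>w. 3 * (\<eta>\<^sup>2 + (max 0 (w e - ?K))\<^sup>2 + ?K * \<eta> * ?s w))"
    by (intro integrable_mult_right Bochner_Integration.integrable_add ti' si) auto
  show *: "integrable Lam (\<lambda>w. (local_err \<eta> J r e w)\<^sup>2)"
    by (rule Bochner_Integration.integrable_bound[OF ii]) (use le in \<open>auto intro: order_trans[OF _ abs_ge_self]\<close>)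
  have "(\<E> w. (local_err \<eta> J r e w)\<^sup>2) \<le> (\<E> w. 3 * (\<eta>\<^sup>2 + (max 0 (w e - ?K))\<^sup>2 + ?K * \<eta> * ?s w))"
    by (rule integral_mono[OF * ii le])
  also have "\<dots> = 3 * (\<eta>\<^sup>2 + (\<E> w. (max 0 (w e - ?K))\<^sup>2)
      + ?K * \<eta> * (\<Sum>j<J. \<E> w. of_bool (arms (real j * \<eta>) r (src e) (dst e) w)))"
    using ti' integrable_arms si by (simp del: sum_of_bool_eq)
  also have "(\<E> w. (max 0 (w e - ?K))\<^sup>2) = (\<integral>x. (max 0 (x - ?K))\<^sup>2 \<partial>\<mu>)"
    by (rule integral_coord) measurable
  also have "3 * (\<eta>\<^sup>2 + (\<integral>x. (max 0 (x - ?K))\<^sup>2 \<partial>\<mu>)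
      + ?K * \<eta> * (\<Sum>j<J. \<E> w. of_bool (arms (real j * \<eta>) r (src e) (dst e) w)))
    \<le> 3 * (\<eta>\<^sup>2 + (\<integral>x. (max 0 (x - ?K))\<^sup>2 \<partial>\<mu>) + ?K * \<eta> * (\<Sum>j<J. \<epsilon>))"
  proof (intro mult_left_mono add_left_mono sum_mono)
    fix j assume "j \<in> {..<J}"
    have "(\<E> w. of_bool (arms (real j * \<eta>) r (src e) (dst e) w)) \<le> arm_prob (real j * \<eta>) r (src e)"
      unfolding arm_prob_def
      by (rule member_le_sum) (use src_dst[OF e] finite_nbh in \<open>auto simp: nbh_def intro!: integral_nonneg\<close>)
    also have "\<dots> \<le> \<epsilon>" using \<epsilon> \<open>j \<in> {..<J}\<close> by simp
    finally show "(\<E> w. of_bool (arms (real j * \<eta>) r (src e) (dst e) w)) \<le> \<epsilon>" .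
  qed (use K \<eta> in auto)
  also have "\<dots> = 3 * (\<eta>\<^sup>2 + (\<integral>x. (max 0 (x - ?K))\<^sup>2 \<partial>\<mu>) + ?K\<^sup>2 * \<epsilon>)"
    by (simp add: power2_eq_square mult_ac)
  finally show "(\<E> w. (local_err \<eta> J r e w)\<^sup>2) \<le> 3 * (\<eta>\<^sup>2 + (\<integral>x. (max 0 (x - ?K))\<^sup>2 \<partial>\<mu>) + ?K\<^sup>2 * \<epsilon>)" .
qed

lemma card_edges_by_src:
  assumes "finite S" "A \<subseteq> gedges E" "\<And>e. e \<in> A \<Longrightarrow> src e \<in> S"
  shows "card A \<le> deg * card S"
proof (rule card_incident_edges[OF assms(1)], rule subsetI)
  fix e assume e: "e \<in> A"
  hence "e = {src e, dst e}" "E (src e) (dst e)" using src_dst assms(2) by blast+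
  thus "e \<in> (\<Union>u\<in>S. (\<lambda>v. {u, v}) ` nbh u)" using assms(3)[OF e] unfolding nbh_def by blast
qed

text \<open>Balls sharing an edge have centres within \<open>2 * r\<close>, and at most
  \<open>deg\<close> edges have a given source. For \<open>1 \<le> r\<close> an edge lies in its own
  ball, so a common index is always a common ball edge.\<close>

lemma card_overlap:
  assumes "F \<subseteq> gedges E" "e \<in> F" "1 \<le> r"
  shows "card {e' \<in> F. insert e (balle (src e) r) \<inter> insert e' (balle (src e') r) \<noteq> {}} \<le> deg * vol (2 * r)"
proof -
  have N: "insert g (balle (src g) r) = balle (src g) r" if "g \<in> F" for g
  proof -
    have g: "g = {src g, dst g}" "E (src g) (dst g)" using src_dst assms(1) that by blast+
    have "src g \<in> ballv (src g) r" "dst g \<in> ballv (src g) r"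
      using gdist_edge[OF sym[OF g(2)]] assms(3) by (auto simp: mem_ball)
    hence "{src g, dst g} \<in> balle (src g) r" using g(2) by (simp add: edge_mem_ball_edges)
    thus ?thesis using g(1) by auto
  qed
  have "src e' \<in> ballv (src e) (2 * r)"
    if e': "e' \<in> F" "insert e (balle (src e) r) \<inter> insert e' (balle (src e') r) \<noteq> {}" for e'
  proof -
    obtain g where g: "g \<in> balle (src e) r" "g \<in> balle (src e') r" using e' N assms(2) by blast
    then obtain x y where "g = {x, y}" by (auto simp: ball_edges_def)
    hence "gdist E x (src e) \<le> r" "gdist E x (src e') \<le> r"
      using g by (auto simp: edge_mem_ball_edges mem_ball)
    thus ?thesis
      using gdist_triangle[of "src e'" "src e" x] by (simp add: mem_ball gdist_commute[of "src e'" x] del: of_nat_mult)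
  qed
  hence "card {e' \<in> F. insert e (balle (src e) r) \<inter> insert e' (balle (src e') r) \<noteq> {}}
      \<le> deg * card (ballv (src e) (2 * r))"
    by (intro card_edges_by_src[OF finite_ball_nat]) (use assms(1) in blast)+
  thus ?thesis by (simp only: card_ball)
qed

end

section \<open>The variance lower bound\<close>

context iid begin

lemma integral_prod_coord:
  fixes h :: "'i \<Rightarrow> real \<Rightarrow> real"
  assumes "finite I" and h: "\<And>i. integrable \<mu> (h i)"
  shows "integrable Lam (\<lambda>w. \<Prod>i\<in>I. h i (w i)) \<and>
    (\<E> w. (\<Prod>i\<in>I. h i (w i))) = (\<Prod>i\<in>I. \<integral>x. h i x \<partial>\<mu>)"
  using assms(1)
proof (induction I rule: finite_induct)
  case (insert i I)
  have hi: "integrable Lam (\<lambda>w. h i (w i))" by (rule integrable_coord[OF h])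
  have m: "h i \<in> borel_measurable borel" using borel_measurable_integrable[OF h[of i]] by simp
  have "dep_on {i} (\<lambda>w. h i (w i))" "dep_on I (\<lambda>w. \<Prod>i\<in>I. h i (w i))"
    by (auto simp: dep_on_def intro!: prod.cong)
  from integral_mult_dep_on[OF hi _ this] insert integral_coord[OF m, of i]
  show ?case by simp
qed simp

end

context iid_transitive_graph begin

text \<open>The tree weight is \<open>A + min x c\<close>, hence monotone. A path avoiding
  \<open>e\<close> starts with another edge at \<open>src e\<close>; if all of these weigh at least
  \<open>b\<close>, then so does \<open>c\<close>, and the whole gap from \<open>a\<close> to
  \<open>b\<close> is felt.\<close>

lemma cmin_increment:
  assumes sub: "is_subgraph E V F" and fin: "finite V" and con: "connected_on V F" and e: "e \<in> F"
  shows "0 \<le> (x - y) * (cmin V F (w(e := x)) - cmin V F (w(e := y)))"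
    and "b \<le> x \<Longrightarrow> y \<le> a \<Longrightarrow> 0 \<le> a \<Longrightarrow> a < b \<Longrightarrow> (\<And>g. g \<in> F - {e} \<Longrightarrow> src e \<in> g \<Longrightarrow> b \<le> w g) \<Longrightarrow>
      b - a \<le> cmin V F (w(e := x)) - cmin V F (w(e := y))"
proof -
  have eg: "e \<in> gedges E" "e \<subseteq> V" using sub e by (auto simp: is_subgraph_def)
  note sd = src_dst[OF eg(1)]
  have V: "src e \<in> V" "dst e \<in> V" using eg(2) sd(1) by blast+
  define X where "X = max (max x y) b + 1"
  have X: "x \<le> X" "y \<le> X" "b < X" by (auto simp: X_def)
  obtain A c where Ac: "\<And>z. z \<le> X \<Longrightarrow> cmin V F (w(e := z)) = A + min z c"
    "\<And>p. 0 \<le> p \<Longrightarrow> p < X \<Longrightarrow> (adj V {g \<in> F - {e}. w g \<le> p})\<^sup>*\<^sup>* (src e) (dst e) \<longleftrightarrow> c \<le> p"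
    using cmin_perturb[OF finite_subgraph_edges[OF sub fin] con sd(1) e sd(3) V, of X w] by blast
  have D: "cmin V F (w(e := x)) - cmin V F (w(e := y)) = min x c - min y c"
    using Ac(1) X by simp
  show "0 \<le> (x - y) * (cmin V F (w(e := x)) - cmin V F (w(e := y)))"
    unfolding D by (cases "x \<le> y") (auto intro!: mult_nonneg_nonneg mult_nonpos_nonpos)
  assume xy: "b \<le> x" "y \<le> a" and ab: "0 \<le> a" "a < b"
    and g: "\<And>g. g \<in> F - {e} \<Longrightarrow> src e \<in> g \<Longrightarrow> b \<le> w g"
  have "b \<le> c"
  proof (rule ccontr)
    assume "\<not> b \<le> c"
    define p where "p = max 0 c"
    have p: "0 \<le> p" "p < b" "c \<le> p" "p < X" using ab \<open>\<not> b \<le> c\<close> X(3) by (auto simp: p_def)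
    hence "(adj V {g \<in> F - {e}. w g \<le> p})\<^sup>*\<^sup>* (src e) (dst e)" using Ac(2) by blast
    then obtain z where "adj V {g \<in> F - {e}. w g \<le> p} (src e) z"
      using sd(3) by (cases rule: converse_rtranclpE) auto
    hence "{src e, z} \<in> F - {e}" "w {src e, z} \<le> p" by (auto simp: adj_def)
    thus False using g[of "{src e, z}"] p(2) by auto
  qed
  hence "min y c \<le> a" "b \<le> min x c" using xy by (simp_all add: min_le_iff_disj)
  thus "b - a \<le> cmin V F (w(e := x)) - cmin V F (w(e := y))" unfolding D by linarith
qed

section \<open>Tree weight and total weight as functions of iid weights\<close>

lemma measurable_cmin: "finite F \<Longrightarrow> cmin V F \<in> borel_measurable Lam"
  unfolding cmin_def[abs_def] by (intro borel_measurable_Min borel_measurable_sum measurable_coord) simp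

lemma sum_abs_sq_integrable:
  fixes F :: "'i set"
  assumes "integrable \<mu> (\<lambda>x. x\<^sup>2)" "finite F"
  shows "integrable Lam (\<lambda>w. (\<Sum>e\<in>F. \<bar>w e\<bar>)\<^sup>2)"
proof -
  have "integrable Lam (\<lambda>w. \<bar>w e\<bar> * \<bar>w g\<bar>)" for e g :: 'i
    by (rule integrable_mult_of_squares) (use integrable_coord[OF assms(1)] in auto)
  thus ?thesis unfolding power2_eq_square sum_product by auto
qed

text \<open>Obtained from \<open>mom2\<close> through the trivial instance with no edges and the
  zero function.\<close>

lemma second_moment:
  assumes "integrable \<mu> (\<lambda>x. \<bar>x\<bar> ^ 3)"
  shows "integrable \<mu> (\<lambda>x. x\<^sup>2)"
proof -
  interpret z: iid_function \<mu> "{} :: unit set" "\<lambda>_. 0"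
    by unfold_locales (use assms in \<open>auto simp: dep_on_def\<close>)
  show ?thesis by (rule z.mom2)
qed

lemma iid_function_cmin:
  assumes sub: "is_subgraph E V F" and fin: "finite V" and con: "connected_on V F"
    and m3: "integrable \<mu> (\<lambda>x. \<bar>x\<bar> ^ 3)"
  shows "iid_function \<mu> F (cmin V F)"
proof
  show finF: "finite F" by (rule finite_subgraph_edges[OF sub fin])
  show [measurable]: "cmin V F \<in> borel_measurable Lam" by (rule measurable_cmin[OF finF])
  show "dep_on F (cmin V F)" by (auto simp: dep_on_def intro: cmin_cong)
  show "\<bar>cmin V F (w(e := x)) - cmin V F w\<bar> \<le> \<bar>x - w e\<bar>" for w e x
    using cmin_lipschitz[OF finF con, of w e x "w e"] simple_subgraph[OF sub]
    unfolding simple_edges_def by simp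
  show "integrable Lam (\<lambda>w. (cmin V F w)\<^sup>2)"
  proof (rule Bochner_Integration.integrable_bound)
    show "integrable Lam (\<lambda>w. (\<Sum>e\<in>F. \<bar>w e\<bar>)\<^sup>2)"
      by (rule sum_abs_sq_integrable[OF second_moment[OF m3] finF])
    have "(cmin V F w)\<^sup>2 \<le> (\<Sum>e\<in>F. \<bar>w e\<bar>)\<^sup>2" for w
      using abs_cmin_le[OF finF con, of w] by (metis abs_ge_zero power2_abs power_mono)
    thus "AE w in Lam. norm ((cmin V F w)\<^sup>2) \<le> norm ((\<Sum>e\<in>F. \<bar>w e\<bar>)\<^sup>2)" by auto
  qed measurable
qed (rule m3)

lemma iid_function_sum:
  fixes F :: "'i set"
  assumes "finite F" and m3: "integrable \<mu> (\<lambda>x. \<bar>x\<bar> ^ 3)"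
  shows "iid_function \<mu> F (\<lambda>w. \<Sum>e\<in>F. w e)"
proof
  show "\<bar>(\<Sum>g\<in>F. (w(e := x)) g) - (\<Sum>g\<in>F. w g)\<bar> \<le> \<bar>x - w e\<bar>" for w :: "'i \<Rightarrow> real" and e x
  proof -
    have "(\<Sum>g\<in>F. (w(e := x)) g) - (\<Sum>g\<in>F. w g) = (\<Sum>g\<in>F. (w(e := x)) g - w g)"
      by (rule sum_subtractf[of "w(e := x)" w F, symmetric])
    also have "\<dots> = (\<Sum>g\<in>F. if g = e then x - w e else 0)" by (rule sum.cong) auto
    finally show ?thesis using assms(1) by simp
  qed
  show "integrable Lam (\<lambda>w :: 'i \<Rightarrow> real. (\<Sum>e\<in>F. w e)\<^sup>2)"
  proof (rule Bochner_Integration.integrable_bound)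
    show "integrable Lam (\<lambda>w. (\<Sum>e\<in>F. \<bar>w e\<bar>)\<^sup>2)"
      by (rule sum_abs_sq_integrable[OF second_moment[OF m3] assms(1)])
    have "(\<Sum>e\<in>F. w e)\<^sup>2 \<le> (\<Sum>e\<in>F. \<bar>w e\<bar>)\<^sup>2" for w :: "'i \<Rightarrow> real"
      using sum_abs[of w F] by (metis abs_ge_zero power2_abs power_mono)
    thus "AE w in Lam. norm ((\<Sum>e\<in>F. w e)\<^sup>2) \<le> norm ((\<Sum>e\<in>F. \<bar>w e\<bar>)\<^sup>2)" by auto
  qed measurable
qed (use assms in \<open>auto simp: dep_on_def intro!: sum.cong\<close>)

text \<open>The variance is at least \<open>2 s Cov - s\<^sup>2 Var\<close> for the covariance with the total weight,
  and by \<open>covariance_formula\<close> the covariance is a sum of nonnegative increments.\<close>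

lemma cmin_variance_lower:
  assumes sub: "is_subgraph E V F" and fin: "finite V" and con: "connected_on V F"
    and m3: "integrable \<mu> (\<lambda>x. \<bar>x\<bar> ^ 3)" and ab: "0 \<le> a" "a < b"
  defines "c \<equiv> (b - a)\<^sup>2 * (popen a * mu.prob {b..} ^ (deg + 1))"
    and "M \<equiv> (\<integral>x. x\<^sup>2 \<partial>\<mu>)"
  shows "card F * (c\<^sup>2 / (8 * (M + 1))) \<le> (\<E> w. (cmin V F w - (\<E> w. cmin V F w))\<^sup>2)"
proof -
  have finF: "finite F" by (rule finite_subgraph_edges[OF sub fin])
  interpret f: iid_function \<mu> F "cmin V F" by (rule iid_function_cmin[OF sub fin con m3])
  let ?\<Psi> = "\<lambda>w :: 'v set \<Rightarrow> real. \<Sum>e\<in>F. w e"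
  interpret g: iid_function \<mu> F ?\<Psi> by (rule iid_function_sum[OF finF m3])
  have M: "0 \<le> M" by (simp add: M_def)
  have c: "0 \<le> c" by (simp add: c_def popen_def)
  have trm: "c \<le> (\<E> w. (w (e, False) - w (e, True)) * f.Dlt e (f.pre e) w)" if e: "e \<in> F" for e
  proof -
    define Adj where "Adj = {g \<in> F - {e}. src e \<in> g}"
    \<comment> \<open>The coordinates asked to be at least \<open>b\<close>: the original weight of
      \<open>e\<close> and, in the copy selected by \<open>mix (f.pre e)\<close>, every other edge
      at \<open>src e\<close>. With \<open>(e, True)\<close> at most \<open>a\<close> the increment
      is then at least \<open>b - a\<close>; the at most \<open>deg + 1\<close> members explain the
      exponent in \<open>c\<close>.\<close>
    define J where "J = insert (e, False) ((\<lambda>g. (g, g \<in> f.pre e)) ` Adj)"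
    define h where "h i x = (if i = (e, True) then of_bool (x \<le> a) else of_bool (b \<le> x) :: real)" for i :: "'v set \<times> bool" and x
    have hm: "h i \<in> borel_measurable borel" for i unfolding h_def by simp
    have hi: "integrable \<mu> (h i)" for i
      by (rule mu.integrable_const_bound[of _ 1]) (use hm in \<open>auto simp: h_def cong: measurable_cong_sets\<close>)
    have finJ: "finite (insert (e, True) J)" "(e, True) \<notin> J" using finF by (auto simp: J_def Adj_def)
    have ha: "(\<integral>x. h (e, True) x \<partial>\<mu>) = popen a"
    proof -
      have "(\<integral>x. h (e, True) x \<partial>\<mu>) = (\<integral>x. (indicator {..a} x :: real) \<partial>\<mu>)"
        by (rule Bochner_Integration.integral_cong) (auto simp: h_def indicator_def)
      thus ?thesis by (simp add: popen_def)
    qed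
    have hb: "(\<integral>x. h i x \<partial>\<mu>) = mu.prob {b..}" if "i \<in> J" for i
    proof -
      have "(\<integral>x. h i x \<partial>\<mu>) = (\<integral>x. (indicator {b..} x :: real) \<partial>\<mu>)"
        by (rule Bochner_Integration.integral_cong) (use that finJ(2) in \<open>auto simp: h_def indicator_def\<close>)
      thus ?thesis by simp
    qed
    have "card Adj \<le> deg * card {src e}"
    proof (rule card_incident_edges, simp, rule subsetI)
      fix g assume g: "g \<in> Adj"
      hence "g \<in> F" by (simp add: Adj_def)
      then obtain x y where xy: "g = {x, y}" "E x y" by (rule subgraph_edgeE[OF sub])
      thus "g \<in> (\<Union>u\<in>{src e}. (\<lambda>v. {u, v}) ` nbh u)"
        using g sym[OF xy(2)] by (auto simp: Adj_def nbh_def insert_commute)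
    qed
    hence "card ((\<lambda>g. (g, g \<in> f.pre e)) ` Adj) \<le> deg"
      using card_image_le[of Adj "\<lambda>g. (g, g \<in> f.pre e)"] finF by (auto simp: Adj_def)
    hence "card J \<le> deg + 1" unfolding J_def using card_insert_le_m1[of "deg + 1"] by simp
    hence "mu.prob {b..} ^ (deg + 1) \<le> mu.prob {b..} ^ card J" by (intro power_decreasing) auto
    hence "c \<le> (b - a)\<^sup>2 * (popen a * mu.prob {b..} ^ card J)"
      unfolding c_def using popen_bounds(1)[of a] by (intro mult_left_mono) auto
    also have "popen a * mu.prob {b..} ^ card J = (\<Prod>i\<in>insert (e, True) J. \<integral>x. h i x \<partial>\<mu>)"
      using finJ ha hb by simp
    also have "\<dots> = (\<E> w. (\<Prod>i\<in>insert (e, True) J. h i (w i)))"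
      using integral_prod_coord[OF finJ(1) hi] by simp
    also have "(b - a)\<^sup>2 * \<dots> = (\<E> w. (b - a)\<^sup>2 * (\<Prod>i\<in>insert (e, True) J. h i (w i)))" by simp
    also have "\<dots> \<le> (\<E> w. (w (e, False) - w (e, True)) * f.Dlt e (f.pre e) w)"
    proof (rule integral_mono)
      show "integrable Lam (\<lambda>w. (b - a)\<^sup>2 * (\<Prod>i\<in>insert (e, True) J. h i (w i)))"
        using integral_prod_coord[OF finJ(1) hi] by simp
      show "integrable Lam (\<lambda>w. (w (e, False) - w (e, True)) * f.Dlt e (f.pre e) w)"
        by (rule integrable_mult_of_squares) (use f.diff2 f.Dlt_sq in auto)
      fix w :: "'v set \<times> bool \<Rightarrow> real"
      let ?m = "mix (f.pre e) w"
      have m: "?m = ?m(e := w (e, False))" using f.pre(1)[OF e] by (auto simp: mix_def fun_eq_iff)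
      have D: "f.Dlt e (f.pre e) w = cmin V F (?m(e := w (e, False))) - cmin V F (?m(e := w (e, True)))"
        unfolding f.Dlt_def mix_insert by (simp only: m[symmetric])
      show "(b - a)\<^sup>2 * (\<Prod>i\<in>insert (e, True) J. h i (w i)) \<le> (w (e, False) - w (e, True)) * f.Dlt e (f.pre e) w"
      proof (cases "\<forall>i\<in>insert (e, True) J. h i (w i) = 1")
        \<comment> \<open>Off the event the product is 0, and the right side is nonnegative because
          the tree weight is monotone in each weight.\<close>
        case False
        then obtain i where i: "i \<in> insert (e, True) J" "h i (w i) \<noteq> 1" by blast
        hence "h i (w i) = 0" by (simp add: h_def split: if_splits)
        hence "(\<Prod>i\<in>insert (e, True) J. h i (w i)) = 0" using i(1) by (intro prod_zero[OF finJ(1)]) blast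
        thus ?thesis using cmin_increment(1)[OF sub fin con e, of "w (e, False)" "w (e, True)" ?m] by (simp only: D)
      next
        case True
        have "h (e, True) (w (e, True)) = 1" using True by blast
        hence le: "w (e, True) \<le> a" by (simp add: h_def split: if_splits)
        have ge: "b \<le> w i" if "i \<in> J" for i
        proof -
          have "h i (w i) = 1" "i \<noteq> (e, True)" using True that finJ(2) by auto
          thus ?thesis by (simp add: h_def split: if_splits)
        qed
        have x: "b \<le> w (e, False)" using ge by (simp add: J_def)
        have "b - a \<le> f.Dlt e (f.pre e) w"
          unfolding D by (rule cmin_increment(2)[OF sub fin con e x le ab]) (use ge in \<open>auto simp: mix_def J_def Adj_def\<close>)
        moreover have "b - a \<le> w (e, False) - w (e, True)" using x le by simp
        ultimately have "(b - a) * (b - a) \<le> (w (e, False) - w (e, True)) * f.Dlt e (f.pre e) w"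
          using ab by (intro mult_mono) auto
        moreover have "(\<Prod>i\<in>insert (e, True) J. h i (w i)) = 1" using True by (intro prod.neutral) auto
        ultimately show ?thesis by (simp only: power2_eq_square mult_1_right)
      qed
    qed
    finally show ?thesis .
  qed
  have "(\<E> w. ?\<Psi> w * of_real (cmin V F w - f.mean)) =
    (\<Sum>e\<in>F. \<E> w. (?\<Psi> (mix {} w) - ?\<Psi> (mix {e} w)) * of_real (f.Dlt e (f.pre e) w)) / 2"
    by (rule f.covariance_formula) (use g.f_sq in auto)
  also have "\<dots> = (\<Sum>e\<in>F. \<E> w. (w (e, False) - w (e, True)) * f.Dlt e (f.pre e) w) / 2"
  proof -
    have "?\<Psi> (mix {} w) - ?\<Psi> (mix {e} w) = w (e, False) - w (e, True)" if "e \<in> F" for e w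
    proof -
      have "?\<Psi> (mix {} w) - ?\<Psi> (mix {e} w) = (\<Sum>g\<in>F. mix {} w g - mix {e} w g)"
        by (rule sum_subtractf[of "mix {} w" "mix {e} w" F, symmetric])
      also have "\<dots> = (\<Sum>g\<in>F. if g = e then w (e, False) - w (e, True) else 0)"
        by (rule sum.cong) (auto simp: mix_def)
      finally show ?thesis using finF that by simp
    qed
    thus ?thesis by simp
  qed
  also have "\<dots> \<ge> (\<Sum>e\<in>F. c) / 2" by (intro divide_right_mono sum_mono trm) auto
  finally have cov: "card F * c / 2 \<le> (\<E> w. ?\<Psi> w * (cmin V F w - f.mean))" by simp
  \<comment> \<open>Maximises \<open>s * c * card F - 2 * s\<^sup>2 * (M + 1) * card F\<close>; the
    1 keeps the denominator positive.\<close>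
  define s where "s = c / (4 * (M + 1))"
  have s: "0 \<le> s" using c M by (simp add: s_def)
  let ?C = "\<E> w. (?\<Psi> w - g.mean) * (cmin V F w - f.mean)"
  have i1: "integrable Lam (\<lambda>w. ?\<Psi> w * (cmin V F w - f.mean))"
    by (rule integrable_mult_of_squares) (use g.f_sq f.sq_int in auto)
  have i2: "integrable Lam (\<lambda>w. (?\<Psi> w - g.mean) * (cmin V F w - f.mean))"
    by (rule integrable_mult_of_squares) (use g.sq_int f.sq_int in auto)
  have i3: "integrable Lam (\<lambda>w. cmin V F w - f.mean)" using f.f_int by auto
  have C: "?C = (\<E> w. ?\<Psi> w * (cmin V F w - f.mean))"
  proof -
    have "?C = (\<E> w. ?\<Psi> w * (cmin V F w - f.mean) - g.mean * (cmin V F w - f.mean))"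
      by (simp only: left_diff_distrib)
    also have "\<dots> = (\<E> w. ?\<Psi> w * (cmin V F w - f.mean)) - g.mean * (\<E> w. cmin V F w - f.mean)"
      using i1 i3 by (subst Bochner_Integration.integral_diff) auto
    also have "(\<E> w. cmin V F w - f.mean) = 0" using f.f_int by simp
    finally show ?thesis by simp
  qed
  have "0 \<le> (\<E> w. ((cmin V F w - f.mean) - s * (?\<Psi> w - g.mean))\<^sup>2)" by simp
  also have "\<dots> = (\<E> w. (cmin V F w - f.mean)\<^sup>2 - 2 * s * ((?\<Psi> w - g.mean) * (cmin V F w - f.mean)) + s\<^sup>2 * (?\<Psi> w - g.mean)\<^sup>2)"
    by (rule Bochner_Integration.integral_cong) (auto simp: power2_eq_square algebra_simps)
  also have "\<dots> = f.var - 2 * s * ?C + s\<^sup>2 * g.var"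
    using i2 f.sq_int g.sq_int by simp
  finally have "2 * s * ?C - s\<^sup>2 * g.var \<le> f.var" by linarith
  moreover have "2 * s * (card F * c / 2) \<le> 2 * s * ?C" using s cov C by (intro mult_left_mono) auto
  moreover have "s\<^sup>2 * g.var \<le> s\<^sup>2 * (2 * (M + 1) * card F)"
  proof -
    have "g.var \<le> 2 * M * card F" using g.var_le by (simp add: g.m2_def M_def)
    also have "\<dots> \<le> 2 * (M + 1) * card F" using M by (intro mult_right_mono) auto
    finally show ?thesis by (intro mult_left_mono) auto
  qed
  moreover have "2 * s * (card F * c / 2) - s\<^sup>2 * (2 * (M + 1) * card F) = card F * (c\<^sup>2 / (8 * (M + 1)))"
  proof -
    have M1: "M + 1 \<noteq> 0" using M by linarith
    define m where "m = M + 1"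
    have "m \<noteq> 0" using M1 by (simp add: m_def)
    thus ?thesis unfolding s_def m_def[symmetric] by (simp add: power2_eq_square field_simps)
  qed
  ultimately show ?thesis by linarith
qed

end

text \<open>Let \<open>c\<close> be the infimum of the points where the distribution function is
  positive. If no such pair existed, there would be no mass below \<open>c\<close> and none from any
  \<open>x > c\<close> on, hence a point mass at \<open>c\<close>.\<close>

lemma (in iid) spread_exists:
  assumes nonneg: "AE x in \<mu>. 0 \<le> x" and nondeg: "\<And>c. mu.prob {c} < 1"
  shows "\<exists>a b. 0 \<le> a \<and> a < b \<and> 0 < popen a \<and> 0 < mu.prob {b..}"
proof (rule ccontr)
  assume no: "\<not> ?thesis"
  define S where "S = {x. 0 < popen x}"
  have mono: "popen x \<le> popen y" if "x \<le> y" for x y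
    unfolding popen_def by (rule mu.finite_measure_mono) (use that in auto)
  have pos: "0 \<le> x" if "x \<in> S" for x
  proof (rule ccontr)
    assume "\<not> 0 \<le> x"
    hence "AE y in \<mu>. y \<notin> {..x}" using nonneg by (auto elim!: eventually_mono)
    hence "popen x = 0" unfolding popen_def by (subst mu.prob_eq_0) auto
    thus False using that by (simp add: S_def)
  qed
  have ne: "S \<noteq> {}"
  proof
    assume "S = {}"
    hence 0: "popen (real n) = 0" for n using popen_bounds(1)[of "real n"] by (auto simp: S_def less_le)
    have "(\<lambda>n. mu.prob {..real n}) \<longlonglongrightarrow> mu.prob (\<Union>n. {..real n})"
      by (rule mu.finite_Lim_measure_incseq) (auto simp: incseq_def)
    moreover have "(\<Union>n. {..real n}) = UNIV" by (auto intro: real_arch_simple)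
    ultimately have "mu.prob UNIV = 0" using 0 LIMSEQ_unique[OF _ tendsto_const] by (fastforce simp: popen_def)
    thus False using mu.prob_space by simp
  qed
  define c where "c = Inf S"
  have bdd: "bdd_below S" using pos by (auto simp: bdd_below_def)
  have c0: "0 \<le> c" unfolding c_def by (rule cInf_greatest[OF ne pos])
  have below: "popen x = 0" if "x < c" for x
    using that cInf_lower[OF _ bdd, of x] popen_bounds(1)[of x] unfolding c_def S_def by fastforce
  have above: "mu.prob {x..} = 0" if cx: "c < x" for x
  proof -
    \<comment> \<open>\<open>y\<close> and \<open>x\<close> would be such a pair if there were mass
      from \<open>x\<close> on.\<close>
    obtain y where y: "y \<in> S" "y < x" using cx[unfolded c_def] cInf_less_iff[OF ne bdd, of x] by auto
    hence "\<not> 0 < mu.prob {x..}" using no pos[OF y(1)] by (auto simp: S_def)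
    thus ?thesis by (simp add: less_le)
  qed
  have z: "AE x in \<mu>. x \<notin> {..c - 1 / real (Suc n)} \<and> x \<notin> {c + 1 / real (Suc n)..}" for n
  proof -
    have "AE x in \<mu>. x \<notin> {..c - 1 / real (Suc n)}"
      using below[of "c - 1 / real (Suc n)"] unfolding popen_def by (subst mu.prob_eq_0[symmetric]) auto
    moreover have "AE x in \<mu>. x \<notin> {c + 1 / real (Suc n)..}"
      using above[of "c + 1 / real (Suc n)"] by (subst mu.prob_eq_0[symmetric]) auto
    ultimately show ?thesis by (rule AE_conjI)
  qed
  have "AE x in \<mu>. \<forall>n. x \<notin> {..c - 1 / real (Suc n)} \<and> x \<notin> {c + 1 / real (Suc n)..}"
    unfolding AE_all_countable using z by blast
  hence "AE x in \<mu>. x \<in> {c}"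
  proof eventually_elim
    case (elim x)
    have "\<bar>x - c\<bar> \<le> 1 / real (Suc n)" for n using elim[rule_format, of n] by auto
    hence "\<bar>x - c\<bar> \<le> 0 + \<epsilon>" if "0 < \<epsilon>" for \<epsilon>
      using nat_approx_posE[OF that] by (metis add_0 less_imp_le order_trans)
    hence "\<bar>x - c\<bar> \<le> 0" by (rule field_le_epsilon)
    thus ?case by simp
  qed
  hence "mu.prob {c} = 1" by (subst mu.prob_eq_1) auto
  thus False using nondeg[of c] by simp
qed

section \<open>Asymptotics along the sequence of subgraphs\<close>

locale mst_sequence = iid_transitive_graph E \<mu>
  for E :: "'v \<Rightarrow> 'v \<Rightarrow> bool" and \<mu> :: "real measure" +
  fixes Vn :: "nat \<Rightarrow> 'v set" and En :: "nat \<Rightarrow> 'v set set"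
  assumes sub: "is_subgraph E (Vn n) (En n)"
    and fin: "finite (Vn n)"
    and subconn: "connected_on (Vn n) (En n)"
    and grow: "filterlim (\<lambda>n. card (Vn n)) at_top sequentially"
    and thin: "r > 0 \<Longrightarrow> (\<lambda>n. real (card {v \<in> Vn n. \<not> ball_within E v r (Vn n) (En n)}))
          \<in> o(\<lambda>n. real (card (Vn n)))"
    and nonneg: "AE x in \<mu>. x \<ge> 0"
    and nondeg: "mu.prob {c} < 1"
    and mom3: "integrable \<mu> (\<lambda>x. \<bar>x\<bar> ^ 3)"
begin

definition mw :: "nat \<Rightarrow> ('v set \<Rightarrow> real) \<Rightarrow> real" where "mw n = cmin (Vn n) (En n)"

sublocale mw: iid_function \<mu> "En n" "mw n" for n
  unfolding mw_def by (rule iid_function_cmin[OF sub fin subconn mom3])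

definition M2 :: real where "M2 = (\<integral>x. x\<^sup>2 \<partial>\<mu>)"
definition mcard :: "nat \<Rightarrow> real" where "mcard n = real (card (En n))"
definition var :: "nat \<Rightarrow> real" where "var n = (\<E> w. (mw n w - (\<E> w. mw n w))\<^sup>2)"
text \<open>The quantity that has to be of smaller order than \<open>var\<close> in the Stein
  bound.\<close>

definition osc :: "nat \<Rightarrow> real" where "osc n = (\<E> w. \<bar>mw.T n w - var n\<bar>)"

lemma M2_nonneg: "0 \<le> M2" by (simp add: M2_def)

lemma finite_En: "finite (En n)" by (rule finite_subgraph_edges[OF sub fin])

text \<open>A connected graph with two or more vertices has no isolated vertex, so its edges cover
  \<open>Vn n\<close>, two vertices each. With \<open>mcard_le\<close> this makes the number of
  edges an equivalent scale.\<close>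

lemma card_V_le:
  assumes "2 \<le> card (Vn n)"
  shows "card (Vn n) \<le> 2 * card (En n)"
proof -
  have "Vn n \<subseteq> \<Union> (En n)"
  proof
    fix u assume u: "u \<in> Vn n"
    have "\<not> Vn n \<subseteq> {u}" using assms card_mono[of "{u}" "Vn n"] by auto
    then obtain v where v: "v \<in> Vn n" "v \<noteq> u" by auto
    have "(adj (Vn n) (En n))\<^sup>*\<^sup>* u v" using subconn u v by (auto simp: connected_on_def)
    then obtain z where "adj (Vn n) (En n) u z" using v(2) by (cases rule: converse_rtranclpE) auto
    thus "u \<in> \<Union> (En n)" by (auto simp: adj_def)
  qed
  moreover have fin2: "finite e \<and> card e = 2" if "e \<in> En n" for e
    using subgraph_edgeE[OF sub that] by (metis card_2_iff finite.emptyI finite.insertI)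
  ultimately have "card (Vn n) \<le> card (\<Union> (En n))"
    using finite_En by (intro card_mono) auto
  also have "\<dots> \<le> (\<Sum>e\<in>En n. card e)" by (rule card_Union_le_sum_card)
  also have "\<dots> = 2 * card (En n)" using fin2 by simp
  finally show ?thesis .
qed

lemma eventually_card_V_le: "eventually (\<lambda>n. real (card (Vn n)) \<le> 2 * mcard n) sequentially"
proof -
  have "eventually (\<lambda>n. 2 \<le> card (Vn n)) sequentially"
    using grow unfolding filterlim_at_top by blast
  thus ?thesis
  proof eventually_elim
    case (elim n)
    show ?case using of_nat_mono[OF card_V_le[OF elim], where 'a=real] by (simp add: mcard_def)
  qed
qed

lemma mcard_le: "mcard n \<le> deg * real (card (Vn n))"
  using of_nat_mono[OF card_subgraph_edges[OF sub fin], where 'a=real] by (simp add: mcard_def)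

lemma mcard_at_top: "filterlim mcard at_top sequentially"
proof (subst filterlim_at_top, intro allI)
  fix Z :: real
  have "eventually (\<lambda>n. nat \<lceil>2 * Z\<rceil> \<le> card (Vn n)) sequentially"
    using grow unfolding filterlim_at_top by blast
  with eventually_card_V_le show "eventually (\<lambda>n. Z \<le> mcard n) sequentially"
  proof eventually_elim
    case (elim n)
    have "2 * Z \<le> real (nat \<lceil>2 * Z\<rceil>)" by linarith
    also have "\<dots> \<le> real (card (Vn n))" using elim by simp
    finally show ?case using elim by linarith
  qed
qed

lemma var_lower: "\<exists>c>0. \<forall>n. c * mcard n \<le> var n"
proof -
  obtain a b where ab: "0 \<le> a" "a < b" "0 < popen a" "0 < mu.prob {b..}"
    using spread_exists[OF nonneg nondeg] by blast
  define c where "c = ((b - a)\<^sup>2 * (popen a * mu.prob {b..} ^ (deg + 1)))\<^sup>2 / (8 * (M2 + 1))"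
  have "0 < c" unfolding c_def using ab M2_nonneg by (auto intro!: divide_pos_pos mult_pos_pos)
  moreover have "c * mcard n \<le> var n" for n
    using cmin_variance_lower[OF sub fin subconn mom3 ab(1,2)]
    by (simp add: c_def M2_def mcard_def var_def mw_def mult.commute)
  ultimately show ?thesis by blast
qed

lemma var_upper: "var n \<le> 2 * M2 * mcard n"
  using mw.var_le[of n] by (simp add: var_def M2_def mcard_def mw.m2_def)

text \<open>\<open>T_concentration\<close> with the local approximation at edges whose ball lies in
  the subgraph. At the other edges 0 is the approximation and the Lipschitz bound gives the error
  \<open>\<bar>w e\<bar>\<close>; there are at most \<open>deg * card bad\<close> of them.\<close>

lemma osc_le:
  fixes \<eta> \<epsilon> \<alpha> \<kappa> :: real and n r :: nat
  assumes \<eta>: "0 < \<eta>" and r: "1 \<le> r" and arm: "\<And>j u. j < J \<Longrightarrow> arm_prob (real j * \<eta>) r u \<le> \<epsilon>"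
    and pos: "0 < \<alpha>" "0 < \<kappa>"
  defines "bad \<equiv> {v \<in> Vn n. \<not> ball_within E v (real r) (Vn n) (En n)}"
  shows "osc n \<le> 4 * \<alpha> * M2 * mcard n
    + 4 * (mcard n * (3 * (\<eta>\<^sup>2 + (\<integral>x. (max 0 (x - real J * \<eta>))\<^sup>2 \<partial>\<mu>) + (real J * \<eta>)\<^sup>2 * \<epsilon>)) + deg * real (card bad) * M2) * (1 + 1 / \<alpha>)
    + \<kappa> / 2 + mcard n * (deg * vol (2 * r)) * (real J * \<eta>) ^ 4 / (2 * \<kappa>)"
proof -
  let ?K = "real J * \<eta>"
  let ?B = "3 * (\<eta>\<^sup>2 + (\<integral>x. (max 0 (x - ?K))\<^sup>2 \<partial>\<mu>) + ?K\<^sup>2 * \<epsilon>)"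
  have m2: "integrable \<mu> (\<lambda>x. x\<^sup>2)" by (rule second_moment[OF mom3])
  define good where "good e \<longleftrightarrow> ball_within E (src e) (real r) (Vn n) (En n)" for e
  define D where "D e = (if good e then local_min \<eta> J r e else (\<lambda>_. 0))" for e
  define \<rho> where "\<rho> e = (if good e then local_err \<eta> J r e else (\<lambda>w. \<bar>w e\<bar>))" for e
  have Eg: "En n \<subseteq> gedges E" using sub by (auto simp: is_subgraph_def)
  have Esrc: "src e \<in> Vn n" if "e \<in> En n" for e
    using src_dst(1)[of e] Eg sub[of n] that unfolding is_subgraph_def by blast
  have err: "integrable Lam (\<lambda>w. (local_err \<eta> J r e w)\<^sup>2)" "(\<E> w. (local_err \<eta> J r e w)\<^sup>2) \<le> ?B"
    if "e \<in> En n" for e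
    using local_err_sq[OF m2 \<eta> subsetD[OF Eg that], of J r \<epsilon>] arm by auto
  have B: "0 \<le> ?B" if "e \<in> En n" for e
    by (rule order_trans[OF _ err(2)[OF that]]) simp
  have sumR: "(\<Sum>e\<in>En n. \<E> w. (\<rho> e w)\<^sup>2) \<le> mcard n * ?B + deg * real (card bad) * M2"
  proof -
    have "(\<Sum>e\<in>En n. \<E> w. (\<rho> e w)\<^sup>2) \<le> (\<Sum>e\<in>En n. ?B + of_bool (\<not> good e) * M2)"
    proof (rule sum_mono)
      fix e assume e: "e \<in> En n"
      show "(\<E> w. (\<rho> e w)\<^sup>2) \<le> ?B + of_bool (\<not> good e) * M2"
      proof (cases "good e")
        case True
        thus ?thesis using err(2)[OF e] by (simp add: \<rho>_def)
      next
        case False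
        have "(\<E> w. (w e)\<^sup>2) = M2" unfolding M2_def by (rule integral_coord) simp
        thus ?thesis using False B[OF e] by (simp add: \<rho>_def)
      qed
    qed
    also have "\<dots> = mcard n * ?B + real (card {e \<in> En n. \<not> good e}) * M2"
      using finite_En by (simp add: sum.distrib mcard_def sum_distrib_right[symmetric] Int_def)
    also have "real (card {e \<in> En n. \<not> good e}) \<le> deg * real (card bad)"
    proof -
      have "card {e \<in> En n. \<not> good e} \<le> deg * card bad"
      proof (rule card_edges_by_src)
        show "finite bad" using fin by (simp add: bad_def)
        show "{e \<in> En n. \<not> good e} \<subseteq> gedges E" using Eg by blast
        show "\<And>e. e \<in> {e \<in> En n. \<not> good e} \<Longrightarrow> src e \<in> bad"
          using Esrc by (auto simp: good_def bad_def)
      qed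
      thus ?thesis by (metis of_nat_mono of_nat_mult)
    qed
    finally show ?thesis using M2_nonneg by (simp add: mult_right_mono)
  qed
  have "(\<E> w. \<bar>mw.T n w - mw.var n\<bar>) \<le>
    4 * \<alpha> * mw.m2 * card (En n) + 4 * (mcard n * ?B + deg * real (card bad) * M2) * (1 + 1 / \<alpha>)
      + \<kappa> / 2 + card (En n) * (deg * vol (2 * r)) * ?K ^ 4 / (2 * \<kappa>)"
  proof (rule mw.T_concentration[where D=D and \<rho>=\<rho> and N="\<lambda>e. insert e (balle (src e) r)"])
    show "D e \<in> borel_measurable Lam" "\<rho> e \<in> borel_measurable Lam" for e
      unfolding D_def \<rho>_def by auto
    show "dep_on (insert e (balle (src e) r)) (D e)" for e
      unfolding D_def using dep_on_local_min by (auto simp: dep_on_def)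
    show "0 \<le> D e w" "D e w \<le> ?K" for e w
      unfolding D_def using local_min_bounds[of \<eta>] \<eta> by auto
    show "integrable Lam (\<lambda>w. (\<rho> e w)\<^sup>2)" if "e \<in> En n" for e
      unfolding \<rho>_def using err(1)[OF that] integrable_coord[OF m2, of e] by auto
    show "AE x in \<mu>. 0 \<le> x" by (rule nonneg)
    show "card {e' \<in> En n. insert e (balle (src e) r) \<inter> insert e' (balle (src e') r) \<noteq> {}} \<le> deg * vol (2 * r)"
      if "e \<in> En n" for e by (rule card_overlap[OF Eg that r])
    show "\<bar>mw n (w(e := x)) - mw n (w(e := y)) - (D e (w(e := x)) - D e (w(e := y)))\<bar> \<le> \<rho> e (w(e := x)) + \<rho> e (w(e := y))"
      if e: "e \<in> En n" and xy: "0 \<le> x" "0 \<le> y" for e w x y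
    proof (cases "good e")
      case True
      thus ?thesis
        using local_approximation[OF sub fin subconn e _ r \<eta> xy, of w J] by (simp add: mw_def D_def \<rho>_def good_def)
    next
      case False
      have "\<bar>mw n ((w(e := y))(e := x)) - mw n (w(e := y))\<bar> \<le> \<bar>x - (w(e := y)) e\<bar>" by (rule mw.f_lip)
      thus ?thesis using False xy by (simp add: D_def \<rho>_def)
    qed
  qed (use pos sumR in auto)
  thus ?thesis by (simp add: osc_def var_def M2_def mcard_def mw.m2_def)
qed

lemma tail_small:
  assumes "0 < \<epsilon>"
  shows "\<exists>k::nat. 1 \<le> k \<and> (\<integral>x. (max 0 (x - real k))\<^sup>2 \<partial>\<mu>) \<le> \<epsilon>"
proof -
  have "(\<lambda>k. \<integral>x. (max 0 (x - real k))\<^sup>2 \<partial>\<mu>) \<longlonglongrightarrow> (\<integral>x. 0 \<partial>\<mu>)"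
  proof (rule integral_dominated_convergence[where w="\<lambda>x. x\<^sup>2"])
    show "integrable \<mu> (\<lambda>x. x\<^sup>2)" by (rule second_moment[OF mom3])
    show "AE x in \<mu>. (\<lambda>k. (max 0 (x - real k))\<^sup>2) \<longlonglongrightarrow> 0"
    proof (rule AE_I2)
      fix x :: real
      obtain N :: nat where N: "x \<le> real N" using real_arch_simple by blast
      have "eventually (\<lambda>k. (max 0 (x - real k))\<^sup>2 = 0) sequentially"
        using eventually_ge_at_top[of N] by eventually_elim (use N in auto)
      thus "(\<lambda>k. (max 0 (x - real k))\<^sup>2) \<longlonglongrightarrow> 0" by (rule tendsto_eventually)
    qed
    show "AE x in \<mu>. norm ((max 0 (x - real k))\<^sup>2) \<le> x\<^sup>2" for k
    proof (rule AE_I2)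
      fix x :: real
      show "norm ((max 0 (x - real k))\<^sup>2) \<le> x\<^sup>2"
        by (cases "x \<le> real k") (auto simp: max_def intro!: power_mono)
    qed
  qed (simp_all cong: measurable_cong_sets)
  hence "eventually (\<lambda>k. (\<integral>x. (max 0 (x - real k))\<^sup>2 \<partial>\<mu>) < \<epsilon>) sequentially"
    using order_tendstoD(2)[OF _ assms] by simp
  then obtain K where "\<And>k. K \<le> k \<Longrightarrow> (\<integral>x. (max 0 (x - real k))\<^sup>2 \<partial>\<mu>) < \<epsilon>"
    unfolding eventually_sequentially by blast
  thus ?thesis by (intro exI[of _ "max 1 K"]) (auto intro: less_imp_le)
qed

text \<open>Order of choices: \<open>\<alpha>\<close>, the height \<open>k\<close>, the mesh, the
  arm tolerance \<open>\<epsilon>'\<close>, the radius, and only then \<open>n\<close>. Of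
  \<open>\<epsilon> * mcard n\<close>, one fifth goes to the \<open>\<alpha>\<close>-term, two
  fifths to the local errors and one fifth to each \<open>\<kappa>\<close>-term.\<close>

lemma osc_small:
  assumes \<epsilon>: "0 < \<epsilon>"
  shows "eventually (\<lambda>n. osc n \<le> \<epsilon> * mcard n) sequentially"
proof -
  define \<alpha> where "\<alpha> = \<epsilon> / (20 * (M2 + 1))"
  have \<alpha>: "0 < \<alpha>" using \<epsilon> M2_nonneg by (simp add: \<alpha>_def add_nonneg_pos)
  have \<alpha>M: "4 * \<alpha> * M2 \<le> \<epsilon> / 5"
  proof -
    have "4 * \<alpha> * M2 \<le> 4 * \<alpha> * (M2 + 1)" using \<alpha> by simp
    also have "\<dots> = \<epsilon> / 5" using M2_nonneg by (simp add: \<alpha>_def field_simps add_nonneg_pos)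
    finally show ?thesis .
  qed
  \<comment> \<open>Half of \<open>\<delta>\<close> is for good edges, as three contributions of
    \<open>\<delta> / 18\<close> times the 3 of \<open>local_err_sq\<close>, and half for bad
    ones.\<close>
  define \<delta> where "\<delta> = \<epsilon> / (10 * (1 + 1 / \<alpha>))"
  have a1: "0 < 1 + 1 / \<alpha>" using \<alpha> by (simp add: add_pos_pos)
  have \<delta>: "0 < \<delta>" unfolding \<delta>_def using \<epsilon> a1 by (intro divide_pos_pos mult_pos_pos) auto
  have \<delta>\<alpha>: "\<delta> * (1 + 1 / \<alpha>) = \<epsilon> / 10" unfolding \<delta>_def using a1 by (simp add: field_simps)
  obtain k :: nat where k: "1 \<le> k" "(\<integral>x. (max 0 (x - real k))\<^sup>2 \<partial>\<mu>) \<le> \<delta> / 18"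
    using tail_small[of "\<delta> / 18"] \<delta> by auto
  obtain J :: nat where J: "real k / sqrt (\<delta> / 18) < real J" using reals_Archimedean2 by blast
  have J0: "0 < real J" by (rule le_less_trans[OF _ J]) (use \<delta> in simp)
  \<comment> \<open>\<open>real J * \<eta>\<close> is exactly the height \<open>k\<close>, and
    \<open>J\<close> was taken large enough for the mesh.\<close>
  define \<eta> where "\<eta> = real k / real J"
  have \<eta>: "0 < \<eta>" "real J * \<eta> = k" using k J0 by (auto simp: \<eta>_def)
  have \<eta>2: "\<eta>\<^sup>2 \<le> \<delta> / 18"
  proof -
    have "\<eta> \<le> sqrt (\<delta> / 18)" using J J0 \<delta> unfolding \<eta>_def
      by (simp add: pos_divide_less_eq pos_divide_le_eq mult.commute less_imp_le)
    hence "\<eta>\<^sup>2 \<le> (sqrt (\<delta> / 18))\<^sup>2" using \<eta> by (intro power_mono) auto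
    thus ?thesis using \<delta> by simp
  qed
  define \<epsilon>' where "\<epsilon>' = \<delta> / (18 * ((real k)\<^sup>2 + 1))"
  have \<epsilon>': "0 < \<epsilon>'" using \<delta> by (simp add: \<epsilon>'_def add_nonneg_pos)
  have k\<epsilon>: "(real k)\<^sup>2 * \<epsilon>' \<le> \<delta> / 18"
  proof -
    have "(real k)\<^sup>2 * \<epsilon>' \<le> ((real k)\<^sup>2 + 1) * \<epsilon>'" using \<epsilon>' by (intro mult_right_mono) auto
    also have "((real k)\<^sup>2 + 1) * \<epsilon>' = \<delta> / 18"
      using zero_le_power2[of "real k"] unfolding \<epsilon>'_def by (simp add: field_simps add_nonneg_eq_0_iff)
    finally show ?thesis .
  qed
  have "\<exists>r0. \<forall>r\<ge>r0. \<forall>u. arm_prob (real j * \<eta>) r u \<le> \<epsilon>'" for j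
    by (rule arm_prob_small[OF sub fin grow _ \<epsilon>']) (use thin[of 1] in \<open>simp add: bdry_def\<close>)
  then obtain r0 where r0: "\<And>j r u. r0 j \<le> r \<Longrightarrow> arm_prob (real j * \<eta>) r u \<le> \<epsilon>'" by metis
  \<comment> \<open>The sum dominates every \<open>r0 j\<close>, so one radius serves all
    \<open>J\<close> levels; the 1 gives \<open>1 \<le> r\<close>.\<close>
  define r where "r = 1 + (\<Sum>j<J. r0 j)"
  have r: "1 \<le> r" by (simp add: r_def)
  have arm: "arm_prob (real j * \<eta>) r u \<le> \<epsilon>'" if "j < J" for j u
    by (rule r0) (use that member_le_sum[of j "{..<J}" r0] in \<open>auto simp: r_def\<close>)
  define bad where "bad n = {v \<in> Vn n. \<not> ball_within E v (real r) (Vn n) (En n)}" for n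
  define \<gamma> where "\<gamma> = \<delta> / (4 * (real deg + 1) * (M2 + 1))"
  have \<gamma>: "0 < \<gamma>" using \<delta> M2_nonneg by (simp add: \<gamma>_def add_nonneg_pos)
  have \<gamma>b: "deg * (\<gamma> * 2) * M2 \<le> \<delta> / 2"
  proof -
    have "deg * (\<gamma> * 2) * M2 \<le> (real deg + 1) * (\<gamma> * 2) * (M2 + 1)"
      using \<gamma> M2_nonneg by (intro mult_mono) auto
    also have "\<dots> = \<delta> / 2" using M2_nonneg by (simp add: \<gamma>_def field_simps add_nonneg_eq_0_iff)
    finally show ?thesis .
  qed
  let ?L = "real deg * real (vol (2 * r)) * real k ^ 4"
  have e1: "eventually (\<lambda>n. real (card (bad n)) \<le> \<gamma> * real (card (Vn n))) sequentially"
    using landau_o.smallD[OF thin[of "real r"] \<gamma>] r by (simp add: bad_def)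
  have e2: "eventually (\<lambda>n. max 1 (25 * ?L / (4 * \<epsilon>\<^sup>2)) \<le> mcard n) sequentially"
    using mcard_at_top unfolding filterlim_at_top by blast
  show ?thesis using e1 e2 eventually_card_V_le
  proof eventually_elim
    case (elim n)
    define m where "m = mcard n"
    have m: "1 \<le> m" "25 * ?L / (4 * \<epsilon>\<^sup>2) \<le> m" using elim(2) by (auto simp: m_def)
    \<comment> \<open>Proportional to \<open>m\<close>: the first \<open>\<kappa>\<close>-term is
      then a fifth of the budget, and the second stays bounded while \<open>m\<close> grows.\<close>
    define \<kappa> where "\<kappa> = 2 * \<epsilon> / 5 * m"
    have \<kappa>: "0 < \<kappa>" using \<epsilon> m by (simp add: \<kappa>_def)
    have cb: "real (card (bad n)) \<le> \<gamma> * 2 * m"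
      using order_trans[OF elim(1) mult_left_mono[OF elim(3), of \<gamma>]] \<gamma> by (simp add: m_def mult_ac)
    have R: "m * (3 * (\<eta>\<^sup>2 + (\<integral>x. (max 0 (x - real k))\<^sup>2 \<partial>\<mu>) + (real k)\<^sup>2 * \<epsilon>')) + deg * real (card (bad n)) * M2 \<le> \<delta> * m"
    proof -
      have "m * (3 * (\<eta>\<^sup>2 + (\<integral>x. (max 0 (x - real k))\<^sup>2 \<partial>\<mu>) + (real k)\<^sup>2 * \<epsilon>')) \<le> m * (\<delta> / 2)"
        using \<eta>2 k(2) k\<epsilon> m by (intro mult_left_mono) auto
      moreover have "deg * real (card (bad n)) * M2 \<le> deg * (\<gamma> * 2 * m) * M2"
        using cb M2_nonneg by (intro mult_right_mono mult_left_mono) auto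
      moreover have "deg * (\<gamma> * 2 * m) * M2 \<le> \<delta> / 2 * m"
        using mult_right_mono[OF \<gamma>b, of m] m by (simp add: mult_ac)
      ultimately show ?thesis by (simp add: algebra_simps)
    qed
    have "osc n \<le> 4 * \<alpha> * M2 * m
      + 4 * (m * (3 * (\<eta>\<^sup>2 + (\<integral>x. (max 0 (x - real k))\<^sup>2 \<partial>\<mu>) + (real k)\<^sup>2 * \<epsilon>')) + deg * real (card (bad n)) * M2) * (1 + 1 / \<alpha>)
      + \<kappa> / 2 + m * (deg * vol (2 * r)) * real k ^ 4 / (2 * \<kappa>)"
      using osc_le[where J=J and n=n, OF \<eta>(1) r arm \<alpha> \<kappa>] unfolding \<eta>(2) m_def bad_def by simp
    also have "\<dots> \<le> \<epsilon> / 5 * m + 4 * (\<delta> * m) * (1 + 1 / \<alpha>) + \<kappa> / 2 + \<epsilon> / 5 * m"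
    proof (intro add_mono mult_right_mono mult_left_mono \<alpha>M R)
      have "m * (deg * vol (2 * r)) * real k ^ 4 / (2 * \<kappa>) = 5 * ?L / (4 * \<epsilon>)"
        using m \<epsilon> by (simp add: \<kappa>_def field_simps)
      also have "\<dots> = \<epsilon> / 5 * (25 * ?L / (4 * \<epsilon>\<^sup>2))" using \<epsilon> by (simp add: field_simps power2_eq_square)
      also have "\<dots> \<le> \<epsilon> / 5 * m" using \<epsilon> by (intro mult_left_mono m) auto
      finally show "m * (deg * vol (2 * r)) * real k ^ 4 / (2 * \<kappa>) \<le> \<epsilon> / 5 * m" .
    qed (use m a1 in auto)
    also have "4 * (\<delta> * m) * (1 + 1 / \<alpha>) = 4 * m * (\<delta> * (1 + 1 / \<alpha>))" by (simp add: mult_ac)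
    also have "\<dots> = 2 * \<epsilon> / 5 * m" unfolding \<delta>\<alpha> by simp
    also have "\<epsilon> / 5 * m + 2 * \<epsilon> / 5 * m + \<kappa> / 2 + \<epsilon> / 5 * m = \<epsilon> * m" by (simp add: \<kappa>_def algebra_simps)
    finally show ?case by (simp add: m_def)
  qed
qed

lemma osc_tendsto: "(\<lambda>n. osc n / mcard n) \<longlonglongrightarrow> 0"
proof (rule LIMSEQ_I)
  fix \<epsilon> :: real assume \<epsilon>: "0 < \<epsilon>"
  have "eventually (\<lambda>n. osc n \<le> \<epsilon> / 2 * mcard n) sequentially" by (rule osc_small) (use \<epsilon> in simp)
  moreover have "eventually (\<lambda>n. 1 \<le> mcard n) sequentially" using mcard_at_top by (simp add: filterlim_at_top)
  ultimately have "eventually (\<lambda>n. norm (osc n / mcard n - 0) < \<epsilon>) sequentially"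
  proof eventually_elim
    case (elim n)
    have "0 \<le> osc n" by (simp add: osc_def)
    hence "\<bar>osc n / mcard n\<bar> \<le> \<epsilon> / 2" using elim by (simp add: pos_divide_le_eq)
    thus ?case using \<epsilon> unfolding diff_0_right real_norm_def by linarith
  qed
  thus "\<exists>n0. \<forall>n\<ge>n0. norm (osc n / mcard n - 0) < \<epsilon>" by (simp add: eventually_sequentially)
qed

lemma variance_bigtheta: "var \<in> \<Theta>(\<lambda>n. real (card (Vn n)))"
proof -
  obtain c where c: "c > 0" "\<And>n. c * mcard n \<le> var n" using var_lower by blast
  have v0: "0 \<le> var n" for n by (simp add: var_def)
  have "var \<in> O(\<lambda>n. real (card (Vn n)))"
  proof (rule bigoI[of _ "2 * M2 * deg"], rule always_eventually, rule allI)
    fix n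
    have "var n \<le> 2 * M2 * (deg * real (card (Vn n)))"
      by (rule order_trans[OF var_upper mult_left_mono[OF mcard_le]]) (use M2_nonneg in auto)
    thus "norm (var n) \<le> 2 * M2 * deg * norm (real (card (Vn n)))" using v0 by (simp add: mult_ac)
  qed
  moreover have "(\<lambda>n. real (card (Vn n))) \<in> O(var)"
  proof (rule bigoI[of _ "2 / c"])
    show "eventually (\<lambda>n. norm (real (card (Vn n))) \<le> 2 / c * norm (var n)) sequentially"
      using eventually_card_V_le
    proof eventually_elim
      case (elim n)
      have "mcard n \<le> var n / c" using c by (simp add: pos_le_divide_eq mult.commute)
      thus ?case using elim v0[of n] by simp
    qed
  qed
  ultimately show ?thesis by (simp add: bigthetaI' bigtheta_def bigomega_iff_bigo)
qed

section \<open>Convergence of characteristic functions\<close>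

definition stdz :: "nat \<Rightarrow> ('v set \<Rightarrow> real) \<Rightarrow> real" where
  "stdz n w = (mw n w - (\<E> w. mw n w)) / sqrt (var n)"

lemma measurable_stdz [measurable]: "stdz n \<in> borel_measurable Lam"
  unfolding stdz_def[abs_def] by measurable

text \<open>The Stein bound is a defect of the form required by \<open>gaussian_comparison\<close>,
  whose \<open>\<delta>\<close> is the sum of the third-moment term and
  \<open>osc n / var n\<close>.\<close>

lemma char_bound:
  assumes v: "0 < var n"
  shows "cmod (char (distr Lam borel (stdz n)) t - complex_of_real (exp (- (t\<^sup>2) / 2)))
    \<le> \<bar>t\<bar> * ((2 * mcard n * mw.m3 / (sqrt (var n)) ^ 3 + osc n / var n) * (t\<^sup>2 + \<bar>t\<bar>))"
proof -
  define s where "s = sqrt (var n)"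
  have s: "s > 0" "s\<^sup>2 = mw.var n" using v by (auto simp: s_def var_def)
  have S: "stdz n w = (mw n w - mw.mean n) / s" for w by (simp add: stdz_def s_def)
  have S2: "integrable Lam (\<lambda>w. (stdz n w)\<^sup>2)"
    unfolding S power_divide using mw.sq_int by auto
  let ?\<phi> = "\<lambda>t. \<E> w. iexp (t * stdz n w)" and ?\<phi>' = "\<lambda>t. \<E> w. \<i> * stdz n w * iexp (t * stdz n w)"
  have "char (distr Lam borel (stdz n)) t = ?\<phi> t"
    unfolding char_def by (subst integral_distr) auto
  moreover have "cmod (?\<phi> t - complex_of_real (exp (- (t\<^sup>2) / 2)))
    \<le> \<bar>t\<bar> * ((2 * mcard n * mw.m3 / s ^ 3 + osc n / var n) * (t\<^sup>2 + \<bar>t\<bar>))"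
  proof (rule gaussian_comparison[where \<phi>'="?\<phi>'"])
    show "(?\<phi> has_vector_derivative ?\<phi>' t) (at t)" for t
      by (rule Lam.expectation_iexp_has_vector_derivative) (use S2 in auto)
    have nn: "0 \<le> 2 * mcard n * mw.m3 / s ^ 3" "0 \<le> osc n / var n"
      using s v mw.m3_nonneg by (auto simp: mcard_def osc_def)
    thus "0 \<le> 2 * mcard n * mw.m3 / s ^ 3 + osc n / var n" by simp
    fix t :: real
    have "cmod (?\<phi>' t + t * ?\<phi> t) \<le> 2 * t\<^sup>2 * card (En n) * mw.m3 / s ^ 3 + \<bar>t\<bar> * osc n / var n"
      using mw.stein_bound[OF s, of t] unfolding S osc_def var_def .
    also have "\<dots> = (2 * mcard n * mw.m3 / s ^ 3) * t\<^sup>2 + (osc n / var n) * \<bar>t\<bar>"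
      by (simp add: mcard_def mult_ac)
    also have "\<dots> \<le> (2 * mcard n * mw.m3 / s ^ 3) * (t\<^sup>2 + \<bar>t\<bar>) + (osc n / var n) * (t\<^sup>2 + \<bar>t\<bar>)"
      using nn by (intro add_mono mult_left_mono) auto
    finally show "cmod (?\<phi>' t + t * ?\<phi> t) \<le> (2 * mcard n * mw.m3 / s ^ 3 + osc n / var n) * (t\<^sup>2 + \<bar>t\<bar>)"
      by (simp add: distrib_right)
  qed simp
  ultimately show ?thesis by (simp add: s_def)
qed

text \<open>As \<open>var n\<close> is at least a multiple of \<open>mcard n\<close>, the
  third-moment term is at most of order \<open>1 / sqrt (mcard n)\<close> and the other at most a
  multiple of \<open>osc n / mcard n\<close>.\<close>

lemma char_tendsto:
  "(\<lambda>n. char (distr Lam borel (stdz n)) t) \<longlonglongrightarrow> complex_of_real (exp (- (t\<^sup>2) / 2))"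
proof -
  obtain c where c: "c > 0" "\<And>n. c * mcard n \<le> var n" using var_lower by blast
  define b where "b n = \<bar>t\<bar> * ((2 * mw.m3 / (c * sqrt (c * mcard n)) + osc n / mcard n / c) * (t\<^sup>2 + \<bar>t\<bar>))" for n
  have "filterlim (\<lambda>n. sqrt (c * mcard n)) at_top sequentially"
    by (intro filterlim_compose[OF sqrt_at_top] filterlim_tendsto_pos_mult_at_top[OF tendsto_const c(1) mcard_at_top])
  hence "filterlim (\<lambda>n. c * sqrt (c * mcard n)) at_top sequentially"
    by (rule filterlim_tendsto_pos_mult_at_top[OF tendsto_const c(1)])
  hence "(\<lambda>n. 2 * mw.m3 / (c * sqrt (c * mcard n))) \<longlonglongrightarrow> 0"
    by (rule real_tendsto_divide_at_top[OF tendsto_const])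
  hence "b \<longlonglongrightarrow> \<bar>t\<bar> * ((0 + 0 / c) * (t\<^sup>2 + \<bar>t\<bar>))"
    unfolding b_def by (intro tendsto_intros osc_tendsto) (use c in auto)
  hence b0: "b \<longlonglongrightarrow> 0" by simp
  have "eventually (\<lambda>n. 1 \<le> mcard n) sequentially" using mcard_at_top by (simp add: filterlim_at_top)
  hence "eventually (\<lambda>n. norm (char (distr Lam borel (stdz n)) t - complex_of_real (exp (- (t\<^sup>2) / 2))) \<le> b n) sequentially"
  proof eventually_elim
    case (elim n)
    have cm: "0 < c * mcard n" using c elim by simp
    hence v: "0 < var n" using c(2)[of n] by linarith
    have 1: "2 * mcard n * mw.m3 / (sqrt (var n)) ^ 3 \<le> 2 * mw.m3 / (c * sqrt (c * mcard n))"
    proof -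
      have "c * mcard n * sqrt (c * mcard n) \<le> var n * sqrt (var n)"
        using c cm v by (intro mult_mono real_sqrt_le_mono) auto
      also have "\<dots> = (sqrt (var n)) ^ 3" using v by (simp add: power3_eq_cube)
      finally have "2 * mcard n * mw.m3 / (sqrt (var n)) ^ 3 \<le> 2 * mcard n * mw.m3 / (c * mcard n * sqrt (c * mcard n))"
        using cm elim c mw.m3_nonneg by (intro divide_left_mono mult_pos_pos) (auto intro!: mult_nonneg_nonneg mult_pos_pos zero_less_power v)
      also have "\<dots> = 2 * mw.m3 / (c * sqrt (c * mcard n))" using elim by (simp add: field_simps)
      finally show ?thesis .
    qed
    have 2: "osc n / var n \<le> osc n / mcard n / c"
    proof -
      have "osc n / var n \<le> osc n / (c * mcard n)"
        using c cm v by (intro divide_left_mono) (auto simp: osc_def)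
      thus ?thesis by (simp add: mult.commute)
    qed
    show ?case unfolding b_def
      by (rule order_trans[OF char_bound[OF v]]) (intro mult_left_mono mult_right_mono add_mono 1 2, auto)
  qed
  hence "(\<lambda>n. char (distr Lam borel (stdz n)) t - complex_of_real (exp (- (t\<^sup>2) / 2))) \<longlonglongrightarrow> 0"
    using b0 by (rule Lim_null_comparison)
  thus ?thesis by (simp add: LIM_zero_iff)
qed

lemma stdz_weak_conv: "weak_conv_m (\<lambda>n. distr Lam borel (stdz n)) std_normal_distribution"
proof (rule levy_continuity)
  show "real_distribution (distr Lam borel (stdz n))" for n
    by (rule Lam.real_distribution_distr) simp
  show "real_distribution std_normal_distribution" by (rule real_dist_normal_dist)
  show "(\<lambda>n. char (distr Lam borel (stdz n)) t) \<longlonglongrightarrow> char std_normal_distribution t" for t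
    using char_tendsto[of t] by (simp add: char_std_normal_distribution)
qed

end

section \<open>The central limit theorem\<close>

text \<open>\<open>W\<close> is iid on \<open>G\<close> only. Restricted to \<open>G\<close>, both
  \<open>W\<close> and the canonical coordinates have the product law \<open>Q\<close>, and
  \<open>h\<close> factors through the restriction once the other coordinates are filled with
  0.\<close>

lemma (in iid) distr_iid_family:
  fixes W :: "'i \<Rightarrow> 'w \<Rightarrow> real" and h :: "('i \<Rightarrow> real) \<Rightarrow> real"
  assumes P: "prob_space P" and ind: "prob_space.indep_vars P (\<lambda>_. borel) W G"
    and ident: "\<And>e. e \<in> G \<Longrightarrow> distr P borel (W e) = \<mu>" and G: "G \<noteq> {}"
    and h: "h \<in> borel_measurable Lam" and dep: "dep_on G h"
  shows "(\<lambda>\<omega>. h (\<lambda>e. W e \<omega>)) \<in> borel_measurable P"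
    and "distr P borel (\<lambda>\<omega>. h (\<lambda>e. W e \<omega>)) = distr Lam borel h"
proof -
  interpret P: prob_space P by (rule P)
  define Q where "Q = Pi\<^sub>M G (\<lambda>_. \<mu>)"
  define ext where "ext x = (\<lambda>e. if e \<in> G then x e else 0)" for x :: "'i \<Rightarrow> real"
  have rv: "W e \<in> borel_measurable P" if "e \<in> G" for e
    using ind that by (auto simp: P.indep_vars_def2)
  have ext: "ext \<in> Q \<rightarrow>\<^sub>M Lam"
  proof (rule measurable_into_Lam)
    fix e show "(\<lambda>x. ext x e) \<in> borel_measurable Q"
    proof (cases "e \<in> G")
      case True
      have "(\<lambda>x. x e) \<in> Q \<rightarrow>\<^sub>M \<mu>" unfolding Q_def using True by (rule measurable_component_singleton)
      thus ?thesis using True by (simp add: ext_def cong: measurable_cong_sets)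
    qed (simp add: ext_def)
  qed
  have hext: "h \<circ> ext \<in> borel_measurable Q" by (rule measurable_comp[OF ext h])
  have sQ: "sets Q = sets (Pi\<^sub>M G (\<lambda>_. borel))" unfolding Q_def by (rule sets_PiM_cong) simp_all
  have mW: "(\<lambda>\<omega>. \<lambda>e\<in>G. W e \<omega>) \<in> P \<rightarrow>\<^sub>M Q"
    unfolding Q_def by (rule measurable_restrict) (use rv in \<open>simp cong: measurable_cong_sets\<close>)
  have dW: "distr P Q (\<lambda>\<omega>. \<lambda>e\<in>G. W e \<omega>) = Q"
  proof -
    have "distr P (Pi\<^sub>M G (\<lambda>_. borel)) (\<lambda>\<omega>. \<lambda>e\<in>G. W e \<omega>) = Pi\<^sub>M G (\<lambda>e. distr P borel (W e))"
      using ind G rv by (subst (asm) P.indep_vars_iff_distr_eq_PiM') auto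
    also have "\<dots> = Q" unfolding Q_def by (rule PiM_cong) (use ident in auto)
    finally show ?thesis using distr_cong[OF refl sQ, of P] by simp
  qed
  have mR: "(\<lambda>w. \<lambda>e\<in>G. w e) \<in> Lam \<rightarrow>\<^sub>M Q"
    unfolding Q_def by (rule measurable_restrict) (simp cong: measurable_cong_sets)
  have dR: "distr Lam Q (\<lambda>w. \<lambda>e\<in>G. w e) = Q"
    using distr_PiM_reindex[of UNIV "\<lambda>_. \<mu>" id G] prob_mu by (simp add: Lam_def Q_def)
  have hW: "(\<lambda>\<omega>. h (\<lambda>e. W e \<omega>)) = (h \<circ> ext) \<circ> (\<lambda>\<omega>. \<lambda>e\<in>G. W e \<omega>)"
    and hR: "h = (h \<circ> ext) \<circ> (\<lambda>w. \<lambda>e\<in>G. w e)"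
    by (auto simp: fun_eq_iff ext_def intro!: dep_onD[OF dep])
  show "(\<lambda>\<omega>. h (\<lambda>e. W e \<omega>)) \<in> borel_measurable P"
    unfolding hW by (rule measurable_comp[OF mW hext])
  have "distr P borel (\<lambda>\<omega>. h (\<lambda>e. W e \<omega>)) = distr Q borel (h \<circ> ext)"
    unfolding hW by (subst distr_distr[OF hext mW, symmetric]) (simp only: dW)
  also have "\<dots> = distr Lam borel ((h \<circ> ext) \<circ> (\<lambda>w. \<lambda>e\<in>G. w e))"
    by (subst distr_distr[OF hext mR, symmetric]) (simp only: dR)
  finally show "distr P borel (\<lambda>\<omega>. h (\<lambda>e. W e \<omega>)) = distr Lam borel h"
    using hR by simp
qed

theorem theorem2p3:
  fixes E :: "'v \<Rightarrow> 'v \<Rightarrow> bool"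
    and Vn :: "nat \<Rightarrow> 'v set" and En :: "nat \<Rightarrow> 'v set set"
    and P :: "'w measure" and W :: "'v set \<Rightarrow> 'w \<Rightarrow> real"
    and \<mu> :: "real measure"
  assumes sym: "\<And>u v. E u v \<Longrightarrow> E v u"
    and irrefl: "\<And>v. \<not> E v v"
    and conn: "graph_connected E"
    and inf: "infinite (UNIV :: 'v set)"
    and lf: "locally_finite E"
    and vt: "vertex_transitive E"
    and sub: "\<And>n. is_subgraph E (Vn n) (En n)"
    and fin: "\<And>n. finite (Vn n)"
    and subconn: "\<And>n. connected_on (Vn n) (En n)"
    and grow: "filterlim (\<lambda>n. card (Vn n)) at_top sequentially"
    and bdry: "\<And>r. r > 0 \<Longrightarrow>
        (\<lambda>n. real (card {v \<in> Vn n. \<not> ball_within E v r (Vn n) (En n)}))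
          \<in> o(\<lambda>n. real (card (Vn n)))"
    and P: "prob_space P"
    and indep: "prob_space.indep_vars P (\<lambda>_. borel) W (gedges E)"
    and ident: "\<And>e. e \<in> gedges E \<Longrightarrow> distr P borel (W e) = \<mu>"
    and nonneg: "AE x in \<mu>. x \<ge> 0"
    and nondeg: "\<And>c. measure \<mu> {c} < 1"
    and moment: "\<exists>\<delta>>0. integrable \<mu> (\<lambda>x. \<bar>x\<bar> powr (4 + \<delta>))"
  defines "M \<equiv> (\<lambda>n \<omega>. mst_weight (Vn n) (En n) (\<lambda>e. W e \<omega>))"
  shows "(\<lambda>n. prob_space.variance P (M n)) \<in> \<Theta>(\<lambda>n. real (card (Vn n)))
         \<and> weak_conv_m
           (\<lambda>n. distr P borel (\<lambda>\<omega>. (M n \<omega> - prob_space.expectation P (M n))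
                                     / sqrt (prob_space.variance P (M n))))
           std_normal_distribution"
proof -
  interpret P: prob_space P by (rule P)
  \<comment> \<open>An infinite connected graph has an edge, and the weight of that edge shows that
    \<open>\<mu>\<close> is a probability measure on the Borel sets.\<close>
  obtain u v :: 'v where uv: "u \<noteq> v"
    using inf by (metis UNIV_eq_I finite.emptyI finite.insertI insertI1 insert_iff)
  have "E\<^sup>*\<^sup>* u v" using conn by (simp add: graph_connected_def)
  then obtain z where "E u z" using uv by (cases rule: converse_rtranclpE) auto
  hence e0: "{u, z} \<in> gedges E" by (auto simp: gedges_def)
  have rv: "W e \<in> borel_measurable P" if "e \<in> gedges E" for e
    using indep that by (auto simp: P.indep_vars_def2)
  have \<mu>: "\<mu> = distr P borel (W {u, z})" using ident[OF e0] by simp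
  have prob: "prob_space \<mu>" unfolding \<mu> by (rule P.prob_space_distr[OF rv[OF e0]])
  have sets: "sets \<mu> = sets borel" by (simp add: \<mu>)
  interpret iid \<mu> by (rule iid.intro[OF prob sets])
  obtain \<delta> where \<delta>: "\<delta> > 0" "integrable \<mu> (\<lambda>x. \<bar>x\<bar> powr (4 + \<delta>))" using moment by blast
  have mom3: "integrable \<mu> (\<lambda>x. \<bar>x\<bar> ^ 3)"
  proof (rule Bochner_Integration.integrable_bound)
    show "integrable \<mu> (\<lambda>x. 1 + \<bar>x\<bar> powr (4 + \<delta>))" using \<delta> by simp
    have "\<bar>x\<bar> ^ 3 \<le> 1 + \<bar>x\<bar> powr (4 + \<delta>)" for x :: real
    proof (cases "\<bar>x\<bar> \<le> 1")
      case True
      hence "\<bar>x\<bar> ^ 3 \<le> 1" by (intro power_le_one) auto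
      thus ?thesis using powr_ge_zero[of "\<bar>x\<bar>" "4 + \<delta>"] by linarith
    next
      case False
      hence "\<bar>x\<bar> ^ 3 = \<bar>x\<bar> powr 3" by (simp add: powr_numeral)
      also have "\<dots> \<le> \<bar>x\<bar> powr (4 + \<delta>)" using False \<delta>(1) by (intro powr_mono) auto
      finally show ?thesis by simp
    qed
    thus "AE x in \<mu>. norm (\<bar>x\<bar> ^ 3) \<le> norm (1 + \<bar>x\<bar> powr (4 + \<delta>))" by auto
  qed (simp cong: measurable_cong_sets)
  interpret S: mst_sequence E \<mu> Vn En
    by unfold_locales (use sym irrefl conn lf vt sub fin subconn grow bdry nonneg nondeg mom3 in blast)+
  have EG: "En n \<subseteq> gedges E" for n using sub[of n] by (simp add: is_subgraph_def)
  have M_meas: "M n \<in> borel_measurable P" for n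
  proof -
    have fS: "finite {T. spanning_tree (Vn n) (En n) T}"
      by (rule finite_subset[of _ "Pow (En n)"]) (use S.finite_En in \<open>auto simp: spanning_tree_def\<close>)
    show ?thesis unfolding M_def mst_weight_def
      by (intro borel_measurable_Min[OF fS] borel_measurable_sum rv)
        (use EG[of n] in \<open>auto simp: spanning_tree_def\<close>)
  qed
  \<comment> \<open>Almost surely the weights on \<open>En n\<close> are nonnegative, which
    identifies the tree weight with \<open>cmin\<close>.\<close>
  have M_AE: "AE \<omega> in P. M n \<omega> = S.mw n (\<lambda>e. W e \<omega>)" for n
  proof -
    have "AE \<omega> in P. 0 \<le> W e \<omega>" if "e \<in> En n" for e
    proof -
      have e: "e \<in> gedges E" using that EG by blast
      have "AE x in distr P borel (W e). 0 \<le> x" unfolding ident[OF e] by (rule nonneg)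
      thus ?thesis by (rule AE_distrD[OF rv[OF e]])
    qed
    hence "AE \<omega> in P. \<forall>e\<in>En n. 0 \<le> W e \<omega>" by (intro AE_finite_allI S.finite_En) auto
    thus ?thesis
    proof eventually_elim
      case (elim \<omega>)
      have "e \<subseteq> Vn n" if "e \<in> En n" for e using sub[of n] that by (auto simp: is_subgraph_def)
      thus ?case unfolding M_def S.mw_def
        by (intro mst_weight_eq_cmin S.finite_En subconn) (use elim in auto)
    qed
  qed
  \<comment> \<open>Mean, variance and standardised law depend on this law only, so both conclusions
    transfer from the canonical space.\<close>
  have law: "distr P borel (M n) = distr Lam borel (S.mw n)" for n
  proof -
    have dep: "dep_on (gedges E) (S.mw n)" by (rule dep_on_mono[OF S.mw.f_dep EG])
    have ne: "gedges E \<noteq> {}" using e0 by blast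
    note tr = distr_iid_family[OF P indep ident ne S.mw.f_meas dep]
    have "distr P borel (M n) = distr P borel (\<lambda>\<omega>. S.mw n (\<lambda>e. W e \<omega>))"
      by (rule distr_cong_AE) (use M_AE M_meas tr(1) in auto)
    thus ?thesis using tr(2) by simp
  qed
  have tr: "(\<integral>\<omega>. g (M n \<omega>) \<partial>P) = (\<E> w. g (S.mw n w))" if "g \<in> borel_measurable borel" for g :: "real \<Rightarrow> real" and n
  proof -
    have "(\<integral>\<omega>. g (M n \<omega>) \<partial>P) = (\<integral>x. g x \<partial>distr P borel (M n))"
      by (rule integral_distr[symmetric]) (use M_meas that in auto)
    also have "\<dots> = (\<E> w. g (S.mw n w))"
      unfolding law by (rule integral_distr) (use that in auto)
    finally show ?thesis .
  qed
  have mean: "P.expectation (M n) = (\<E> w. S.mw n w)" for n using tr[of "\<lambda>x. x"] by simp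
  have var: "P.variance (M n) = S.var n" for n
    unfolding mean S.var_def by (rule tr) simp
  have std: "distr P borel (\<lambda>\<omega>. (M n \<omega> - P.expectation (M n)) / sqrt (P.variance (M n))) = distr Lam borel (S.stdz n)" for n
  proof -
    define g where "g x = (x - P.expectation (M n)) / sqrt (P.variance (M n))" for x
    have g: "g \<in> borel_measurable borel" unfolding g_def by simp
    have "distr P borel (g \<circ> M n) = distr (distr P borel (M n)) borel g"
      by (rule distr_distr[symmetric, OF g M_meas])
    also have "\<dots> = distr Lam borel (g \<circ> S.mw n)"
      unfolding law by (rule distr_distr[OF g]) simp
    also have "g \<circ> S.mw n = S.stdz n" by (simp add: fun_eq_iff g_def S.stdz_def mean var[unfolded mean])
    finally show ?thesis by (simp add: g_def comp_def)
  qed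
  show ?thesis using S.variance_bigtheta S.stdz_weak_conv unfolding std unfolding var by simp
qed

end
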